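(* Let $\{n_k:k\ge 0\}$ be a sequence of positive integers, and for each $s\in\mathbb N$ for which some $n_k$ satisfies $2^s\le n_k<2^{s+1}$ let $A_s$ be the set of block endpoints associated with $\{n_k\}$ (defined in the context), with cardinality $|A_s|$. a) The weighted maximal operator $$\widetilde{\sigma}^{*,\nabla}F:=\sup_{k\in\mathbb N}\frac{|\sigma_{n_k}F|}{|A_{|n_k|}|^2}$$ is bounded from the martingale Hardy space $H_{1/2}(G)$ to the Lebesgue space $L_{1/2}(G)$, i.e. there is a constant $C<\infty$ such that $\|\widetilde{\sigma}^{*,\nabla}F\|_{1/2}\le C\|F\|_{H_{1/2}}$ for all $F\in H_{1/2}(G)$. b) (Sharpness) Suppose that $$\sup_{k\in\mathbb N}|A_{|n_k|}|=\infty$$ and let $\{\varphi_n\}_{n\in\mathbb N}$ be a nondecreasing sequence of positive real numbers satisfying $$\limsup_{k\to\infty}\frac{|A_{|n_k|}|^2}{\varphi_{|n_k|}}=\infty.$$ Then there exists a martingale $F\in H_{1/2}(G)$ such that $$\left\|\sup_{k\in\mathbb N}\frac{|\sigma_{n_k}F|}{\varphi_{|n_k|}}\right\|_{1/2}=\infty;$$ in particular the maximal operator $F\mapsto\sup_{k\in\mathbb N}|\sigma_{n_k}F|/\varphi_{|n_k|}$ is not bounded from $H_{1/2}(G)$ to $L_{1/2}(G)$.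
   Context: $\mathbb N=\{0,1,2,\dots\}$. $G=\prod_{j\in\mathbb N}Z_2$ is the complete direct product of countably many copies of the discrete group $Z_2=\{0,1\}$ (addition mod 2), with the product topology and normalized Haar (product) measure $\mu$; elements are sequences $x=(x_0,x_1,\dots)$. For $x\in G$ put $I_0(x)=G$ and $I_n(x)=\{y\in G:y_0=x_0,\dots,y_{n-1}=x_{n-1}\}$. Every $n\in\mathbb N$ is written uniquely as $n=\sum_{j\ge0}n_j2^j$, $n_j\in\{0,1\}$; for $n\ge1$, $|n|:=\max\{j:n_j\ne0\}$, so $2^{|n|}\le n<2^{|n|+1}$. The Walsh functions are $w_n(x)=\prod_{k\ge0}(-1)^{n_kx_k}$. Let $\zeta_n$ be the $\sigma$-algebra generated by $\{I_n(x):x\in G\}$. A martingale $F=(F_n,n\in\mathbb N)$ is understood with respect to $(\zeta_n)$; its maximal function is $F^*=\sup_n|F_n|$. For $0<p<\infty$, $\|f\|_p=(\int_G|f|^p\,d\mu)^{1/p}$, and $H_p(G)$ is the set of martingales $F$ with $\|F\|_{H_p}:=\|F^*\|_p<\infty$. The Walsh-Fourier coefficients of $F$ are $\widehat F(k)=\lim_{n\to\infty}\int_GF_nw_k\,d\mu$, the partial sums are $S_nF=\sum_{k=0}^{n-1}\widehat F(k)w_k$, and the Fejér means are $\sigma_nF=\frac1n\sum_{k=1}^nS_kF$ for $n\ge1$. Definition of $A_s$. Every positive integer $n$ can be written uniquely as a sum over its maximal blocks of consecutive binary digits equal to 1: $n=\sum_{i=1}^{r}\sum_{k=l_i}^{t_i}2^k$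 with $0\le l_1\le t_1\le l_2-2<l_2\le t_2\le\dots\le l_r-2<l_r\le t_r$. Call $\{l_1,t_1,\dots,l_r,t_r\}$ the set of block endpoints of $n$ (a set, so repeated values are counted once). Given the sequence $\{n_k\}$ and $s\in\mathbb N$, $A_s$ is the union of the sets of block endpoints of all members $n_k$ of the sequence with $2^s\le n_k<2^{s+1}$ (i.e. $|n_k|=s$), and $|A_s|$ is its cardinality. *)

theory Defs
  imports "HOL-Probability.Probability" "HOL-Library.Z2"
begin

type_synonym dyadic = "nat \<Rightarrow> bit"

text \<open>The product sigma-algebra below is the Borel sigma-algebra of the product topology
  (countably many finite factors), and the product of the uniform probability measures on the
  factors is the normalized Haar measure.\<close>

definition haar :: "dyadic measure" where
  "haar = PiM UNIV (\<lambda>_. uniform_count_measure (UNIV :: bit set))"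

definition cyl :: "nat \<Rightarrow> dyadic \<Rightarrow> dyadic set" where
  "cyl n x = {y. \<forall>j<n. y j = x j}"

definition zeta :: "nat \<Rightarrow> dyadic measure" where
  "zeta n = sigma UNIV (range (cyl n))"

definition msb :: "nat \<Rightarrow> nat" where
  "msb n = Max {j. bit n j}"

text \<open>Factors of the infinite product at positions where the digit of \<open>n\<close> is 0 equal 1,
  so only the finitely many nonzero digits contribute.\<close>

definition walsh :: "nat \<Rightarrow> dyadic \<Rightarrow> real" where
  "walsh n x = (\<Prod>k | bit n k. (- 1) ^ of_bool (x k = 1))"

definition dyadic_martingale :: "(nat \<Rightarrow> dyadic \<Rightarrow> real) \<Rightarrow> bool" where
  "dyadic_martingale F \<longleftrightarrow>
     (\<forall>n. F n \<in> borel_measurable (zeta n) \<and> integrable haar (F n)) \<and>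
     (\<forall>m n. m \<le> n \<longrightarrow> (AE x in haar. real_cond_exp haar (zeta m) (F n) x = F m x))"

text \<open>Powers with positive exponent, extended by \<open>\<infinity>\<close> to \<open>\<infinity>\<close>.\<close>

definition epowr :: "ennreal \<Rightarrow> real \<Rightarrow> ennreal" where
  "epowr a p = (if a = \<top> then \<top> else ennreal (enn2real a powr p))"

text \<open>Maximal functions may take the value \<open>\<infinity>\<close>, so (quasi-)norms are taken of
  \<open>[0,\<infinity>]\<close>-valued functions.\<close>

definition Lp_norm :: "real \<Rightarrow> (dyadic \<Rightarrow> ennreal) \<Rightarrow> ennreal" where
  "Lp_norm p f = epowr (\<integral>\<^sup>+ x. epowr (f x) p \<partial>haar) (1 / p)"

definition maximal_fun :: "(nat \<Rightarrow> dyadic \<Rightarrow> real) \<Rightarrow> dyadic \<Rightarrow> ennreal" where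
  "maximal_fun F x = (SUP n. ennreal \<bar>F n x\<bar>)"

definition hardy_norm :: "real \<Rightarrow> (nat \<Rightarrow> dyadic \<Rightarrow> real) \<Rightarrow> ennreal" where
  "hardy_norm p F = Lp_norm p (maximal_fun F)"

definition hardy_space :: "real \<Rightarrow> (nat \<Rightarrow> dyadic \<Rightarrow> real) set" where
  "hardy_space p = {F. dyadic_martingale F \<and> hardy_norm p F < \<infinity>}"

definition wf_coeff :: "(nat \<Rightarrow> dyadic \<Rightarrow> real) \<Rightarrow> nat \<Rightarrow> real" where
  "wf_coeff F k = lim (\<lambda>n. \<integral>x. F n x * walsh k x \<partial>haar)"

definition partial_sum :: "nat \<Rightarrow> (nat \<Rightarrow> dyadic \<Rightarrow> real) \<Rightarrow> dyadic \<Rightarrow> real" where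
  "partial_sum n F x = (\<Sum>k<n. wf_coeff F k * walsh k x)"

definition fejer :: "nat \<Rightarrow> (nat \<Rightarrow> dyadic \<Rightarrow> real) \<Rightarrow> dyadic \<Rightarrow> real" where
  "fejer n F x = (1 / real n) * (\<Sum>k=1..n. partial_sum k F x)"

definition block_decomp :: "nat \<Rightarrow> nat \<Rightarrow> (nat \<Rightarrow> nat) \<Rightarrow> (nat \<Rightarrow> nat) \<Rightarrow> bool" where
  "block_decomp n r l t \<longleftrightarrow>
     (\<forall>i\<in>{1..r}. l i \<le> t i) \<and>
     (\<forall>i\<in>{1..<r}. t i + 2 \<le> l (i + 1)) \<and>
     n = (\<Sum>i=1..r. \<Sum>k=l i..t i. 2 ^ k)"

text \<open>The decomposition is unique (on the indices \<open>1..r\<close>), so the union below is over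
  a single set of endpoints.\<close>

definition block_endpoints :: "nat \<Rightarrow> nat set" where
  "block_endpoints n = (\<Union>{l ` {1..r} \<union> t ` {1..r} | r l t. block_decomp n r l t})"

definition endpoint_set :: "(nat \<Rightarrow> nat) \<Rightarrow> nat \<Rightarrow> nat set" where
  "endpoint_set nk s = (\<Union>k\<in>{k. 2 ^ s \<le> nk k \<and> nk k < 2 ^ (s + 1)}. block_endpoints (nk k))"

definition weighted_fejer_max ::
  "(nat \<Rightarrow> nat) \<Rightarrow> (nat \<Rightarrow> real) \<Rightarrow> (nat \<Rightarrow> dyadic \<Rightarrow> real) \<Rightarrow> dyadic \<Rightarrow> ennreal" where
  "weighted_fejer_max nk \<phi> F x = (SUP k. ennreal (\<bar>fejer (nk k) F x\<bar> / \<phi> (msb (nk k))))"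

definition bounded_hardy_Lp ::
  "real \<Rightarrow> ((nat \<Rightarrow> dyadic \<Rightarrow> real) \<Rightarrow> dyadic \<Rightarrow> ennreal) \<Rightarrow> bool" where
  "bounded_hardy_Lp p T \<longleftrightarrow>
     (\<exists>C :: real. \<forall>F\<in>hardy_space p. Lp_norm p (T F) \<le> ennreal C * hardy_norm p F)"

lemma space_haar [simp]: "space haar = UNIV"
  by (simp add: haar_def space_PiM space_uniform_count_measure)

lemma finite_UNIV_bit: "finite (UNIV :: bit set)"
proof -
  have "(UNIV :: bit set) = {0, 1}"
    using bit.exhaust by auto
  then show ?thesis by (metis finite.emptyI finite_insert)
qed

lemma prob_space_haar: "prob_space haar"
  unfolding haar_def
  by (intro prob_space_PiM prob_space_uniform_count_measure finite_UNIV_bit) simp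

lemma sets_cyl: "cyl n x \<in> sets haar"
proof -
  have "cyl n x = {y \<in> space haar. \<forall>j\<in>{..<n}. y j \<in> {x j}}"
    by (auto simp: cyl_def)
  also have "\<dots> \<in> sets haar"
  proof (rule sets.sets_Collect_finite_All)
    fix j
    have "(\<lambda>y. y j) \<in> measurable haar (uniform_count_measure UNIV)"
      unfolding haar_def by (rule measurable_component_singleton) simp
    moreover have "{x j} \<in> sets (uniform_count_measure UNIV)"
      by (simp add: sets_uniform_count_measure)
    ultimately have "(\<lambda>y. y j) -` {x j} \<inter> space haar \<in> sets haar"
      by (rule measurable_sets)
    then show "{y \<in> space haar. y j \<in> {x j}} \<in> sets haar"
      by (simp add: vimage_def)
  qed simp
  finally show ?thesis .
qed

text \<open>Side condition under which \<^const>\<open>real_cond_exp\<close> is the conditional expectation.\<close>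

lemma subalgebra_zeta: "subalgebra haar (zeta n)"
proof -
  have "sigma_sets UNIV (range (cyl n)) \<subseteq> sets haar"
    using sets.sigma_sets_subset[of "range (cyl n)" haar] sets_cyl by auto
  then show ?thesis
    by (simp add: subalgebra_def zeta_def)
qed

end

theory Submission
  imports Defs
begin

text \<open>
  The Fejer mean of order \<open>n < 2 ^ M\<close> of a martingale only involves its \<open>M\<close>-th term, a function on
  the \<open>2 ^ M\<close> cylinders of length \<open>M\<close>. Identifying these with the numbers below \<open>2 ^ M\<close>, addition in
  the group becomes \<open>XOR\<close>, and all estimates are finite sums, uniform in \<open>M\<close>.

  Write \<open>S_n\<close> for \<open>n\<close> times the Fejer kernel. For \<open>n = 2 ^ (t + 1) - 2 ^ l + n'\<close> with \<open>n' < 2 ^ l\<close>,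
  applying the mirror formula for \<open>S\<close> at \<open>2 ^ m - q\<close> twice bounds \<open>\<bar>S_n\<bar>\<close> by
  \<open>3 (S_(2 ^ (t + 1)) + S_(2 ^ l)) + \<bar>S_n'\<bar>\<close>, so only the block endpoints of \<open>n\<close> contribute. The
  kernels \<open>S_(2 ^ m)\<close> are nonnegative, have square roots of bounded mean, and outside the class of 0
  their averages over classes modulo \<open>2 ^ N\<close> equal \<open>S_(2 ^ min m N)\<close>. Hence for an atom supported on a
  class modulo \<open>2 ^ N\<close> the supremum over \<open>\<bar>n\<bar> = s\<close>, weighted by \<open>\<bar>A_s\<bar>\<^sup>2\<close>, has an off-support
  square-root mean of order \<open>2 ^ (- N / 2 - s / 2)\<close>, which is summable over \<open>s \<ge> N\<close>. Stopping the
  martingale at dyadic levels decomposes it into such atoms.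

  For the sharpness, the atom \<open>a_s = 4 ^ s r_s\<close> on the class of 0 modulo \<open>2 ^ s\<close> satisfies
  \<open>\<bar>\<sigma>_n a_s\<bar> = 2 ^ s \<bar>S_(n - 2 ^ s)\<bar> / n\<close>. Each block endpoint of \<open>n\<close> other than \<open>0\<close> and \<open>s\<close> yields an
  index \<open>i\<close> and a class of measure \<open>2 ^ (- i - 2)\<close> on which \<open>\<bar>S_(n - 2 ^ s)\<bar> \<ge> 4 ^ i / 8\<close>; these classes
  are disjoint, so the square root of the supremum has integral at least of order \<open>\<bar>A_s\<bar>\<close>. A lacunary
  sum of such atoms is the required martingale.
\<close>

unbundle bit_operations_syntax

section \<open>Walsh--Dirichlet sums\<close>

definition rad :: "nat \<Rightarrow> nat \<Rightarrow> real" where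
  "rad j x = (if bit x j then - 1 else 1)"

definition wal :: "nat \<Rightarrow> nat \<Rightarrow> real" where
  "wal n x = (\<Prod>j | bit n j. rad j x)"

definition dir_ker :: "nat \<Rightarrow> nat \<Rightarrow> real" where
  "dir_ker n x = (\<Sum>j<n. wal j x)"

text \<open>\<open>dir_sum n\<close> is \<open>n\<close> times the Fejer kernel.\<close>

definition dir_sum :: "nat \<Rightarrow> nat \<Rightarrow> real" where
  "dir_sum n x = (\<Sum>k=1..n. dir_ker k x)"

section \<open>Binary digits and Walsh functions as characters\<close>

lemma bit_less_exp: "bit n j \<Longrightarrow> n < 2 ^ M \<Longrightarrow> j < M" for n :: nat
  by (metis bit_take_bit_iff take_bit_nat_eq_self)

lemma finite_bits: "finite {j. bit n j}" for n :: nat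
proof (rule finite_subset)
  show "{j. bit n j} \<subseteq> {..<n}"
    using bit_less_exp[of n _ n] by (auto simp: less_exp)
qed simp

lemma bit_exp_add: "n < 2 ^ m \<Longrightarrow> bit (2 ^ m + n) j \<longleftrightarrow> j = m \<or> bit n j" for n :: nat
  using bit_less_exp[of n _ m]
  by (subst bit_disjunctive_add_iff) (auto simp: bit_exp_iff)

text \<open>Subtraction from a number whose \<open>m\<close> digits are all 1 never borrows, so it
  flips the digits. This turns the reflection of an index into a translation by \<open>XOR\<close>,
  under which Walsh functions multiply.\<close>

lemma exp_mirror_xor:
  fixes i :: nat
  assumes "i < 2 ^ m"
  shows "2 ^ m - 1 - i = mask m XOR i"
proof -
  have b: "\<And>j. bit i j \<Longrightarrow> j < m" using bit_less_exp assms by blast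
  have "(mask m XOR i) + i = (mask m XOR i) OR i"
    by (rule disjunctive_add_eq_or) (use b in \<open>auto simp: bit_eq_iff bit_simps\<close>)
  also have "\<dots> = mask m"
    using b by (auto simp: bit_eq_iff bit_simps)
  finally show ?thesis by (simp add: mask_eq_exp_minus_1)
qed

lemma wal_0 [simp]: "wal 0 x = 1"
  by (simp add: wal_def)

lemma abs_rad [simp]: "\<bar>rad j x\<bar> = 1" "rad j x * rad j x = 1"
  by (auto simp: rad_def)

lemma abs_wal [simp]: "\<bar>wal n x\<bar> = 1"
  by (simp add: wal_def abs_prod)

lemma wal_exp_add: "n < 2 ^ m \<Longrightarrow> wal (2 ^ m + n) x = rad m x * wal n x"
proof -
  assume n: "n < 2 ^ m"
  have "{j. bit (2 ^ m + n) j} = insert m {j. bit n j}"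
    using bit_exp_add[OF n] by auto
  moreover have "m \<notin> {j. bit n j}" using bit_less_exp n by blast
  ultimately show ?thesis
    unfolding wal_def by (simp add: finite_bits)
qed

lemma wal_eq_prod: "n < 2 ^ M \<Longrightarrow> wal n x = (\<Prod>j<M. if bit n j then rad j x else 1)"
proof -
  assume n: "n < 2 ^ M"
  have "{j. bit n j} = {j \<in> {..<M}. bit n j}" using bit_less_exp n by auto
  then show ?thesis
    unfolding wal_def by (simp only: prod.inter_filter finite_lessThan)
qed

lemma wal_xor_left: "wal (n XOR k) x = wal n x * wal k x"
proof -
  define M where "M = n + k"
  have n: "n < 2 ^ M" "k < 2 ^ M"
    unfolding M_def by (meson le_add1 le_add2 le_less_trans less_exp order_less_le_trans power_increasing one_le_numeral)+
  have "n XOR k < 2 ^ M"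
    using n by (metis take_bit_nat_eq_self take_bit_nat_less_exp take_bit_xor)
  then show ?thesis
    using n by (simp add: wal_eq_prod flip: prod.distrib)
      (rule prod.cong, auto simp: bit_simps rad_def)
qed

lemma wal_mirror: "i < 2 ^ m \<Longrightarrow> wal (2 ^ m - 1 - i) x = wal (2 ^ m - 1) x * wal i x"
  using exp_mirror_xor[of i m] by (simp add: wal_xor_left mask_eq_exp_minus_1)

lemma rad_xor: "rad j (x XOR y) = rad j x * rad j y"
  by (auto simp: rad_def bit_simps)

lemma wal_xor: "wal n (x XOR y) = wal n x * wal n y"
  by (simp add: wal_def rad_xor prod.distrib)

lemma rad_mod: "j < m \<Longrightarrow> rad j (x mod 2 ^ m) = rad j x"
  by (simp add: rad_def bit_take_bit_iff flip: take_bit_eq_mod)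

lemma wal_mod: "n < 2 ^ m \<Longrightarrow> wal n (x mod 2 ^ m) = wal n x"
  unfolding wal_def using bit_less_exp by (intro prod.cong) (auto simp: rad_mod)

lemma dir_ker_mod: "n \<le> 2 ^ m \<Longrightarrow> dir_ker n (x mod 2 ^ m) = dir_ker n x"
  unfolding dir_ker_def by (intro sum.cong) (auto simp: wal_mod)

lemma dir_sum_mod: "n \<le> 2 ^ m \<Longrightarrow> dir_sum n (x mod 2 ^ m) = dir_sum n x"
  unfolding dir_sum_def by (intro sum.cong) (auto simp: dir_ker_mod)

section \<open>Shift and mirror formulas for the kernels\<close>

lemma dir_ker_0 [simp]: "dir_ker 0 x = 0" and dir_ker_1 [simp]: "dir_ker (Suc 0) x = 1"
  by (simp_all add: dir_ker_def)

lemma dir_sum_0 [simp]: "dir_sum 0 x = 0" and dir_sum_Suc: "dir_sum (Suc n) x = dir_sum n x + dir_ker (Suc n) x"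
  by (simp_all add: dir_sum_def)

lemma dir_ker_exp_add: "k \<le> 2 ^ m \<Longrightarrow> dir_ker (2 ^ m + k) x = dir_ker (2 ^ m) x + rad m x * dir_ker k x"
proof (induction k)
  case (Suc k)
  then show ?case
    using wal_exp_add[of k m x] by (simp add: dir_ker_def algebra_simps)
qed simp

lemma dir_sum_exp_add:
  "k \<le> 2 ^ m \<Longrightarrow> dir_sum (2 ^ m + k) x = dir_sum (2 ^ m) x + real k * dir_ker (2 ^ m) x + rad m x * dir_sum k x"
proof (induction k)
  case (Suc k)
  then show ?case
    using dir_ker_exp_add[of "Suc k" m x] by (simp add: dir_sum_Suc algebra_simps)
qed simp

text \<open>The characters removed from the end of \<open>dir_ker (2 ^ m)\<close> are, by
  \<open>wal_mirror\<close>, the first \<open>k\<close> characters times the fixed factor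
  \<open>wal (2 ^ m - 1)\<close>.\<close>

lemma dir_ker_mirror:
  "k \<le> 2 ^ m \<Longrightarrow> dir_ker (2 ^ m - k) x = dir_ker (2 ^ m) x - wal (2 ^ m - 1) x * dir_ker k x"
proof (induction k)
  case (Suc k)
  have e: "2 ^ m - k = Suc (2 ^ m - Suc k)" using Suc.prems by simp
  have "dir_ker (2 ^ m - k) x = dir_ker (2 ^ m - Suc k) x + wal (2 ^ m - 1 - k) x"
    unfolding e dir_ker_def by simp
  then show ?case
    using Suc wal_mirror[of k m x] by (simp add: dir_ker_def algebra_simps)
qed simp

text \<open>Lowering the index from \<open>2 ^ m\<close> to \<open>2 ^ m - Suc q\<close> removes
  \<open>Suc q\<close> kernels, each given by \<open>dir_ker_mirror\<close>. One of them is mirrored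
  to \<open>dir_ker 0\<close>, which is 0, so the last term involves
  \<open>dir_sum q\<close>.\<close>

lemma dir_sum_mirror:
  "q < 2 ^ m \<Longrightarrow> dir_sum (2 ^ m - Suc q) x
     = dir_sum (2 ^ m) x - real (Suc q) * dir_ker (2 ^ m) x + wal (2 ^ m - 1) x * dir_sum q x"
proof (induction q)
  case 0
  have e: "2 ^ m = Suc (2 ^ m - Suc 0)" by simp
  have "dir_sum (2 ^ m) x = dir_sum (2 ^ m - Suc 0) x + dir_ker (2 ^ m) x"
    using dir_sum_Suc[of "2 ^ m - Suc 0" x] e by simp
  then show ?case by simp
next
  case (Suc q)
  have e: "2 ^ m - Suc q = Suc (2 ^ m - Suc (Suc q))" using Suc.prems by simp
  have "dir_sum (2 ^ m - Suc q) x = dir_sum (2 ^ m - Suc (Suc q)) x + dir_ker (2 ^ m - Suc q) x"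
    using dir_sum_Suc[of "2 ^ m - Suc (Suc q)" x] e by simp
  then show ?case
    using Suc dir_ker_mirror[of "Suc q" m x] by (simp add: dir_sum_Suc algebra_simps)
qed

section \<open>Kernels at powers of two\<close>

lemma wal_cong_zero: "n < 2 ^ m \<Longrightarrow> x mod 2 ^ m = 0 \<Longrightarrow> wal n x = 1"
  using wal_mod[of n m x] by (simp add: wal_def rad_def)

lemma dir_ker_at_zero: "n \<le> 2 ^ m \<Longrightarrow> x mod 2 ^ m = 0 \<Longrightarrow> dir_ker n x = real n"
  unfolding dir_ker_def by (simp add: wal_cong_zero[of _ m])

lemma dir_sum_at_zero: "n \<le> 2 ^ m \<Longrightarrow> x mod 2 ^ m = 0 \<Longrightarrow> dir_sum n x = real n * (real n + 1) / 2"
proof (induction n)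
  case (Suc n)
  then show ?case by (simp add: dir_sum_Suc dir_ker_at_zero field_simps)
qed simp

lemma dir_ker_exp_Suc: "dir_ker (2 ^ Suc m) x = dir_ker (2 ^ m) x * (1 + rad m x)"
  using dir_ker_exp_add[of "2 ^ m" m x] by (simp add: algebra_simps mult_2)

lemma mod_exp_Suc_eq_0_iff: "x mod 2 ^ Suc m = 0 \<longleftrightarrow> x mod 2 ^ m = 0 \<and> \<not> bit x m" for x :: nat
proof -
  have "take_bit k x = 0 \<longleftrightarrow> (\<forall>j<k. \<not> bit x j)" for k
    by (simp add: bit_eq_iff[of _ "0 :: nat"] bit_take_bit_iff)
  then have "take_bit (Suc m) x = 0 \<longleftrightarrow> take_bit m x = 0 \<and> \<not> bit x m"
    by (metis less_Suc_eq)
  then show ?thesis by (simp add: take_bit_eq_mod)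
qed

text \<open>Paley's formula: \<open>dir_ker_exp_Suc\<close> makes the kernel a product of factors
  \<open>1 + rad j x\<close>, each equal to 2 or 0.\<close>

lemma dir_ker_exp: "dir_ker (2 ^ m) x = (if x mod 2 ^ m = 0 then 2 ^ m else 0)"
proof (induction m)
  case (Suc m)
  show ?case unfolding dir_ker_exp_Suc Suc mod_exp_Suc_eq_0_iff by (simp add: rad_def)
qed simp

lemma dir_sum_exp_Suc: "dir_sum (2 ^ Suc m) x = dir_sum (2 ^ m) x * (1 + rad m x) + 2 ^ m * dir_ker (2 ^ m) x"
  using dir_sum_exp_add[of "2 ^ m" m x] by (simp add: algebra_simps mult_2)

lemma dir_sum_exp_nonneg: "dir_sum (2 ^ m) x \<ge> 0"
proof (induction m)
  case (Suc m)
  then show ?case unfolding dir_sum_exp_Suc by (auto simp: rad_def dir_ker_exp)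
qed (simp add: dir_sum_def)

text \<open>Only the class of 0 matters, and there \<open>dir_sum (2 ^ m) x\<close> is
  \<open>2 ^ m * (2 ^ m + 1) / 2\<close>. This absorbs the Dirichlet terms of the mirror formula
  into nonnegative kernels.\<close>

lemma dir_ker_le_dir_sum_exp: "2 ^ m * dir_ker (2 ^ m) x \<le> 2 * dir_sum (2 ^ m) x"
proof (cases "x mod 2 ^ m = 0")
  case True
  then show ?thesis by (simp add: dir_ker_exp dir_sum_at_zero[of _ m] algebra_simps)
qed (use dir_sum_exp_nonneg in \<open>simp add: dir_ker_exp\<close>)

lemma dir_sum_block:
  assumes "l \<le> t" "n < 2 ^ l"
  shows "\<bar>dir_sum (2 ^ Suc t - 2 ^ l + n) x\<bar> \<le> 3 * (dir_sum (2 ^ Suc t) x + dir_sum (2 ^ l) x) + \<bar>dir_sum n x\<bar>"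
proof -
  \<comment> \<open>With this \<open>q\<close> the index is \<open>2 ^ Suc t - Suc q\<close>, and
    \<open>q\<close> itself is a reflection at \<open>2 ^ l\<close>. The mirror formula is used at
    level \<open>l\<close> first, then at \<open>Suc t\<close>; each time the Dirichlet term costs
    twice the kernel, whence the factor 3.\<close>
  define q where "q = 2 ^ l - Suc n"
  have lt: "(2::nat) ^ l \<le> 2 ^ Suc t" using assms by (intro power_increasing) auto
  have q: "Suc q \<le> 2 ^ l" "q < 2 ^ Suc t" "2 ^ Suc t - 2 ^ l + n = 2 ^ Suc t - Suc q"
    using assms lt unfolding q_def by auto
  have d: "dir_ker (2 ^ m) x \<ge> 0" for m by (simp add: dir_ker_exp)
  have "\<bar>dir_sum q x\<bar> \<le> dir_sum (2 ^ l) x + real (Suc n) * dir_ker (2 ^ l) x + \<bar>wal (2 ^ l - 1) x * dir_sum n x\<bar>"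
    unfolding q_def dir_sum_mirror[OF assms(2)] using d[of l] dir_sum_exp_nonneg[of l x]
    by (smt (verit) mult_nonneg_nonneg of_nat_0_le_iff)
  also have "real (Suc n) * dir_ker (2 ^ l) x \<le> 2 ^ l * dir_ker (2 ^ l) x"
  proof (intro mult_right_mono d)
    have "Suc n \<le> 2 ^ l" using assms(2) by simp
    then show "real (Suc n) \<le> 2 ^ l" by (metis of_nat_le_iff of_nat_numeral of_nat_power)
  qed
  also have "\<dots> \<le> 2 * dir_sum (2 ^ l) x" by (rule dir_ker_le_dir_sum_exp)
  finally have 1: "\<bar>dir_sum q x\<bar> \<le> 3 * dir_sum (2 ^ l) x + \<bar>dir_sum n x\<bar>" by (simp add: abs_mult)
  have "\<bar>dir_sum (2 ^ Suc t - Suc q) x\<bar> \<le> dir_sum (2 ^ Suc t) x + real (Suc q) * dir_ker (2 ^ Suc t) x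
      + \<bar>wal (2 ^ Suc t - 1) x * dir_sum q x\<bar>"
    unfolding dir_sum_mirror[OF q(2)] using d[of "Suc t"] dir_sum_exp_nonneg[of "Suc t" x]
    by (smt (verit) mult_nonneg_nonneg of_nat_0_le_iff)
  also have "real (Suc q) * dir_ker (2 ^ Suc t) x \<le> 2 ^ Suc t * dir_ker (2 ^ Suc t) x"
  proof (intro mult_right_mono d)
    have "Suc q \<le> 2 ^ Suc t" using q(1) lt by linarith
    then show "real (Suc q) \<le> 2 ^ Suc t" by (metis of_nat_le_iff of_nat_numeral of_nat_power)
  qed
  also have "\<dots> \<le> 2 * dir_sum (2 ^ Suc t) x" by (rule dir_ker_le_dir_sum_exp)
  finally show ?thesis unfolding q(3) using 1 by (simp add: abs_mult)
qed

section \<open>Blocks of binary digits\<close>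

lemma sum_exp_block: "l \<le> t \<Longrightarrow> (\<Sum>k=l..t. 2 ^ k) = (2 ^ Suc t - 2 ^ l :: nat)"
proof (induction t rule: dec_induct)
  case (step t)
  have "(2::nat) ^ l \<le> 2 ^ Suc t" using step by (intro power_increasing) auto
  then show ?case using step by simp
qed simp

lemma exp_block_eq_push_bit: "l \<le> t \<Longrightarrow> 2 ^ Suc t - 2 ^ l = push_bit l (mask (Suc t - l) :: nat)"
proof -
  assume "l \<le> t"
  then have "(2::nat) ^ Suc t = 2 ^ (Suc t - l) * 2 ^ l" by (simp flip: power_add)
  then show ?thesis
    by (simp only: push_bit_eq_mult mask_eq_exp_minus_1 diff_mult_distrib mult_1)
qed

lemma bit_exp_block_add:
  fixes n :: nat
  assumes "l \<le> t" "n < 2 ^ l"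
  shows "bit (2 ^ Suc t - 2 ^ l + n) j \<longleftrightarrow> l \<le> j \<and> j \<le> t \<or> bit n j"
proof -
  have "j < l" if "bit n j" for j using bit_less_exp that assms(2) by blast
  then show ?thesis
    unfolding exp_block_eq_push_bit[OF assms(1)] using assms(1)
    by (subst bit_disjunctive_add_iff) (auto simp: bit_simps dest: leD)
qed

lemma block_decomp_0: "block_decomp n 0 l t \<longleftrightarrow> n = 0"
  by (simp add: block_decomp_def)

text \<open>Splitting off the top block is what makes induction on the number of blocks
  possible.\<close>

lemma block_decomp_Suc:
  "block_decomp n (Suc r) l t \<longleftrightarrow>
     (\<exists>n'. block_decomp n' r l t \<and> n = 2 ^ Suc (t (Suc r)) - 2 ^ l (Suc r) + n' \<and>
        l (Suc r) \<le> t (Suc r) \<and> (r > 0 \<longrightarrow> t r + 2 \<le> l (Suc r)))"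
proof -
  have i: "{1..Suc r} = insert (Suc r) {1..r}" by auto
  have j: "{1..<Suc r} = (if r > 0 then insert r {1..<r} else {})" by auto
  show ?thesis
    unfolding block_decomp_def i j using sum_exp_block[of "l (Suc r)" "t (Suc r)"] by auto
qed

lemma block_decomp_less: "block_decomp n r l t \<Longrightarrow> r > 0 \<Longrightarrow> n < 2 ^ Suc (t r)"
proof (induction r arbitrary: n)
  case (Suc r)
  then obtain n' where n': "block_decomp n' r l t"
    "n = 2 ^ Suc (t (Suc r)) - 2 ^ l (Suc r) + n'" "l (Suc r) \<le> t (Suc r)"
    "r > 0 \<longrightarrow> t r + 2 \<le> l (Suc r)"
    unfolding block_decomp_Suc by blast
  have "n' < 2 ^ l (Suc r)"
  proof (cases "r = 0")
    case False
    then have "n' < 2 ^ Suc (t r)" using Suc.IH n' by blast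
    also have "\<dots> \<le> 2 ^ l (Suc r)" using n' False by (intro power_increasing) auto
    finally show ?thesis .
  qed (use n' in \<open>simp add: block_decomp_0\<close>)
  moreover have "(2::nat) ^ l (Suc r) \<le> 2 ^ Suc (t (Suc r))"
    using n' by (intro power_increasing) auto
  ultimately show ?case using n' by linarith
qed simp

text \<open>The gap before the top block leaves a remainder below \<open>2 ^ l (Suc r)\<close>, as
  \<open>dir_sum_block\<close> and \<open>bit_exp_block_add\<close> demand.\<close>

lemma block_decomp_SucE:
  assumes "block_decomp n (Suc r) l t"
  obtains n' where "block_decomp n' r l t" "n' < 2 ^ l (Suc r)" "l (Suc r) \<le> t (Suc r)"
    "r > 0 \<Longrightarrow> t r + 2 \<le> l (Suc r)" "n = 2 ^ Suc (t (Suc r)) - 2 ^ l (Suc r) + n'"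
proof -
  obtain n' where n': "block_decomp n' r l t"
    "n = 2 ^ Suc (t (Suc r)) - 2 ^ l (Suc r) + n'" "l (Suc r) \<le> t (Suc r)"
    "r > 0 \<longrightarrow> t r + 2 \<le> l (Suc r)"
    using assms unfolding block_decomp_Suc by blast
  have "n' < 2 ^ l (Suc r)"
  proof (cases "r = 0")
    case False
    then have "n' < 2 ^ Suc (t r)" using block_decomp_less n' by blast
    also have "\<dots> \<le> 2 ^ l (Suc r)" using n' False by (intro power_increasing) auto
    finally show ?thesis .
  qed (use n' in \<open>simp add: block_decomp_0\<close>)
  then show thesis using n' that by blast
qed

lemma bit_block_decomp:
  "block_decomp n r l t \<Longrightarrow> bit n j \<longleftrightarrow> (\<exists>i\<in>{1..r}. l i \<le> j \<and> j \<le> t i)"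
proof (induction r arbitrary: n)
  case (Suc r)
  obtain n' where n': "block_decomp n' r l t" "n' < 2 ^ l (Suc r)" "l (Suc r) \<le> t (Suc r)"
    "n = 2 ^ Suc (t (Suc r)) - 2 ^ l (Suc r) + n'"
    using block_decomp_SucE[OF Suc.prems] by metis
  have i: "{1..Suc r} = insert (Suc r) {1..r}" by auto
  show ?case unfolding i n'(4) bit_exp_block_add[OF n'(3,2)] using Suc.IH[OF n'(1)] by auto
qed (simp add: block_decomp_0)

text \<open>Iterates \<open>dir_sum_block\<close> from the top block downwards; after the last block
  the remaining index is 0.\<close>

lemma abs_dir_sum_le:
  "block_decomp n r l t \<Longrightarrow> \<bar>dir_sum n x\<bar> \<le> 3 * (\<Sum>i=1..r. dir_sum (2 ^ Suc (t i)) x + dir_sum (2 ^ l i) x)"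
proof (induction r arbitrary: n)
  case (Suc r)
  obtain n' where n': "block_decomp n' r l t" "n' < 2 ^ l (Suc r)" "l (Suc r) \<le> t (Suc r)"
    "n = 2 ^ Suc (t (Suc r)) - 2 ^ l (Suc r) + n'"
    using block_decomp_SucE[OF Suc.prems] by metis
  show ?case
    using dir_sum_block[OF n'(3,2), of x] Suc.IH[OF n'(1)] n'(4)
    by (simp del: power_Suc add: algebra_simps)
qed (simp add: block_decomp_0)

lemma block_decomp_order:
  assumes "block_decomp n r l t" "1 \<le> i" "i < j" "j \<le> r"
  shows "t i + 2 \<le> l j"
  using assms(3,4)
proof (induction j)
  case (Suc j)
  have s: "t j + 2 \<le> l (Suc j)" if "1 \<le> j" "Suc j \<le> r"
    using assms(1) that unfolding block_decomp_def by (auto dest!: bspec[of _ _ j])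
  show ?case
  proof (cases "i = j")
    case False
    moreover have "l j \<le> t j" using assms(1,2) Suc.prems False unfolding block_decomp_def by auto
    ultimately show ?thesis using Suc s assms(2) by force
  qed (use s Suc.prems assms(2) in auto)
qed simp

lemma block_decomp_le: "block_decomp n r l t \<Longrightarrow> i \<in> {1..r} \<Longrightarrow> l i \<le> t i"
  unfolding block_decomp_def by blast

lemma block_decomp_exists_less: "n < 2 ^ M \<Longrightarrow> \<exists>r l t. block_decomp n r l t"
proof (induction M arbitrary: n)
  case 0
  then have "block_decomp n 0 id id" by (simp add: block_decomp_0)
  then show ?case by blast
next
  case (Suc M)
  show ?case
  proof (cases "n < 2 ^ M")
    case False
    define n' where "n' = n - 2 ^ M"
    have n': "n = 2 ^ M + n'" "n' < 2 ^ M" using False Suc.prems by (auto simp: n'_def)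
    obtain r l t where d: "block_decomp n' r l t" using Suc.IH n'(2) by blast
    have tM: "t r < M" if "r > 0"
    proof -
      have "bit n' (t r)"
        unfolding bit_block_decomp[OF d] using block_decomp_le[OF d, of r] that
        by (intro bexI[of _ r]) auto
      then show ?thesis using bit_less_exp n'(2) by blast
    qed
    show ?thesis
    \<comment> \<open>The new top digit \<open>M\<close> lengthens the top block if that ends at
      \<open>M - 1\<close>; otherwise it forms a block of length 1.\<close>
    proof (cases "r > 0 \<and> Suc (t r) = M")
      case True
      then obtain r0 where r0: "r = Suc r0" by (cases r) auto
      obtain m where m: "block_decomp m r0 l t" "l r \<le> t r" "r0 > 0 \<Longrightarrow> t r0 + 2 \<le> l r"
        "n' = 2 ^ Suc (t r) - 2 ^ l r + m"
        using block_decomp_SucE[of n' r0 l t] d r0 by metis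
      have "block_decomp m r0 l (t(r := M))"
        using m(1) unfolding block_decomp_def r0 by (auto intro!: sum.cong)
      moreover have "n = 2 ^ Suc M - 2 ^ l r + m"
      proof -
        have "(2::nat) ^ l r \<le> 2 ^ M" using m True by (intro power_increasing) auto
        moreover have "n' = 2 ^ M - 2 ^ l r + m" using m(4) True by (simp del: power_Suc)
        moreover have "(2::nat) ^ Suc M = 2 ^ M + 2 ^ M" by simp
        ultimately show ?thesis using n'(1) by linarith
      qed
      ultimately have "block_decomp n (Suc r0) l (t(r := M))"
        unfolding block_decomp_Suc using m True r0 by auto
      then show ?thesis by blast
    next
      case False
      have "block_decomp n' r (l(Suc r := M)) (t(Suc r := M))"
        using d unfolding block_decomp_def by (auto intro!: sum.cong)
      then have "block_decomp n (Suc r) (l(Suc r := M)) (t(Suc r := M))"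
        unfolding block_decomp_Suc using tM False n' by auto
      then show ?thesis by blast
    qed
  qed (use Suc.IH in blast)
qed

lemma block_decomp_exists: "\<exists>r l t. block_decomp n r l t"
  using block_decomp_exists_less[OF less_exp] .

lemma block_endpoints_superset:
  "block_decomp n r l t \<Longrightarrow> l ` {1..r} \<union> t ` {1..r} \<subseteq> block_endpoints n"
  unfolding block_endpoints_def by blast

text \<open>A digit 1 next to an end, outside the block, would lie in another block, which the gap
  in \<open>block_decomp_order\<close> excludes. The form in digits serves the later count of
  endpoints.\<close>

lemma block_endpoints_bits:
  assumes "e \<in> block_endpoints n"
  shows "bit n e \<and> ((e > 0 \<longrightarrow> \<not> bit n (e - 1)) \<or> \<not> bit n (Suc e))"
proof -
  obtain r l t i where d: "block_decomp n r l t" and i: "i \<in> {1..r}" "e = l i \<or> e = t i"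
    using assms unfolding block_endpoints_def by blast
  note b = bit_block_decomp[OF d]
  have le: "l i' \<le> t i'" if "i' \<in> {1..r}" for i' using block_decomp_le[OF d] that by blast
  have "bit n e" using b i le[of i] by auto
  moreover have "\<not> bit n (e - 1)" if "e = l i" "e > 0"
  proof
    assume "bit n (e - 1)"
    then obtain i' where i': "i' \<in> {1..r}" "l i' \<le> e - 1" "e - 1 \<le> t i'" using b by auto
    consider "i' < i" | "i' = i" | "i < i'" by linarith
    then show False
      using block_decomp_order[OF d, of i' i] block_decomp_order[OF d, of i i'] i i' that le[of i]
      by cases auto
  qed
  moreover have "\<not> bit n (Suc e)" if "e = t i"
  proof
    assume "bit n (Suc e)"
    then obtain i' where i': "i' \<in> {1..r}" "l i' \<le> Suc e" "Suc e \<le> t i'" using b by auto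
    consider "i' < i" | "i' = i" | "i < i'" by linarith
    then show False
      using block_decomp_order[OF d, of i' i] block_decomp_order[OF d, of i i'] i i' that le[of i]
      by cases auto
  qed
  ultimately show ?thesis using i by blast
qed

section \<open>Endpoints of a whole level\<close>

lemma endpoint_set_bits:
  assumes "e \<in> endpoint_set nk s"
  shows "\<exists>k. 2 ^ s \<le> nk k \<and> nk k < 2 ^ Suc s \<and> bit (nk k) e \<and>
    ((e > 0 \<longrightarrow> \<not> bit (nk k) (e - 1)) \<or> \<not> bit (nk k) (Suc e))"
  using assms block_endpoints_bits unfolding endpoint_set_def by force

lemma endpoint_set_subset: "endpoint_set nk s \<subseteq> {..s}"
  using endpoint_set_bits[of _ nk s] bit_less_exp less_Suc_eq_le by blast

lemma finite_endpoint_set: "finite (endpoint_set nk s)"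
  using endpoint_set_subset finite_subset by blast

lemma card_endpoint_set_pos:
  assumes "2 ^ s \<le> nk k" "nk k < 2 ^ Suc s"
  shows "card (endpoint_set nk s) > 0"
proof -
  obtain r l t where d: "block_decomp (nk k) r l t" using block_decomp_exists by blast
  have "r > 0"
  proof (rule ccontr)
    assume "\<not> r > 0"
    then have "nk k = 0" using d by (simp add: block_decomp_0)
    then show False using assms by simp
  qed
  then have "l 1 \<in> block_endpoints (nk k)"
    using block_endpoints_superset[OF d] by (auto simp: image_subset_iff)
  then have "l 1 \<in> endpoint_set nk s" unfolding endpoint_set_def using assms by auto
  then show ?thesis using finite_endpoint_set card_gt_0_iff by blast
qed

text \<open>The kernels at powers of two are nonnegative, so the endpoints of one index may be
  enlarged to those of its whole level. The bound then no longer depends on \<open>k\<close>, which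
  suits the supremum.\<close>

lemma abs_dir_sum_le_endpoints:
  assumes "2 ^ s \<le> nk k" "nk k < 2 ^ Suc s"
  shows "\<bar>dir_sum (nk k) x\<bar> \<le> 3 * (\<Sum>e\<in>endpoint_set nk s. dir_sum (2 ^ Suc e) x + dir_sum (2 ^ e) x)"
proof -
  obtain r l t where d: "block_decomp (nk k) r l t" using block_decomp_exists by blast
  have le: "l i \<le> t i" if "i \<in> {1..r}" for i using block_decomp_le[OF d] that by blast
  \<comment> \<open>Injectivity turns sums over blocks into sums over sets. Left and right ends are
    summed separately, so a block with \<open>l i = t i\<close> causes no collision.\<close>
  have "l i \<noteq> l j \<and> t i \<noteq> t j" if "i \<in> {1..r}" "j \<in> {1..r}" "i < j" for i j
    using block_decomp_order[OF d, of i j] le[of i] le[of j] that by auto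
  then have "inj_on l {1..r}" "inj_on t {1..r}"
    by (auto intro!: linorder_inj_onI')
  then have *: "(\<Sum>i=1..r. dir_sum (2 ^ Suc (t i)) x) = (\<Sum>e\<in>t ` {1..r}. dir_sum (2 ^ Suc e) x)"
    "(\<Sum>i=1..r. dir_sum (2 ^ l i) x) = (\<Sum>e\<in>l ` {1..r}. dir_sum (2 ^ e) x)"
    by (simp_all add: sum.reindex)
  have "t ` {1..r} \<subseteq> endpoint_set nk s" "l ` {1..r} \<subseteq> endpoint_set nk s"
    using block_endpoints_superset[OF d] assms unfolding endpoint_set_def by auto
  then have "(\<Sum>e\<in>t ` {1..r}. dir_sum (2 ^ Suc e) x) \<le> (\<Sum>e\<in>endpoint_set nk s. dir_sum (2 ^ Suc e) x)"
    and "(\<Sum>e\<in>l ` {1..r}. dir_sum (2 ^ e) x) \<le> (\<Sum>e\<in>endpoint_set nk s. dir_sum (2 ^ e) x)"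
    by (auto intro!: sum_mono2 finite_endpoint_set dir_sum_exp_nonneg simp del: power_Suc)
  then show ?thesis using abs_dir_sum_le[OF d, of x] * by (simp add: sum.distrib)
qed

section \<open>Sums over dyadic classes\<close>

text \<open>For \<open>N \<le> M\<close> this is the cylinder of length \<open>N\<close> with code
  \<open>r\<close>, listed by the codes of its subcylinders of length \<open>M\<close>. Low digits
  are the early coordinates, hence \<open>mod\<close>.\<close>

definition res_class :: "nat \<Rightarrow> nat \<Rightarrow> nat \<Rightarrow> nat set" where
  "res_class M N r = {y. y < 2 ^ M \<and> y mod 2 ^ N = r}"

lemma finite_res_class [simp]: "finite (res_class M N r)"
  unfolding res_class_def by simp

lemma res_class_0: "res_class M 0 0 = {..<2 ^ M}"
  unfolding res_class_def by auto

lemma res_class_same: "r < 2 ^ N \<Longrightarrow> res_class N N r = {r}"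
  unfolding res_class_def by auto

text \<open>Codes of length \<open>Suc M\<close> arise from those of length \<open>M\<close> by a
  new digit at place \<open>M\<close>, which does not affect residues modulo
  \<open>2 ^ N\<close>.\<close>

lemma sum_res_class_Suc:
  assumes "N \<le> M"
  shows "(\<Sum>y\<in>res_class (Suc M) N r. g y) = (\<Sum>y\<in>res_class M N r. g y + g (y + 2 ^ M) :: 'a :: comm_monoid_add)"
proof -
  have d: "(2::nat) ^ N dvd 2 ^ M" using assms by (rule le_imp_power_dvd)
  have "res_class (Suc M) N r = res_class M N r \<union> (\<lambda>y. y + 2 ^ M) ` res_class M N r"
  proof (intro equalityI subsetI)
    fix y assume y: "y \<in> res_class (Suc M) N r"
    show "y \<in> res_class M N r \<union> (\<lambda>y. y + 2 ^ M) ` res_class M N r"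
    proof (cases "y < 2 ^ M")
      case False
      then have "y = (y - 2 ^ M) + 2 ^ M" by simp
      moreover have "(y - 2 ^ M) mod 2 ^ N = y mod 2 ^ N"
        using d False by (metis le_mod_geq linorder_not_less mod_mod_cancel)
      ultimately show ?thesis using y False unfolding res_class_def by (intro UnI2 image_eqI[of _ _ "y - 2 ^ M"]) auto
    qed (use y in \<open>simp add: res_class_def\<close>)
  next
    fix y assume "y \<in> res_class M N r \<union> (\<lambda>y. y + 2 ^ M) ` res_class M N r"
    moreover have "(y + 2 ^ M) mod 2 ^ N = y mod 2 ^ N" for y :: nat
      using d by (metis dvd_eq_mod_eq_0 mod_add_right_eq add.right_neutral)
    ultimately show "y \<in> res_class (Suc M) N r"
      unfolding res_class_def by auto
  qed
  moreover have "res_class M N r \<inter> (\<lambda>y. y + 2 ^ M) ` res_class M N r = {}"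
    unfolding res_class_def by auto
  ultimately show ?thesis
    by (simp add: sum.union_disjoint sum.reindex inj_on_def sum.distrib)
qed

lemma sum_exp_Suc: "(\<Sum>y::nat<2 ^ Suc M. g y) = (\<Sum>y<2 ^ M. g y + g (y + 2 ^ M) :: 'a :: comm_monoid_add)"
  using sum_res_class_Suc[of 0 M g 0] unfolding res_class_0 by simp

lemma bit_at_exp: "y < 2 ^ m \<Longrightarrow> \<not> bit y m" "y < 2 ^ m \<Longrightarrow> bit (y + 2 ^ m) m" for y :: nat
  using bit_less_exp[of y m m] bit_exp_add[of y m m] by (auto simp: add.commute)

lemma sum_res_class_periodic:
  fixes g :: "nat \<Rightarrow> real"
  assumes "N \<le> m" "m \<le> M" "\<And>y. g (y mod 2 ^ m) = g y"
  shows "(\<Sum>y\<in>res_class M N r. g y) = 2 ^ (M - m) * (\<Sum>y\<in>res_class m N r. g y)"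
  using assms(2)
proof (induction M rule: dec_induct)
  case (step M)
  have "(2::nat) ^ m dvd 2 ^ M" using step.hyps by (intro le_imp_power_dvd)
  then have "g (y + 2 ^ M) = g y" for y
    using assms(3)[of "y + 2 ^ M"] assms(3)[of y]
    by (metis dvd_eq_mod_eq_0 mod_add_right_eq add.right_neutral)
  then show ?case
    using step assms(1) by (simp add: sum_res_class_Suc Suc_diff_le sum_distrib_left[symmetric] mult.assoc)
qed simp

lemma sum_periodic:
  fixes g :: "nat \<Rightarrow> real"
  assumes "m \<le> M" "\<And>y. g (y mod 2 ^ m) = g y"
  shows "(\<Sum>y<2 ^ M. g y) = 2 ^ (M - m) * (\<Sum>y<2 ^ m. g y)"
  using sum_res_class_periodic[of 0 m M g 0] assms unfolding res_class_0 by simp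

lemma card_res_class:
  assumes "N \<le> M" "r < 2 ^ N"
  shows "card (res_class M N r) = 2 ^ (M - N)"
proof -
  have "real (card (res_class M N r)) = 2 ^ (M - N) * real (card (res_class N N r))"
    using sum_res_class_periodic[of N N M "\<lambda>_. 1"] assms by simp
  then have "real (card (res_class M N r)) = real (2 ^ (M - N))"
    using res_class_same[OF assms(2)] by simp
  then show ?thesis by linarith
qed

text \<open>Away from the class of 0 the Dirichlet term in \<open>dir_sum_exp_Suc\<close> vanishes,
  so the two extensions by a digit carry the factors 2 and 0 and average to the previous kernel.
  Hence all levels above \<open>N\<close> collapse to \<open>N\<close>; below \<open>N\<close> the
  kernel is constant on the class.\<close>

lemma sum_res_class_dir_sum:
  assumes "N \<le> M" "l \<le> M" "0 < r" "r < 2 ^ N"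
  shows "(\<Sum>y\<in>res_class M N r. dir_sum (2 ^ l) y) = 2 ^ (M - N) * dir_sum (2 ^ min l N) r"
proof (cases "N \<le> l")
  case True
  have "(\<Sum>y\<in>res_class l N r. dir_sum (2 ^ l) y) = 2 ^ (l - N) * dir_sum (2 ^ N) r"
    using True
  proof (induction l rule: dec_induct)
    case base
    then show ?case using res_class_same[OF assms(4)] by simp
  next
    case (step l)
    have "dir_sum (2 ^ Suc l) y + dir_sum (2 ^ Suc l) (y + 2 ^ l) = 2 * dir_sum (2 ^ l) y" if "y \<in> res_class l N r" for y
    proof -
      have y: "y < 2 ^ l" "y mod 2 ^ N = r" using that by (auto simp: res_class_def)
      have "y mod 2 ^ l \<noteq> 0"
      proof
        assume "y mod 2 ^ l = 0"
        then have "y mod 2 ^ N = 0" using y by simp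
        then show False using y assms by simp
      qed
      moreover have "dir_sum (2 ^ l) (y + 2 ^ l) = dir_sum (2 ^ l) y"
        using dir_sum_mod[of "2 ^ l" l "y + 2 ^ l"] y by simp
      ultimately show ?thesis
        using bit_at_exp[OF y(1)] y(1) unfolding dir_sum_exp_Suc dir_ker_exp by (simp add: rad_def)
    qed
    then show ?case
      using step by (simp add: sum_res_class_Suc sum_distrib_left[symmetric] Suc_diff_le del: power_Suc)
        simp
  qed
  then show ?thesis
    using sum_res_class_periodic[of N l M "dir_sum (2 ^ l)" r] True assms
    by (simp add: dir_sum_mod min_def power_add[symmetric])
next
  case False
  have "dir_sum (2 ^ l) y = dir_sum (2 ^ l) r" if "y \<in> res_class M N r" for y
  proof -
    have "r mod 2 ^ l = y mod 2 ^ l"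
      using that False by (auto simp: res_class_def mod_mod_cancel le_imp_power_dvd)
    then show ?thesis by (metis dir_sum_mod le_refl)
  qed
  then show ?thesis using False card_res_class[OF assms(1,4)] by simp
qed

lemma mod_exp_xor: "(x XOR y) mod 2 ^ n = (x mod 2 ^ n) XOR (y mod 2 ^ n)" for x y :: nat
  by (simp flip: take_bit_eq_mod)

lemma xor_less_exp: "x < 2 ^ n \<Longrightarrow> y < 2 ^ n \<Longrightarrow> x XOR y < 2 ^ n" for x y :: nat
  by (metis take_bit_nat_eq_self take_bit_nat_less_exp take_bit_xor)

text \<open>Translation by \<open>x\<close> permutes the cylinders of length
  \<open>N\<close>.\<close>

lemma sum_res_class_xor:
  assumes "x < 2 ^ M"
  shows "(\<Sum>y\<in>res_class M N r. g (x XOR y)) = (\<Sum>z\<in>res_class M N ((x mod 2 ^ N) XOR r). g z)"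
  by (rule sum.reindex_bij_witness[of _ "\<lambda>z. x XOR z" "\<lambda>y. x XOR y"])
    (auto simp: res_class_def mod_exp_xor xor_less_exp assms xor.assoc[symmetric])

lemma sum_xor:
  fixes x :: nat
  assumes "x < 2 ^ M"
  shows "(\<Sum>y<2 ^ M. g (x XOR y)) = (\<Sum>z<2 ^ M. g z)"
  using sum_res_class_xor[OF assms, of g 0 0] unfolding res_class_0 by (simp add: res_class_0)

section \<open>Means of the kernels and of their square roots\<close>

lemma sum_dir_ker_exp: "m \<le> M \<Longrightarrow> (\<Sum>x<2 ^ M. dir_ker (2 ^ m) x) = 2 ^ M"
proof -
  assume m: "m \<le> M"
  have "(\<Sum>x<2 ^ m. dir_ker (2 ^ m) x) = (\<Sum>x::nat<2 ^ m. if x = 0 then 2 ^ m else 0)"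
    unfolding dir_ker_exp by (intro sum.cong) auto
  then show ?thesis
    using sum_periodic[of m M "dir_ker (2 ^ m)"] m by (simp add: dir_ker_mod power_add[symmetric])
qed

lemma sum_dir_sum_exp: "m \<le> M \<Longrightarrow> (\<Sum>x<2 ^ M. dir_sum (2 ^ m) x) = 2 ^ M * 2 ^ m"
proof -
  assume m: "m \<le> M"
  have "(\<Sum>x<2 ^ m. dir_sum (2 ^ m) x) = 2 ^ m * 2 ^ m"
  proof (induction m)
    case (Suc m)
    have "dir_sum (2 ^ Suc m) y + dir_sum (2 ^ Suc m) (y + 2 ^ m) = 2 * dir_sum (2 ^ m) y + 2 * 2 ^ m * dir_ker (2 ^ m) y"
      if y: "y < 2 ^ m" for y
      using bit_at_exp[OF y] dir_sum_mod[of "2 ^ m" m "y + 2 ^ m"] dir_ker_mod[of "2 ^ m" m "y + 2 ^ m"] y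
      unfolding dir_sum_exp_Suc by (simp add: rad_def)
    then have "(\<Sum>x<2 ^ Suc m. dir_sum (2 ^ Suc m) x)
        = 2 * (\<Sum>x<2 ^ m. dir_sum (2 ^ m) x) + 2 * 2 ^ m * (\<Sum>x<2 ^ m. dir_ker (2 ^ m) x)"
      unfolding sum_exp_Suc by (simp add: sum.distrib sum_distrib_left del: power_Suc)
    then show ?case using Suc sum_dir_ker_exp[of m m] by simp
  qed (simp add: dir_sum_def)
  then show ?thesis
    using sum_periodic[of m M "dir_sum (2 ^ m)"] m by (simp add: dir_sum_mod power_add[symmetric])
qed

text \<open>By \<open>dir_sum_exp_Suc\<close> a new digit 0 essentially doubles the kernel and a new
  digit 1 leaves only the Dirichlet term. The square root grows by \<open>sqrt 2\<close> while the
  number of codes doubles, so the means contract up to a bounded error.\<close>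

lemma sum_sqrt_dir_sum_exp: "m \<le> M \<Longrightarrow> (\<Sum>x<2 ^ M. sqrt (dir_sum (2 ^ m) x)) \<le> 8 * 2 ^ M"
proof -
  assume m: "m \<le> M"
  have "(\<Sum>x<2 ^ m. sqrt (dir_sum (2 ^ m) x)) \<le> 8 * 2 ^ m"
  proof (induction m)
    case (Suc m)
    have "sqrt (dir_sum (2 ^ Suc m) y) + sqrt (dir_sum (2 ^ Suc m) (y + 2 ^ m))
        \<le> sqrt 2 * sqrt (dir_sum (2 ^ m) y) + 2 * dir_ker (2 ^ m) y"
      if y: "y < 2 ^ m" for y
    proof -
      have s: "sqrt (2 ^ m * dir_ker (2 ^ m) y) = dir_ker (2 ^ m) y"
        unfolding dir_ker_exp by simp
      have "sqrt (dir_sum (2 ^ Suc m) y) = sqrt (2 * dir_sum (2 ^ m) y + 2 ^ m * dir_ker (2 ^ m) y)"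
        using bit_at_exp[OF y] unfolding dir_sum_exp_Suc by (simp add: rad_def)
      also have "\<dots> \<le> sqrt (2 * dir_sum (2 ^ m) y) + sqrt (2 ^ m * dir_ker (2 ^ m) y)"
        by (intro sqrt_add_le_add_sqrt) (auto simp: dir_sum_exp_nonneg dir_ker_exp)
      finally have 1: "sqrt (dir_sum (2 ^ Suc m) y) \<le> sqrt 2 * sqrt (dir_sum (2 ^ m) y) + dir_ker (2 ^ m) y"
        using s by (simp add: real_sqrt_mult)
      have "dir_sum (2 ^ Suc m) (y + 2 ^ m) = 2 ^ m * dir_ker (2 ^ m) y"
        using bit_at_exp[OF y] dir_ker_mod[of "2 ^ m" m "y + 2 ^ m"] y
        unfolding dir_sum_exp_Suc by (simp add: rad_def)
      then show ?thesis using 1 s by simp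
    qed
    then have "(\<Sum>x<2 ^ Suc m. sqrt (dir_sum (2 ^ Suc m) x))
        \<le> (\<Sum>y<2 ^ m. sqrt 2 * sqrt (dir_sum (2 ^ m) y) + 2 * dir_ker (2 ^ m) y)"
      unfolding sum_exp_Suc by (intro sum_mono) auto
    also have "\<dots> = sqrt 2 * (\<Sum>y<2 ^ m. sqrt (dir_sum (2 ^ m) y)) + 2 * 2 ^ m"
      using sum_dir_ker_exp[of m m] by (simp add: sum.distrib sum_distrib_left[symmetric])
    also have "\<dots> \<le> sqrt 2 * (8 * 2 ^ m) + 2 * 2 ^ m"
      using Suc by (intro add_right_mono mult_left_mono) auto
    \<comment> \<open>With \<open>sqrt 2 \<le> 7 / 4\<close> the constant 8 reproduces itself:
      \<open>7 / 4 * 8 + 2 = 16\<close>.\<close>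
    also have "\<dots> \<le> 7 / 4 * (8 * 2 ^ m) + 2 * 2 ^ m"
      by (intro add_right_mono mult_right_mono real_le_lsqrt) (auto simp: power2_eq_square)
    finally show ?case by simp
  qed (simp add: dir_sum_def)
  then have "2 ^ (M - m) * (\<Sum>x<2 ^ m. sqrt (dir_sum (2 ^ m) x)) \<le> 2 ^ (M - m) * (8 * 2 ^ m)"
    by (intro mult_left_mono) auto
  also have "2 ^ (M - m) * (8 * 2 ^ m) = 8 * (2::real) ^ M" using m by (simp flip: power_add)
  finally show ?thesis
    using sum_periodic[of m M "\<lambda>x. sqrt (dir_sum (2 ^ m) x)"] m by (simp add: dir_sum_mod)
qed

lemma exp_decomp:
  fixes n :: nat
  assumes "n > 0"
  obtains m k where "n = 2 ^ m + k" "k < 2 ^ m"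
proof -
  obtain m where "2 ^ m \<le> n" "n < 2 ^ Suc m"
    using ex_power_ivl1[of 2 n] assms by auto
  then show thesis using that[of m "n - 2 ^ m"] by auto
qed

text \<open>The Fejer kernels are bounded by 2 in mean. Removing the leading digit of
  \<open>n = 2 ^ m + k\<close> leaves \<open>2 ^ m + k + 2 * k\<close>, at most \<open>2 * n\<close>
  because \<open>k < 2 ^ m\<close>.\<close>

lemma sum_abs_dir_sum: "n \<le> 2 ^ M \<Longrightarrow> (\<Sum>x<2 ^ M. \<bar>dir_sum n x\<bar>) \<le> 2 * real n * 2 ^ M"
proof (induction n rule: less_induct)
  case (less n)
  show ?case
  proof (cases "n = 0")
    case False
    then obtain m k where n: "n = 2 ^ m + k" "k < 2 ^ m" using exp_decomp[of n] by auto
    have "(2::nat) ^ m \<le> 2 ^ M" using n less.prems by linarith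
    then have mM: "m \<le> M" by simp
    have "\<bar>dir_sum n x\<bar> \<le> dir_sum (2 ^ m) x + real k * dir_ker (2 ^ m) x + \<bar>dir_sum k x\<bar>" for x
    proof -
      have "0 \<le> real k * dir_ker (2 ^ m) x" by (simp add: dir_ker_exp)
      moreover have "\<bar>rad m x * dir_sum k x\<bar> = \<bar>dir_sum k x\<bar>" by (simp add: abs_mult)
      ultimately show ?thesis
        unfolding n(1) using dir_sum_exp_add[of k m x] n(2) dir_sum_exp_nonneg[of m x] by linarith
    qed
    then have "(\<Sum>x<2 ^ M. \<bar>dir_sum n x\<bar>) \<le> (\<Sum>x<2 ^ M. dir_sum (2 ^ m) x + real k * dir_ker (2 ^ m) x + \<bar>dir_sum k x\<bar>)"
      by (intro sum_mono)
    also have "\<dots> = 2 ^ M * 2 ^ m + real k * 2 ^ M + (\<Sum>x<2 ^ M. \<bar>dir_sum k x\<bar>)"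
      using sum_dir_sum_exp[OF mM] sum_dir_ker_exp[OF mM] by (simp add: sum.distrib sum_distrib_left[symmetric])
    also have "\<dots> \<le> 2 ^ M * 2 ^ m + real k * 2 ^ M + 2 * real k * 2 ^ M"
      using less.IH[of k] n less.prems by (intro add_left_mono) auto
    also have "\<dots> = (2 ^ m + 3 * real k) * 2 ^ M" by (simp add: algebra_simps)
    also have "\<dots> \<le> (2 * real n) * 2 ^ M"
    proof (intro mult_right_mono)
      have "real k \<le> 2 ^ m" using n(2) by (metis less_imp_le of_nat_le_iff of_nat_numeral of_nat_power)
      then show "2 ^ m + 3 * real k \<le> 2 * real n" using n(1) by simp
    qed simp
    finally show ?thesis .
  qed simp
qed

section \<open>The atomic estimate\<close>

text \<open>Agrees with the Fejer mean of the function with values \<open>f y\<close> on the cylinders of length \<open>M\<close>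
  only for \<open>n \<le> 2 ^ M\<close>.\<close>

definition fejer_conv :: "nat \<Rightarrow> (nat \<Rightarrow> real) \<Rightarrow> nat \<Rightarrow> nat \<Rightarrow> real" where
  "fejer_conv M f n x = (\<Sum>y<2 ^ M. f y * dir_sum n (x XOR y)) / (real n * 2 ^ M)"

text \<open>The support gets the uniform bound for Fejer means; outside it one term per level
  \<open>s \<ge> N\<close> is summed, so one function dominates the means of all levels below
  \<open>M\<close> at once.\<close>

definition atom_majorant :: "(nat \<Rightarrow> nat) \<Rightarrow> nat \<Rightarrow> nat \<Rightarrow> nat \<Rightarrow> nat \<Rightarrow> real" where
  "atom_majorant nk M N r x =
     (if x mod 2 ^ N = r then sqrt 2
      else \<Sum>s=N..<M. sqrt (3 / (2 ^ N * 2 ^ s)) / real (card (endpoint_set nk s)) *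
        (\<Sum>e\<in>endpoint_set nk s. sqrt (dir_sum (2 ^ min (Suc e) N) (x XOR r)) + sqrt (dir_sum (2 ^ min e N) (x XOR r))))"

lemma atom_majorant_nonneg: "atom_majorant nk M N r x \<ge> 0"
  unfolding atom_majorant_def
  by (auto intro!: sum_nonneg mult_nonneg_nonneg divide_nonneg_nonneg add_nonneg_nonneg simp: dir_sum_exp_nonneg)

lemma abs_fejer_conv_le:
  assumes "n \<le> 2 ^ M" "n > 0" "x < 2 ^ M" "\<And>y. y < 2 ^ M \<Longrightarrow> \<bar>a y\<bar> \<le> b"
  shows "\<bar>fejer_conv M a n x\<bar> \<le> 2 * b"
proof -
  have b: "b \<ge> 0" using assms(3,4) by (meson abs_ge_zero order_trans)
  have "\<bar>\<Sum>y<2 ^ M. a y * dir_sum n (x XOR y)\<bar> \<le> (\<Sum>y<2 ^ M. b * \<bar>dir_sum n (x XOR y)\<bar>)"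
    by (rule order_trans[OF sum_abs sum_mono]) (auto simp: abs_mult intro!: mult_right_mono assms(4))
  also have "\<dots> = b * (\<Sum>y<2 ^ M. \<bar>dir_sum n y\<bar>)"
    using sum_xor[OF assms(3), of "\<lambda>z. \<bar>dir_sum n z\<bar>"] by (simp add: sum_distrib_left[symmetric])
  also have "\<dots> \<le> b * (2 * real n * 2 ^ M)"
    using sum_abs_dir_sum[OF assms(1)] b by (intro mult_left_mono)
  finally show ?thesis
    using assms(2) unfolding fejer_conv_def by (simp add: abs_divide field_simps)
qed

lemma sqrt_sum_le: "(\<And>i. i \<in> A \<Longrightarrow> g i \<ge> 0) \<Longrightarrow> sqrt (\<Sum>i\<in>A. g i) \<le> (\<Sum>i\<in>A. sqrt (g i))"
proof (induction A rule: infinite_finite_induct)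
  case (insert i A)
  then have "sqrt (g i + sum g A) \<le> sqrt (g i) + sqrt (sum g A)"
    by (intro sqrt_add_le_add_sqrt sum_nonneg) auto
  then show ?case using insert by (simp add: order_trans)
qed auto

text \<open>On the support the Fejer kernels are bounded in mean. Off the support the kernel is
  constant on the translated support if \<open>s < N\<close>, and the zero mean removes it; if
  \<open>s \<ge> N\<close> it is averaged over a class away from 0. The alternative
  \<open>N = 0\<close> admits constants as atoms: their support is everything.\<close>

lemma atom_estimate:
  assumes r: "r < 2 ^ N" and N: "N \<le> M"
    and supp: "\<And>y. y < 2 ^ M \<Longrightarrow> y mod 2 ^ N \<noteq> r \<Longrightarrow> a y = 0"
    and bound: "\<And>y. y < 2 ^ M \<Longrightarrow> \<bar>a y\<bar> \<le> b"
    and mean: "N = 0 \<or> (\<Sum>y\<in>res_class M N r. a y) = 0"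
    and x: "x < 2 ^ M" and k: "2 ^ s \<le> nk k" "nk k < 2 ^ Suc s" and s: "s < M"
  shows "sqrt (\<bar>fejer_conv M a (nk k) x\<bar> / (real (card (endpoint_set nk s)))\<^sup>2)
    \<le> sqrt b * atom_majorant nk M N r x"
proof -
  define n c where "n = nk k" and "c = real (card (endpoint_set nk s))"
  have c: "c \<ge> 1" using card_endpoint_set_pos[of s nk k] k unfolding c_def by linarith
  have b: "b \<ge> 0" using x bound by (meson abs_ge_zero order_trans)
  have n0: "n > 0" using k(1) unfolding n_def by (metis gr0I le_zero_eq power_eq_0_iff zero_neq_numeral)
  have "(2::nat) ^ Suc s \<le> 2 ^ M" using s by (intro power_increasing) auto
  then have nM: "n \<le> 2 ^ M" using k unfolding n_def by linarith
  \<comment> \<open>The squared weight becomes the plain number of endpoints under the root; it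
    later cancels against the number of summands.\<close>
  have sqrt_c: "sqrt (u / c\<^sup>2) = sqrt u / c" for u
    using c by (simp add: real_sqrt_divide)
  show ?thesis
  proof (cases "x mod 2 ^ N = r")
    case True
    have "sqrt \<bar>fejer_conv M a n x\<bar> \<le> sqrt (2 * b)"
      using abs_fejer_conv_le[OF nM n0 x bound] by simp
    moreover have "sqrt \<bar>fejer_conv M a n x\<bar> / c \<le> sqrt \<bar>fejer_conv M a n x\<bar>"
      using c by (simp add: divide_le_eq mult_le_cancel_left1)
    ultimately show ?thesis
      unfolding n_def[symmetric] c_def[symmetric] sqrt_c using True
      by (simp add: atom_majorant_def real_sqrt_mult mult.commute)
  next
    case False
    define z where "z = (x mod 2 ^ N) XOR r"
    have z: "z < 2 ^ N" unfolding z_def using r by (simp add: xor_less_exp)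
    have z0: "z > 0"
    proof (rule ccontr)
      assume "\<not> z > 0"
      moreover have "x mod 2 ^ N = z XOR r" unfolding z_def by (simp add: xor.assoc)
      ultimately show False using False by simp
    qed
    have xz: "(x XOR r) mod 2 ^ N = z" using r by (simp add: mod_exp_xor z_def)
    have res_class: "{y \<in> {..<2 ^ M}. y mod 2 ^ N = r} = res_class M N r" unfolding res_class_def by auto
    have restr: "(\<Sum>y<2 ^ M. a y * dir_sum n (x XOR y)) = (\<Sum>y\<in>res_class M N r. a y * dir_sum n (x XOR y))"
      unfolding res_class[symmetric] by (rule sum.mono_neutral_right) (use supp in auto)
    show ?thesis
    proof (cases "s < N")
      case True
      have "(2::nat) ^ Suc s \<le> 2 ^ N" using True by (intro power_increasing) auto
      then have nN: "n \<le> 2 ^ N" using k unfolding n_def by linarith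
      have "dir_sum n (x XOR y) = dir_sum n z" if "y \<in> res_class M N r" for y
      proof -
        have "(x XOR y) mod 2 ^ N = z" using that by (simp add: mod_exp_xor z_def res_class_def)
        then show ?thesis using dir_sum_mod[OF nN] by metis
      qed
      then have "(\<Sum>y\<in>res_class M N r. a y * dir_sum n (x XOR y)) = (\<Sum>y\<in>res_class M N r. a y) * dir_sum n z"
        by (simp add: sum_distrib_right)
      then have "fejer_conv M a n x = 0"
        using mean True unfolding fejer_conv_def restr by simp
      then show ?thesis unfolding n_def[symmetric] using b atom_majorant_nonneg by simp
    next
      case sN: False
      define W where "W = (\<Sum>e\<in>endpoint_set nk s. dir_sum (2 ^ min (Suc e) N) z + dir_sum (2 ^ min e N) z)"
      have W0: "W \<ge> 0" unfolding W_def by (intro sum_nonneg add_nonneg_nonneg dir_sum_exp_nonneg)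
      have fz: "dir_sum (2 ^ min e N) (x XOR r) = dir_sum (2 ^ min e N) z" for e
        using xz dir_sum_mod[of "2 ^ min e N" "min e N"] by (metis dir_sum_mod min.cobounded2 one_le_numeral power_increasing)
      have "\<bar>\<Sum>y\<in>res_class M N r. a y * dir_sum n (x XOR y)\<bar> \<le> (\<Sum>y\<in>res_class M N r. b * \<bar>dir_sum n (x XOR y)\<bar>)"
        by (rule order_trans[OF sum_abs sum_mono])
          (auto simp: abs_mult res_class_def intro!: mult_right_mono bound)
      \<comment> \<open>Translation by \<open>x\<close> moves the support to the class of
        \<open>z\<close>, which is not that of 0, so \<open>sum_res_class_dir_sum\<close> applies
        below.\<close>
      also have "\<dots> = b * (\<Sum>y\<in>res_class M N z. \<bar>dir_sum n y\<bar>)"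
        using sum_res_class_xor[OF x, of "\<lambda>z. \<bar>dir_sum n z\<bar>" N r]
        by (simp add: sum_distrib_left[symmetric] z_def)
      also have "(\<Sum>y\<in>res_class M N z. \<bar>dir_sum n y\<bar>)
          \<le> (\<Sum>y\<in>res_class M N z. 3 * (\<Sum>e\<in>endpoint_set nk s. dir_sum (2 ^ Suc e) y + dir_sum (2 ^ e) y))"
        unfolding n_def by (intro sum_mono abs_dir_sum_le_endpoints k)
      also have "\<dots> = 3 * (\<Sum>e\<in>endpoint_set nk s. (\<Sum>y\<in>res_class M N z. dir_sum (2 ^ Suc e) y) + (\<Sum>y\<in>res_class M N z. dir_sum (2 ^ e) y))"
        by (subst sum.distrib[symmetric], subst sum.swap) (simp add: sum_distrib_left)
      also have "\<dots> = 3 * (\<Sum>e\<in>endpoint_set nk s. 2 ^ (M - N) * (dir_sum (2 ^ min (Suc e) N) z + dir_sum (2 ^ min e N) z))"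
      proof (intro arg_cong[of _ _ "(*) 3"] sum.cong refl)
        fix e assume "e \<in> endpoint_set nk s"
        then have "Suc e \<le> M" "e \<le> M" using endpoint_set_subset[of nk s] s by auto
        then show "(\<Sum>y\<in>res_class M N z. dir_sum (2 ^ Suc e) y) + (\<Sum>y\<in>res_class M N z. dir_sum (2 ^ e) y)
            = 2 ^ (M - N) * (dir_sum (2 ^ min (Suc e) N) z + dir_sum (2 ^ min e N) z)"
          using sum_res_class_dir_sum[OF N _ z0 z] by (simp add: distrib_left del: power_Suc)
      qed
      also have "\<dots> = 3 * 2 ^ (M - N) * W"
        unfolding W_def by (simp add: sum_distrib_left[symmetric])
      finally have "\<bar>\<Sum>y<2 ^ M. a y * dir_sum n (x XOR y)\<bar> \<le> b * (3 * 2 ^ (M - N) * W)"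
        unfolding restr using b by (simp add: mult_left_mono)
      then have "\<bar>fejer_conv M a n x\<bar> \<le> b * (3 * 2 ^ (M - N) * W) / (real n * 2 ^ M)"
        unfolding fejer_conv_def by (simp add: abs_divide divide_right_mono)
      also have "\<dots> = b * 3 * W / (real n * 2 ^ N)"
        using N n0 by (simp add: power_diff field_simps)
      also have "\<dots> \<le> b * 3 * W / (2 ^ s * 2 ^ N)"
      proof (rule divide_left_mono)
        have "2 ^ s \<le> real n" using k(1) unfolding n_def by (metis of_nat_le_iff of_nat_numeral of_nat_power)
        then show "2 ^ s * 2 ^ N \<le> real n * 2 ^ N" by simp
      qed (use b W0 n0 in auto)
      finally have "sqrt \<bar>fejer_conv M a n x\<bar> \<le> sqrt (b * (3 / (2 ^ N * 2 ^ s)) * W)"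
        by (simp add: algebra_simps)
      also have "\<dots> = sqrt b * (sqrt (3 / (2 ^ N * 2 ^ s)) * sqrt W)"
        by (simp only: real_sqrt_mult mult.assoc)
      finally have "sqrt \<bar>fejer_conv M a n x\<bar> / c \<le> sqrt b * (sqrt (3 / (2 ^ N * 2 ^ s)) * sqrt W) / c"
        using c by (intro divide_right_mono) auto
      also have "\<dots> = sqrt b * (sqrt (3 / (2 ^ N * 2 ^ s)) / c * sqrt W)" by simp
      also have "\<dots> \<le> sqrt b * (sqrt (3 / (2 ^ N * 2 ^ s)) / c *
          (\<Sum>e\<in>endpoint_set nk s. sqrt (dir_sum (2 ^ min (Suc e) N) z) + sqrt (dir_sum (2 ^ min e N) z)))"
      proof (intro mult_left_mono)
        have "sqrt W \<le> (\<Sum>e\<in>endpoint_set nk s. sqrt (dir_sum (2 ^ min (Suc e) N) z + dir_sum (2 ^ min e N) z))"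
          unfolding W_def by (intro sqrt_sum_le add_nonneg_nonneg dir_sum_exp_nonneg)
        also have "\<dots> \<le> (\<Sum>e\<in>endpoint_set nk s. sqrt (dir_sum (2 ^ min (Suc e) N) z) + sqrt (dir_sum (2 ^ min e N) z))"
          by (intro sum_mono sqrt_add_le_add_sqrt dir_sum_exp_nonneg)
        finally show "sqrt W \<le> \<dots>" .
      qed (use b c in auto)
      also have "\<dots> \<le> sqrt b * atom_majorant nk M N r x"
      proof (intro mult_left_mono)
        have "s \<in> {N..<M}" using sN s by auto
        then show "sqrt (3 / (2 ^ N * 2 ^ s)) / c *
          (\<Sum>e\<in>endpoint_set nk s. sqrt (dir_sum (2 ^ min (Suc e) N) z) + sqrt (dir_sum (2 ^ min e N) z))
          \<le> atom_majorant nk M N r x"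
          unfolding atom_majorant_def fz using False
          by (simp only: if_False, intro member_le_sum[of s "{N..<M}"
            "\<lambda>s. sqrt (3 / (2 ^ N * 2 ^ s)) / real (card (endpoint_set nk s)) *
              (\<Sum>e\<in>endpoint_set nk s. sqrt (dir_sum (2 ^ min (Suc e) N) z) + sqrt (dir_sum (2 ^ min e N) z))", folded c_def])
           (auto intro!: sum_nonneg mult_nonneg_nonneg divide_nonneg_nonneg add_nonneg_nonneg simp: dir_sum_exp_nonneg)
      qed (use b in auto)
      finally show ?thesis unfolding n_def[symmetric] c_def[symmetric] sqrt_c .
    qed
  qed
qed

text \<open>The ratio is at most \<open>3 / 4\<close>, so the tail is at most
  \<open>1 / (1 - 3 / 4) = 4\<close> times its first term.\<close>

lemma sum_inverse_sqrt2_power: "N \<le> M \<Longrightarrow> (\<Sum>s=N..<M. (1 / sqrt 2) ^ s) \<le> 4 * (1 / sqrt 2) ^ N"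
proof -
  assume "N \<le> M"
  have q: "1 / sqrt 2 \<le> 3 / (4 :: real)"
  proof -
    have "4 / 3 \<le> sqrt 2" by (rule real_le_rsqrt) (simp add: power2_eq_square)
    then show ?thesis by (simp add: field_simps)
  qed
  have "(\<Sum>s=N..<M. (1 / sqrt 2) ^ s) \<le> 4 * (1 / sqrt 2) ^ N - 4 * (1 / sqrt 2) ^ M"
    using \<open>N \<le> M\<close>
  proof (induction M rule: dec_induct)
    case (step M)
    have "(1 / sqrt 2) ^ M * (4 * (1 / sqrt 2)) \<le> (1 / sqrt 2) ^ M * 3"
      using q by (intro mult_left_mono) auto
    then have "4 * (1 / sqrt 2) ^ Suc M \<le> 3 * (1 / sqrt 2) ^ M"
      by (simp only: power_Suc mult_ac)
    moreover have "(\<Sum>s=N..<Suc M. (1 / sqrt 2) ^ s) = (\<Sum>s=N..<M. (1 / sqrt 2) ^ s) + (1 / sqrt 2) ^ M"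
      using step.hyps by simp
    ultimately show ?case using step.IH by linarith
  qed simp
  moreover have "0 \<le> 4 * (1 / sqrt 2) ^ M" by simp
  ultimately show ?thesis by linarith
qed

text \<open>Level \<open>s\<close> has as many pairs of kernels as endpoints, which cancels the
  weight, and square roots of kernels have mean at most 8. The factors
  \<open>(1 / sqrt 2) ^ (N + s)\<close> sum over \<open>s \<ge> N\<close> to order
  \<open>2 ^ - N\<close>; the constant is \<open>2 + 2 * 16 * 4 = 130\<close>.\<close>

lemma sum_atom_majorant:
  assumes r: "r < 2 ^ N" and N: "N \<le> M"
  shows "(\<Sum>x<2 ^ M. atom_majorant nk M N r x) \<le> 130 * 2 ^ (M - N)"
proof -
  define g where "g x s = sqrt (3 / (2 ^ N * 2 ^ s)) / real (card (endpoint_set nk s)) *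
        (\<Sum>e\<in>endpoint_set nk s. sqrt (dir_sum (2 ^ min (Suc e) N) (x XOR r)) + sqrt (dir_sum (2 ^ min e N) (x XOR r)))" for x s
  have g0: "g x s \<ge> 0" for x s
    unfolding g_def by (auto intro!: sum_nonneg mult_nonneg_nonneg divide_nonneg_nonneg add_nonneg_nonneg simp: dir_sum_exp_nonneg)
  define q where "q = 1 / sqrt 2"
  have q: "q \<ge> 0" "q * q = 1 / 2" unfolding q_def by auto
  have "(2::nat) ^ N \<le> 2 ^ M" using N by (intro power_increasing) auto
  then have rM: "r < 2 ^ M" using r by linarith
  have G: "(\<Sum>x<2 ^ M. g x s) \<le> 32 * 2 ^ M * q ^ N * q ^ s" for s
  proof -
    define c where "c = real (card (endpoint_set nk s))"
    have "(\<Sum>x<2 ^ M. sqrt (dir_sum (2 ^ min e N) (x XOR r))) \<le> 8 * 2 ^ M" for e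
      using sum_xor[OF rM, of "\<lambda>z. sqrt (dir_sum (2 ^ min e N) z)"] sum_sqrt_dir_sum_exp[of "min e N" M] N
      by (simp add: xor.commute)
    then have "(\<Sum>e\<in>endpoint_set nk s. (\<Sum>x<2 ^ M. sqrt (dir_sum (2 ^ min (Suc e) N) (x XOR r)))
        + (\<Sum>x<2 ^ M. sqrt (dir_sum (2 ^ min e N) (x XOR r)))) \<le> (\<Sum>e\<in>endpoint_set nk s. 8 * 2 ^ M + 8 * 2 ^ M)"
      by (intro sum_mono add_mono)
    also have "\<dots> = c * (16 * 2 ^ M)" unfolding c_def by simp
    finally have 1: "(\<Sum>e\<in>endpoint_set nk s. (\<Sum>x<2 ^ M. sqrt (dir_sum (2 ^ min (Suc e) N) (x XOR r)))
        + (\<Sum>x<2 ^ M. sqrt (dir_sum (2 ^ min e N) (x XOR r)))) \<le> c * (16 * 2 ^ M)" .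
    have "(\<Sum>x<2 ^ M. g x s) = sqrt (3 / (2 ^ N * 2 ^ s)) / c *
       (\<Sum>e\<in>endpoint_set nk s. (\<Sum>x<2 ^ M. sqrt (dir_sum (2 ^ min (Suc e) N) (x XOR r)))
        + (\<Sum>x<2 ^ M. sqrt (dir_sum (2 ^ min e N) (x XOR r))))"
      unfolding g_def c_def[symmetric] sum_distrib_left[symmetric]
      by (subst sum.distrib[symmetric], subst sum.swap) simp
    also have "\<dots> \<le> sqrt (3 / (2 ^ N * 2 ^ s)) / c * (c * (16 * 2 ^ M))"
      using 1 by (intro mult_left_mono) (auto simp: c_def)
    \<comment> \<open>A level without members has \<open>c = 0\<close>, and then the quotient by
      \<open>c\<close> is 0.\<close>
    also have "\<dots> \<le> sqrt (3 / (2 ^ N * 2 ^ s)) * (16 * 2 ^ M)"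
      by (cases "c = 0") auto
    also have "sqrt (3 / (2 ^ N * 2 ^ s)) \<le> sqrt (4 / (2 ^ N * 2 ^ s))"
      by (intro real_sqrt_le_mono divide_right_mono) auto
    also have "sqrt (4 / (2 ^ N * 2 ^ s)) = 2 * q ^ N * q ^ s"
      unfolding q_def by (simp add: real_sqrt_divide real_sqrt_mult real_sqrt_power power_one_over field_simps)
    finally show ?thesis by (simp add: algebra_simps)
  qed
  have "(\<Sum>x<2 ^ M. atom_majorant nk M N r x)
      \<le> (\<Sum>x<2 ^ M. (if x \<in> res_class M N r then sqrt 2 else 0) + (\<Sum>s=N..<M. g x s))"
    unfolding atom_majorant_def g_def[symmetric] by (intro sum_mono) (auto simp: res_class_def sum_nonneg g0)
  also have "\<dots> = (\<Sum>x<2 ^ M. if x \<in> res_class M N r then sqrt 2 else 0) + (\<Sum>s=N..<M. \<Sum>x<2 ^ M. g x s)"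
    by (subst sum.distrib, subst sum.swap) simp
  also have "(\<Sum>x<2 ^ M. if x \<in> res_class M N r then sqrt 2 else 0) = sqrt 2 * 2 ^ (M - N)"
  proof -
    have "{..<2 ^ M} \<inter> res_class M N r = res_class M N r" by (auto simp: res_class_def)
    then show ?thesis using card_res_class[OF N r] by (simp add: sum.If_cases)
  qed
  also have "sqrt 2 * 2 ^ (M - N) \<le> 2 * 2 ^ (M - N)"
    by (intro mult_right_mono real_le_lsqrt) auto
  also have "(\<Sum>s=N..<M. \<Sum>x<2 ^ M. g x s) \<le> (\<Sum>s=N..<M. 32 * 2 ^ M * q ^ N * q ^ s)"
    by (intro sum_mono G)
  also have "\<dots> = 32 * 2 ^ M * q ^ N * (\<Sum>s=N..<M. q ^ s)" by (simp add: sum_distrib_left)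
  also have "\<dots> \<le> 32 * 2 ^ M * q ^ N * (4 * q ^ N)"
    using sum_inverse_sqrt2_power[OF N] q unfolding q_def[symmetric] by (intro mult_left_mono) auto
  also have "\<dots> = 128 * 2 ^ M * (q * q) ^ N" by (simp add: power_mult_distrib)
  also have "\<dots> = 128 * 2 ^ (M - N)"
    unfolding q(2) using N by (simp add: power_diff power_one_over)
  finally show ?thesis by simp
qed

section \<open>Atomic decomposition of dyadic martingales\<close>

lemma mod_exp_Suc: "y mod 2 ^ Suc n = y mod 2 ^ n + (if bit y n then 2 ^ n else 0)" for y :: nat
proof -
  have "y mod 2 ^ Suc n = 2 ^ n * (y div 2 ^ n mod 2) + y mod 2 ^ n"
    using mod_mult2_eq[of y "2 ^ n" 2] by (simp add: mult.commute)
  then show ?thesis by (simp add: bit_iff_odd odd_iff_mod_2_eq_one)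
qed

lemma mod_exp_flip: "(x XOR 2 ^ n) mod 2 ^ j = x mod 2 ^ j" if "j \<le> n" for x :: nat
  using that by (simp add: mod_exp_xor le_imp_power_dvd)

text \<open>\<open>f n c\<close> stands for the value of the \<open>n\<close>-th martingale term on
  the cylinder of length \<open>n\<close> with code \<open>c\<close>, whose halves have codes
  \<open>c\<close> and \<open>c + 2 ^ n\<close>.\<close>

locale dyadic_tree =
  fixes f :: "nat \<Rightarrow> nat \<Rightarrow> real"
  assumes avg: "c < 2 ^ n \<Longrightarrow> f n c = (f (Suc n) c + f (Suc n) (c + 2 ^ n)) / 2"
begin

definition ev :: "nat \<Rightarrow> nat \<Rightarrow> real" where
  "ev n x = f n (x mod 2 ^ n)"

definition child_max :: "nat \<Rightarrow> nat \<Rightarrow> real" where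
  "child_max n x = max \<bar>f (Suc n) (x mod 2 ^ n)\<bar> \<bar>f (Suc n) (x mod 2 ^ n + 2 ^ n)\<bar>"

text \<open>Including both children makes the running maximum predictable, so stopping when it exceeds a
  level costs only a factor 2 in measure and no overshoot.\<close>

definition run_max :: "nat \<Rightarrow> nat \<Rightarrow> real" where
  "run_max n x = Max ((\<lambda>j. child_max j x) ` {..n})"

definition max_ev :: "nat \<Rightarrow> nat \<Rightarrow> real" where
  "max_ev M x = Max ((\<lambda>n. \<bar>ev n x\<bar>) ` {..M})"

lemma ev_mod: "n \<le> m \<Longrightarrow> ev n (x mod 2 ^ m) = ev n x"
  by (simp add: ev_def mod_mod_cancel le_imp_power_dvd)

lemma child_max_mod: "n \<le> m \<Longrightarrow> child_max n (x mod 2 ^ m) = child_max n x"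
  by (simp add: child_max_def mod_mod_cancel le_imp_power_dvd)

lemma run_max_mod: "n \<le> m \<Longrightarrow> run_max n (x mod 2 ^ m) = run_max n x"
  unfolding run_max_def by (intro arg_cong[of _ _ Max] image_cong) (auto simp: child_max_mod)

lemma run_max_flip: "j \<le> n \<Longrightarrow> run_max j (x XOR 2 ^ n) = run_max j x"
  by (metis run_max_mod mod_exp_flip order_refl)

lemma child_max_le_run_max: "j \<le> n \<Longrightarrow> child_max j x \<le> run_max n x"
  unfolding run_max_def by (intro Max_ge) auto

lemma run_max_mono: "m \<le> n \<Longrightarrow> run_max m x \<le> run_max n x"
  unfolding run_max_def by (intro Max_mono) auto

lemma run_max_0: "run_max 0 x = child_max 0 x"
  by (simp add: run_max_def)

lemma run_max_Suc: "run_max (Suc n) x = max (child_max (Suc n) x) (run_max n x)"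
  unfolding run_max_def by (simp add: atMost_Suc)

lemma abs_ev_Suc_le: "\<bar>ev (Suc n) x\<bar> \<le> child_max n x"
  unfolding ev_def child_max_def mod_exp_Suc by auto

lemma abs_ev_le: "\<bar>ev n x\<bar> \<le> child_max n x"
  using avg[of "x mod 2 ^ n" n] unfolding ev_def child_max_def by auto

lemma ev_flip_add: "ev (Suc n) x + ev (Suc n) (x XOR 2 ^ n) = 2 * ev n x"
  unfolding ev_def mod_exp_Suc mod_exp_flip[OF order_refl]
  using avg[of "x mod 2 ^ n" n] by (simp add: bit_simps)

lemma ev_flip: "ev n (x XOR 2 ^ n) = ev n x"
  by (metis ev_mod mod_exp_flip order_refl)

section \<open>Stopping cylinders and layers\<close>

text \<open>The cylinders on which the running maximum first exceeds \<open>v\<close>. The code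
  \<open>r\<close> also serves as a point, since \<open>run_max N\<close> depends only on the
  residue modulo \<open>2 ^ N\<close>.\<close>

definition stop_nodes :: "nat \<Rightarrow> real \<Rightarrow> (nat \<times> nat) set" where
  "stop_nodes M v = {(N, r). N < M \<and> r < 2 ^ N \<and> v < run_max N r \<and> (N = 0 \<or> run_max (N - 1) r \<le> v)}"

text \<open>The martingale stopped on passing \<open>2 * v\<close> minus the one stopped on passing
  \<open>v\<close>.\<close>

definition layer :: "nat \<Rightarrow> real \<Rightarrow> nat \<Rightarrow> real" where
  "layer M v x = (\<Sum>n | n < M \<and> v < run_max n x \<and> run_max n x \<le> 2 * v. ev (Suc n) x - ev n x)"

lemma finite_stop_nodes: "finite (stop_nodes M v)"
proof (rule finite_subset)
  show "stop_nodes M v \<subseteq> (SIGMA N:{..<M}. {..<2 ^ N})" unfolding stop_nodes_def by auto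
qed simp

lemma stop_nodes_unique:
  assumes "(N, r) \<in> stop_nodes M v" "x mod 2 ^ N = r" "n < M"
  shows "v < run_max n x \<longleftrightarrow> N \<le> n"
proof -
  have "run_max N x > v" using assms run_max_mod[of N N x] unfolding stop_nodes_def by auto
  moreover have "run_max (N - 1) x \<le> v" if "N > 0"
    using assms that run_max_mod[of "N - 1" N x] unfolding stop_nodes_def by auto
  ultimately show ?thesis
    using run_max_mono[of N n x] run_max_mono[of n "N - 1" x] by fastforce
qed

lemma stop_nodes_same_level:
  assumes "(N, r) \<in> stop_nodes M v" "(N', r') \<in> stop_nodes M v" "x mod 2 ^ N = r" "x mod 2 ^ N' = r'"
  shows "N = N'"
proof -
  have "N \<le> n \<longleftrightarrow> N' \<le> n" if "n < M" for n
    using stop_nodes_unique[OF assms(1,3) that] stop_nodes_unique[OF assms(2,4) that] by blast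
  moreover have "N < M" "N' < M" using assms unfolding stop_nodes_def by auto
  ultimately show ?thesis by (meson le_antisym order_refl)
qed

lemma stop_nodes_cover:
  assumes "n < M" "v < run_max n x"
  obtains N where "(N, x mod 2 ^ N) \<in> stop_nodes M v"
proof -
  define N where "N = (LEAST n. v < run_max n x)"
  have N: "v < run_max N x" "N \<le> n" unfolding N_def
    using assms by (auto intro: LeastI Least_le)
  have "run_max (N - 1) x \<le> v" if "N \<noteq> 0"
    using not_less_Least[of "N - 1" "\<lambda>n. v < run_max n x"] that unfolding N_def by force
  then have "(N, x mod 2 ^ N) \<in> stop_nodes M v"
    using N assms run_max_mod[of N N x] run_max_mod[of "N - 1" N x] unfolding stop_nodes_def by auto
  then show thesis using that by blast
qed

text \<open>The increments telescope to a difference of two stopped values, each at most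
  \<open>2 * v\<close> because stopping causes no overshoot.\<close>

lemma abs_layer_le:
  assumes "v > 0"
  shows "\<bar>layer M v x\<bar> \<le> 4 * v"
proof -
  \<comment> \<open>\<open>p u\<close> is the first passage above \<open>u\<close>, capped at
    \<open>M\<close>; the increments of the layer then form an interval.\<close>
  define p where "p u = (LEAST n. n = M \<or> u < run_max n x)" for u
  have p: "v' < run_max n x \<longleftrightarrow> p v' \<le> n" if "n < M" for n v'
  proof
    assume "v' < run_max n x" then show "p v' \<le> n" unfolding p_def by (intro Least_le) auto
  next
    assume "p v' \<le> n"
    moreover have "p v' = M \<or> v' < run_max (p v') x"
      unfolding p_def by (rule LeastI) auto
    ultimately show "v' < run_max n x" using that run_max_mono[of "p v'" n x] by auto
  qed
  have pM: "p u \<le> M" for u unfolding p_def by (rule Least_le) auto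
  have "{n. n < M \<and> v < run_max n x \<and> run_max n x \<le> 2 * v} = {p v..<p (2 * v)}"
    using p pM[of "2 * v"] by (auto simp: not_less[symmetric])
  then have *: "layer M v x = (\<Sum>n=p v..<p (2 * v). ev (Suc n) x - ev n x)"
    unfolding layer_def by simp
  show ?thesis
  proof (cases "p v < p (2 * v)")
    case True
    then have l: "layer M v x = ev (p (2 * v)) x - ev (p v) x"
      unfolding * by (intro sum_Suc_diff') simp
    \<comment> \<open>\<open>q\<close> is the last index before the second passage;
      \<open>run_max q\<close> already accounts for the values at \<open>Suc q\<close>.\<close>
    obtain q where q: "p (2 * v) = Suc q" using True by (cases "p (2 * v)") auto
    have "run_max q x \<le> 2 * v" "run_max (p v) x \<le> 2 * v"
      using p[of q "2 * v"] p[of "p v" "2 * v"] pM[of "2 * v"] True q by auto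
    then have "\<bar>ev (p (2 * v)) x\<bar> \<le> 2 * v" "\<bar>ev (p v) x\<bar> \<le> 2 * v"
      using abs_ev_Suc_le[of q x] child_max_le_run_max[of q q x] abs_ev_le[of "p v" x]
        child_max_le_run_max[of "p v" "p v" x] q by auto
    then show ?thesis unfolding l by linarith
  qed (use * assms in simp)
qed

text \<open>Flipping digit \<open>n\<close> keeps \<open>run_max n\<close> and \<open>ev n\<close>
  and reverses the increment, so each increment with \<open>n \<ge> N\<close> sums to 0 over the
  class. Those with \<open>n < N\<close> are absent there, as the maximum has not yet passed
  \<open>v\<close>.\<close>

lemma sum_layer_stop_node:
  assumes node: "(N, r) \<in> stop_nodes M v"
  shows "(\<Sum>x\<in>res_class M N r. layer M v x) = 0"
proof -
  define h where "h n x = (if v < run_max n x \<and> run_max n x \<le> 2 * v then ev (Suc n) x - ev n x else 0)" for n x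
  have "(\<Sum>x\<in>res_class M N r. h n x) = 0" if n: "n < M" for n
  proof (cases "N \<le> n")
    case True
    have "(\<Sum>x\<in>res_class M N r. h n x) = (\<Sum>x\<in>res_class M N r. h n (x XOR 2 ^ n))"
      using True n
      by (intro sum.reindex_bij_witness[of _ "\<lambda>x. x XOR 2 ^ n" "\<lambda>x. x XOR 2 ^ n"])
        (auto simp: res_class_def mod_exp_flip xor.assoc intro!: xor_less_exp)
    also have "\<dots> = (\<Sum>x\<in>res_class M N r. - h n x)"
    proof (intro sum.cong refl)
      fix x
      show "h n (x XOR 2 ^ n) = - h n x"
        using ev_flip_add[of n x] unfolding h_def run_max_flip[OF order_refl] ev_flip by auto
    qed
    finally show ?thesis by (simp add: sum_negf)
  next
    case False
    then show ?thesis
      using stop_nodes_unique[OF node _ n] by (intro sum.neutral) (auto simp: res_class_def h_def)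
  qed
  moreover have "layer M v x = (\<Sum>n<M. h n x)" for x
    unfolding layer_def h_def
    by (simp add: sum.inter_filter[symmetric])
  ultimately show ?thesis
    by (simp add: sum.swap[of _ "{..<M}"])
qed

text \<open>A point lies in at most one stopping cylinder, and the layer vanishes outside all of
  them.\<close>

lemma sum_stop_nodes_layer:
  "(\<Sum>(N, r)\<in>stop_nodes M v. if x mod 2 ^ N = r then layer M v x else 0) = layer M v x"
proof (cases "\<exists>n<M. v < run_max n x")
  case True
  then obtain N where N: "(N, x mod 2 ^ N) \<in> stop_nodes M v"
    using stop_nodes_cover by metis
  have "(case p of (N', r) \<Rightarrow> if x mod 2 ^ N' = r then layer M v x else 0)
      = (if p = (N, x mod 2 ^ N) then layer M v x else 0)" if p: "p \<in> stop_nodes M v" for p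
  proof -
    obtain N' r where p': "p = (N', r)" by (cases p)
    show ?thesis
    proof (cases "x mod 2 ^ N' = r")
      case True
      then have "p = (N, x mod 2 ^ N)"
        using stop_nodes_same_level[OF N p[unfolded p'] refl True] p' by metis
      then show ?thesis by simp
    next
      case False
      then have "p \<noteq> (N, x mod 2 ^ N)" using p' by blast
      then show ?thesis using False p' by (simp only: prod.case if_False)
    qed
  qed
  then have "(\<Sum>(N', r)\<in>stop_nodes M v. if x mod 2 ^ N' = r then layer M v x else 0)
      = (\<Sum>p\<in>stop_nodes M v. if p = (N, x mod 2 ^ N) then layer M v x else 0)"
    by (intro sum.cong refl)
  then show ?thesis using N finite_stop_nodes by simp
next
  case False
  then have "layer M v x = 0" unfolding layer_def by (intro sum.neutral) auto
  then show ?thesis by (auto intro!: sum.neutral)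
qed

lemma less_max_ev_iff: "v < max_ev M x \<longleftrightarrow> (\<exists>n\<le>M. v < \<bar>ev n x\<bar>)"
  unfolding max_ev_def by (subst Max_gr_iff) auto

text \<open>The running maximum passes \<open>v\<close> at a stopping cylinder because one of its
  two children does, so at least half of the cylinder lies where the maximal function exceeds
  \<open>v\<close>. Stopping cylinders are disjoint.\<close>

lemma sum_stop_nodes_le:
  "(\<Sum>(N, r)\<in>stop_nodes M v. 2 ^ (M - N)) \<le> 2 * real (card {x. x < 2 ^ M \<and> v < max_ev M x})"
proof -
  define H where "H p = {x \<in> res_class M (fst p) (snd p). v < \<bar>ev (Suc (fst p)) x\<bar>}" for p
  have fin: "finite (H p)" for p unfolding H_def by simp
  have card: "2 ^ (M - fst p) \<le> 2 * card (H p)" if pm: "p \<in> stop_nodes M v" for p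
  proof -
    obtain N r where p: "p = (N, r)" by (cases p)
    have N: "N < M" "r < 2 ^ N" "v < run_max N r" "N = 0 \<or> run_max (N - 1) r \<le> v"
      using pm unfolding p stop_nodes_def by auto
    have "v < child_max N r"
      using N by (cases N) (auto simp: run_max_Suc run_max_0)
    then have "v < \<bar>f (Suc N) r\<bar> \<or> v < \<bar>f (Suc N) (r + 2 ^ N)\<bar>"
      unfolding child_max_def using N(2) by (simp add: less_max_iff_disj)
    then obtain c where c: "c = r \<or> c = r + 2 ^ N" "v < \<bar>f (Suc N) c\<bar>" by blast
    have c2: "c < 2 ^ Suc N" "c mod 2 ^ N = r" using c N by auto
    have "res_class M (Suc N) c \<subseteq> H p"
    proof
      fix x assume x: "x \<in> res_class M (Suc N) c"
      then have "x mod 2 ^ N = r"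
        using c2 mod_mod_cancel[of "2 ^ N" "2 ^ Suc N" x] by (auto simp: res_class_def)
      then show "x \<in> H p" using x c unfolding H_def p by (auto simp: res_class_def ev_def simp del: power_Suc)
    qed
    then have "2 ^ (M - Suc N) \<le> card (H p)"
      using card_mono[OF fin] card_res_class[of "Suc N" M c] N(1) c2 by (metis Suc_leI)
    moreover have "(2::nat) ^ (M - N) = 2 * 2 ^ (M - Suc N)"
      using N(1) by (metis Suc_diff_Suc power_Suc)
    ultimately show ?thesis using p by simp
  qed
  have disj: "H p \<inter> H q = {}" if pq: "p \<in> stop_nodes M v" "q \<in> stop_nodes M v" "p \<noteq> q" for p q
  proof (rule ccontr)
    assume "H p \<inter> H q \<noteq> {}"
    then obtain x where x: "x mod 2 ^ fst p = snd p" "x mod 2 ^ fst q = snd q"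
      unfolding H_def res_class_def by auto
    have "(fst p, snd p) \<in> stop_nodes M v" "(fst q, snd q) \<in> stop_nodes M v" using pq by auto
    from stop_nodes_same_level[OF this x] have "fst p = fst q" .
    then show False using x pq(3) by (simp add: prod_eq_iff)
  qed
  have "(\<Sum>p\<in>stop_nodes M v. 2 ^ (M - fst p)) \<le> (\<Sum>p\<in>stop_nodes M v. 2 * card (H p))"
    by (intro sum_mono card)
  also have "\<dots> = 2 * card (\<Union>p\<in>stop_nodes M v. H p)"
    using card_UN_disjoint[of "stop_nodes M v" H] finite_stop_nodes fin disj
    by (simp add: sum_distrib_left)
  also have "card (\<Union>p\<in>stop_nodes M v. H p) \<le> card {x. x < 2 ^ M \<and> v < max_ev M x}"
  proof (rule card_mono)
    show "(\<Union>p\<in>stop_nodes M v. H p) \<subseteq> {x. x < 2 ^ M \<and> v < max_ev M x}"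
    proof
      fix x assume "x \<in> (\<Union>p\<in>stop_nodes M v. H p)"
      then obtain N r where "N < M" "x < 2 ^ M" "v < \<bar>ev (Suc N) x\<bar>"
        unfolding H_def res_class_def stop_nodes_def by auto
      then show "x \<in> {x. x < 2 ^ M \<and> v < max_ev M x}"
        unfolding less_max_ev_iff using Suc_leI by blast
    qed
  qed simp
  finally have "(\<Sum>p\<in>stop_nodes M v. 2 ^ (M - fst p)) \<le> 2 * card {x. x < 2 ^ M \<and> v < max_ev M x}"
    by simp
  then have "real (\<Sum>p\<in>stop_nodes M v. 2 ^ (M - fst p)) \<le> real (2 * card {x. x < 2 ^ M \<and> v < max_ev M x})"
    by (simp only: of_nat_le_iff)
  then show ?thesis by (simp add: case_prod_unfold)
qed

text \<open>The levels \<open>c * 2 ^ k\<close> partition the positive values of the running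
  maximum, so each increment belongs to exactly one layer; where the maximum is 0 the increment is
  0.\<close>

lemma ev_eq_sum_layers:
  assumes c: "c > 0" "\<And>n. n < M \<Longrightarrow> run_max n x = 0 \<or> c < run_max n x"
    "\<And>n. n < M \<Longrightarrow> run_max n x \<le> c * 2 ^ K"
  shows "ev M x = ev 0 x + (\<Sum>k<K. layer M (c * 2 ^ k) x)"
proof -
  define d where "d n = ev (Suc n) x - ev n x" for n
  have one: "(\<Sum>k<K. if c * 2 ^ k < run_max n x \<and> run_max n x \<le> 2 * (c * 2 ^ k) then d n else 0) = d n"
    if n: "n < M" for n
  proof (cases "run_max n x = 0")
    case True
    then have "child_max n x \<le> 0" using child_max_le_run_max[of n n x] by simp
    then have "d n = 0" unfolding d_def using abs_ev_Suc_le[of n x] abs_ev_le[of n x] by linarith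
    then show ?thesis by (simp add: sum.neutral)
  next
    case False
    have "(\<Sum>k<L. if c * 2 ^ k < run_max n x \<and> run_max n x \<le> 2 * (c * 2 ^ k) then d n else 0)
        = (if run_max n x \<le> c * 2 ^ L then d n else 0)" for L
    proof (induction L)
      case 0
      then show ?case using c(2)[OF n] False by auto
    next
      case (Suc L)
      have "c * 2 ^ L \<le> 2 * (c * 2 ^ L)" using c(1) by simp
      then show ?case using Suc by (auto simp: mult.left_commute)
    qed
    then show ?thesis using c(3)[OF n] by simp
  qed
  have "(\<Sum>k<K. layer M (c * 2 ^ k) x)
      = (\<Sum>k<K. \<Sum>n<M. if c * 2 ^ k < run_max n x \<and> run_max n x \<le> 2 * (c * 2 ^ k) then d n else 0)"
    unfolding layer_def d_def by (simp add: sum.inter_filter[symmetric])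
  also have "\<dots> = (\<Sum>n<M. d n)" by (subst sum.swap) (simp add: one)
  also have "\<dots> = ev M x - ev 0 x" unfolding d_def by (rule sum_lessThan_telescope)
  finally show ?thesis by simp
qed

end

section \<open>Summation over levels and atoms\<close>

text \<open>A layer-cake sum: the levels grow geometrically, so the largest one below
  \<open>y\<close> dominates. The induction also carries the bound
  \<open>3 * sqrt (c * 2 ^ K)\<close>, which reproduces because
  \<open>4 \<le> 3 * sqrt 2\<close>.\<close>

lemma sum_dyadic_levels_le:
  assumes c: "c > 0" and y: "y \<ge> 0"
  shows "(\<Sum>k<K. if c * 2 ^ k < y then sqrt (c * 2 ^ k) else 0) \<le> 4 * sqrt y"
proof -
  define G where "G K = (\<Sum>k<K. if c * 2 ^ k < y then sqrt (c * 2 ^ k) else 0)" for K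
  have s: "4 * sqrt u \<le> 3 * sqrt (2 * u)" if "u \<ge> 0" for u :: real
  proof -
    have "4 / 3 \<le> sqrt 2" by (rule real_le_rsqrt) (simp add: power2_eq_square)
    then have "4 / 3 * sqrt u \<le> sqrt 2 * sqrt u" using that by (intro mult_right_mono) auto
    then show ?thesis by (simp add: real_sqrt_mult)
  qed
  have "G K \<le> 3 * sqrt (c * 2 ^ K) \<and> G K \<le> 4 * sqrt y"
  proof (induction K)
    case 0
    then show ?case using c y by (simp add: G_def)
  next
    case (Suc K)
    have nn: "c * 2 ^ K \<ge> 0" using c by simp
    have 1: "G (Suc K) \<le> 4 * sqrt (c * 2 ^ K)" if "c * 2 ^ K < y"
      using Suc that by (simp add: G_def)
    have 2: "4 * sqrt (c * 2 ^ K) \<le> 3 * sqrt (c * 2 ^ Suc K)"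
      using s[OF nn] by (simp add: mult_ac)
    show ?case
    proof (cases "c * 2 ^ K < y")
      case True
      then have "sqrt (c * 2 ^ K) \<le> sqrt y" by simp
      then show ?thesis using 1[OF True] 2 by linarith
    next
      case False
      then have "G (Suc K) = G K" by (simp add: G_def)
      moreover have "sqrt (c * 2 ^ K) \<ge> 0" using nn by simp
      ultimately show ?thesis using Suc 2 by linarith
    qed
  qed
  then show ?thesis unfolding G_def by blast
qed

lemma fejer_conv_sum:
  "fejer_conv M (\<lambda>y. \<Sum>i\<in>A. g i y) n x = (\<Sum>i\<in>A. fejer_conv M (g i) n x)"
  unfolding fejer_conv_def sum_divide_distrib[symmetric] sum_distrib_right
  by (subst sum.swap) simp

lemma fejer_conv_add:
  "fejer_conv M (\<lambda>y. g y + h y) n x = fejer_conv M g n x + fejer_conv M h n x"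
  unfolding fejer_conv_def by (simp add: distrib_right sum.distrib add_divide_distrib)

lemma fejer_conv_cong:
  "(\<And>y. y < 2 ^ M \<Longrightarrow> g y = h y) \<Longrightarrow> fejer_conv M g n x = fejer_conv M h n x"
  unfolding fejer_conv_def by simp

text \<open>Subadditivity of the square root plays the part of the triangle inequality for the
  exponent 1/2.\<close>

lemma sqrt_abs_add_le: "0 \<le> w \<Longrightarrow> sqrt (\<bar>u + v\<bar> / w) \<le> sqrt (\<bar>u\<bar> / w) + sqrt (\<bar>v\<bar> / w)"
proof -
  assume w: "0 \<le> w"
  have "sqrt (\<bar>u + v\<bar> / w) \<le> sqrt (\<bar>u\<bar> / w + \<bar>v\<bar> / w)"
    using w by (simp add: add_divide_distrib[symmetric] divide_right_mono)
  also have "\<dots> \<le> sqrt (\<bar>u\<bar> / w) + sqrt (\<bar>v\<bar> / w)"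
    using w by (intro sqrt_add_le_add_sqrt) auto
  finally show ?thesis .
qed

lemma sqrt_abs_sum_le: "0 \<le> w \<Longrightarrow> sqrt (\<bar>\<Sum>i\<in>A. u i\<bar> / w) \<le> (\<Sum>i\<in>A. sqrt (\<bar>u i\<bar> / w))"
proof -
  assume w: "0 \<le> w"
  have "sqrt (\<bar>\<Sum>i\<in>A. u i\<bar> / w) \<le> sqrt (\<Sum>i\<in>A. \<bar>u i\<bar> / w)"
    using w by (simp add: sum_divide_distrib[symmetric] divide_right_mono)
  also have "\<dots> \<le> (\<Sum>i\<in>A. sqrt (\<bar>u i\<bar> / w))"
    using w by (intro sqrt_sum_le) auto
  finally show ?thesis .
qed

context dyadic_tree
begin

lemma max_ev_nonneg: "max_ev M x \<ge> 0"
  unfolding max_ev_def by (subst Max_ge_iff) auto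

text \<open>For \<open>n < M\<close> only finitely many values occur, because
  \<open>run_max n\<close> is determined by a code of length \<open>M\<close>.\<close>

lemma level_bounds:
  obtains c K where "c > 0" "\<And>n x. n < M \<Longrightarrow> run_max n x = 0 \<or> c < run_max n x"
    "\<And>n x. n < M \<Longrightarrow> run_max n x \<le> c * 2 ^ K"
proof -
  define X where "X = (\<lambda>(n, x). run_max n x) ` ({..<M} \<times> {..<2 ^ M})"
  have fin: "finite X" unfolding X_def by simp
  have X: "run_max n x \<in> X" if "n < M" for n x
  proof -
    have "run_max n x = run_max n (x mod 2 ^ M)" using run_max_mod[of n M x] that by simp
    then show ?thesis unfolding X_def using that by (intro image_eqI[of _ _ "(n, x mod 2 ^ M)"]) auto
  qed
  have nonneg: "u \<ge> 0" if u: "u \<in> X" for u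
  proof -
    obtain n x where "u = run_max n x" using u unfolding X_def by auto
    then show ?thesis using child_max_le_run_max[of n n x] unfolding child_max_def by linarith
  qed
  \<comment> \<open>The extra element 1 keeps the set nonempty when every value is 0.\<close>
  define Y where "Y = insert 1 {u \<in> X. u > 0}"
  have Y: "finite Y" "Y \<noteq> {}" unfolding Y_def using fin by auto
  define c where "c = Min Y / 2"
  have "Min Y \<in> Y" using Y by (rule Min_in)
  then have cpos: "c > 0" unfolding c_def Y_def by auto
  have c: "c < u" if "u \<in> X" "u \<noteq> 0" for u
  proof -
    have "u \<in> Y" using that nonneg[of u] unfolding Y_def by auto
    then have "Min Y \<le> u" using Y by simp
    then show ?thesis using cpos unfolding c_def by linarith
  qed
  obtain K :: nat where K: "Max Y / c < 2 ^ K" using real_arch_pow[of 2 "Max Y / c"] by auto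
  have "u \<le> c * 2 ^ K" if "u \<in> X" for u
  proof (cases "u = 0")
    case False
    then have "u \<in> Y" using that nonneg[of u] unfolding Y_def by auto
    then have "u \<le> Max Y" using Y by simp
    also have "Max Y \<le> c * 2 ^ K" using K cpos by (simp add: field_simps)
    finally show ?thesis .
  qed (use cpos in simp)
  then show thesis using that[of c K] cpos c X by blast
qed

text \<open>\<open>U\<close> does not depend on \<open>k\<close> and \<open>s\<close>, so it bounds
  the supremum. Its sum is controlled by square roots of levels times sizes of stopping cylinders,
  which the layer-cake bound turns into the square root of the maximal function.\<close>

lemma fejer_conv_majorant:
  "\<exists>U. (\<forall>x. 0 \<le> U x) \<and>
     (\<forall>x s k. x < 2 ^ M \<longrightarrow> s < M \<longrightarrow> 2 ^ s \<le> nk k \<longrightarrow> nk k < 2 ^ Suc s \<longrightarrow>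
        sqrt (\<bar>fejer_conv M (f M) (nk k) x\<bar> / (real (card (endpoint_set nk s)))\<^sup>2) \<le> U x) \<and>
     (\<Sum>x<2 ^ M. U x) \<le> 2210 * (\<Sum>x<2 ^ M. sqrt (max_ev M x))"
proof -
  obtain c K where c: "c > 0" "\<And>n x. n < M \<Longrightarrow> run_max n x = 0 \<or> c < run_max n x"
    "\<And>n x. n < M \<Longrightarrow> run_max n x \<le> c * 2 ^ K"
    using level_bounds[of M] by metis
  define v where "v k = c * 2 ^ k" for k
  have v: "v k > 0" for k unfolding v_def using c(1) by simp
  define maj where "maj = atom_majorant nk M"
  \<comment> \<open>The starting value is a constant atom with \<open>N = 0\<close>; a layer at
    level \<open>v k\<close> restricted to a stopping cylinder is an atom bounded by
    \<open>4 * v k\<close>.\<close>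
  define U where "U x = sqrt \<bar>f 0 0\<bar> * maj 0 0 x
      + (\<Sum>k<K. \<Sum>(N, r)\<in>stop_nodes M (v k). sqrt (4 * v k) * maj N r x)" for x
  have maj0: "maj N r x \<ge> 0" for N r x unfolding maj_def by (rule atom_majorant_nonneg)
  have U0: "0 \<le> U x" for x
    unfolding U_def using maj0 v by (auto intro!: add_nonneg_nonneg sum_nonneg mult_nonneg_nonneg simp: less_imp_le)
  define a where "a k p y = (if y mod 2 ^ fst p = snd p then layer M (v k) y else 0)" for k and p :: "nat \<times> nat" and y
  have rep: "f M y = f 0 0 + (\<Sum>k<K. \<Sum>p\<in>stop_nodes M (v k). a k p y)" if "y < 2 ^ M" for y
  proof -
    have "f M y = f 0 0 + (\<Sum>k<K. layer M (v k) y)"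
      using ev_eq_sum_layers[OF c(1,2,3), of M y] that unfolding v_def ev_def by simp
    also have "(\<Sum>k<K. layer M (v k) y) = (\<Sum>k<K. \<Sum>p\<in>stop_nodes M (v k). a k p y)"
      using sum_stop_nodes_layer[of y M] unfolding a_def case_prod_unfold by simp
    finally show ?thesis .
  qed
  have est: "sqrt (\<bar>fejer_conv M (f M) (nk k) x\<bar> / (real (card (endpoint_set nk s)))\<^sup>2) \<le> U x"
    if x: "x < 2 ^ M" and s: "s < M" and k: "2 ^ s \<le> nk k" "nk k < 2 ^ Suc s" for x s k
  proof -
    define w where "w = (real (card (endpoint_set nk s)))\<^sup>2"
    have w: "w \<ge> 0" unfolding w_def by simp
    define T where "T g = sqrt (\<bar>fejer_conv M g (nk k) x\<bar> / w)" for g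
    have "fejer_conv M (f M) (nk k) x = fejer_conv M (\<lambda>_. f 0 0) (nk k) x
       + (\<Sum>j<K. \<Sum>p\<in>stop_nodes M (v j). fejer_conv M (a j p) (nk k) x)"
      using fejer_conv_cong[OF rep, where n = "nk k" and x = x] by (simp add: fejer_conv_add fejer_conv_sum)
    then have "T (f M) \<le> T (\<lambda>_. f 0 0)
        + sqrt (\<bar>\<Sum>j<K. \<Sum>p\<in>stop_nodes M (v j). fejer_conv M (a j p) (nk k) x\<bar> / w)"
      unfolding T_def by (simp add: sqrt_abs_add_le[OF w])
    also have "sqrt (\<bar>\<Sum>j<K. \<Sum>p\<in>stop_nodes M (v j). fejer_conv M (a j p) (nk k) x\<bar> / w)
        \<le> (\<Sum>j<K. \<Sum>p\<in>stop_nodes M (v j). T (a j p))"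
      unfolding T_def by (rule order_trans[OF sqrt_abs_sum_le[OF w] sum_mono]) (rule sqrt_abs_sum_le[OF w])
    also have "T (\<lambda>_. f 0 0) \<le> sqrt \<bar>f 0 0\<bar> * maj 0 0 x"
      unfolding T_def w_def maj_def by (rule atom_estimate) (use x k s in auto)
    also have "(\<Sum>j<K. \<Sum>p\<in>stop_nodes M (v j). T (a j p))
        \<le> (\<Sum>j<K. \<Sum>(N, r)\<in>stop_nodes M (v j). sqrt (4 * v j) * maj N r x)"
    proof (intro sum_mono)
      fix j p assume p: "p \<in> stop_nodes M (v j)"
      obtain N r where pe: "p = (N, r)" by (cases p)
      have Nr: "N < M" "r < 2 ^ N" using p unfolding pe stop_nodes_def by auto
      have mean: "(\<Sum>y\<in>res_class M N r. a j p y) = 0"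
      proof -
        have "(\<Sum>y\<in>res_class M N r. a j p y) = (\<Sum>y\<in>res_class M N r. layer M (v j) y)"
          unfolding a_def pe by (intro sum.cong) (auto simp: res_class_def)
        then show ?thesis using sum_layer_stop_node p unfolding pe by simp
      qed
      have "T (a j p) \<le> sqrt (4 * v j) * maj N r x"
        unfolding T_def w_def maj_def
      proof (rule atom_estimate[where nk = nk and k = k, OF Nr(2) less_imp_le[OF Nr(1)] _ _ _ x k s])
        show "a j p y = 0" if "y mod 2 ^ N \<noteq> r" for y using that unfolding a_def pe by simp
        show "\<bar>a j p y\<bar> \<le> 4 * v j" for y
          using abs_layer_le[OF v, of M j y] v[of j] unfolding a_def by auto
        show "N = 0 \<or> (\<Sum>y\<in>res_class M N r. a j p y) = 0" using mean by blast
      qed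
      then show "T (a j p) \<le> (case p of (N, r) \<Rightarrow> sqrt (4 * v j) * maj N r x)"
        unfolding pe by simp
    qed
    finally show ?thesis unfolding T_def w_def U_def by simp
  qed
  have sum: "(\<Sum>x<2 ^ M. U x) \<le> 2210 * (\<Sum>x<2 ^ M. sqrt (max_ev M x))"
  proof -
    define m where "m = max_ev M"
    have "(\<Sum>x<2 ^ M. U x) = sqrt \<bar>f 0 0\<bar> * (\<Sum>x<2 ^ M. maj 0 0 x)
        + (\<Sum>k<K. \<Sum>(N, r)\<in>stop_nodes M (v k). sqrt (4 * v k) * (\<Sum>x<2 ^ M. maj N r x))"
      unfolding U_def case_prod_unfold sum.distrib sum_distrib_left
      by (intro arg_cong2[of _ _ _ _ "(+)"] refl, subst sum.swap, intro sum.cong refl, rule sum.swap)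
    also have "\<dots> \<le> sqrt \<bar>f 0 0\<bar> * (130 * 2 ^ (M - 0))
        + (\<Sum>k<K. \<Sum>(N, r)\<in>stop_nodes M (v k). sqrt (4 * v k) * (130 * 2 ^ (M - N)))"
      unfolding maj_def
      by (intro add_mono mult_left_mono sum_mono sum_atom_majorant)
        (auto simp: stop_nodes_def v less_imp_le intro!: mult_left_mono sum_atom_majorant)
    also have "\<dots> = 130 * (2 ^ M * sqrt \<bar>f 0 0\<bar>)
        + (\<Sum>k<K. 260 * sqrt (v k) * (\<Sum>(N, r)\<in>stop_nodes M (v k). 2 ^ (M - N)))"
      by (simp add: real_sqrt_mult case_prod_unfold sum_distrib_left algebra_simps)
    also have "2 ^ M * sqrt \<bar>f 0 0\<bar> \<le> (\<Sum>x<2 ^ M. sqrt (m x))"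
    proof -
      have "\<bar>f 0 0\<bar> \<le> m x" for x
        unfolding m_def max_ev_def by (rule Max_ge) (auto simp: ev_def image_iff intro!: bexI[of _ 0])
      then have "(\<Sum>x::nat<2 ^ M. sqrt \<bar>f 0 0\<bar>) \<le> (\<Sum>x<2 ^ M. sqrt (m x))"
        by (intro sum_mono real_sqrt_le_mono)
      then show ?thesis by simp
    qed
    also have "(\<Sum>k<K. 260 * sqrt (v k) * (\<Sum>(N, r)\<in>stop_nodes M (v k). 2 ^ (M - N)))
        \<le> (\<Sum>k<K. 260 * sqrt (v k) * (2 * real (card {x. x < 2 ^ M \<and> v k < m x})))"
      unfolding m_def by (intro sum_mono mult_left_mono sum_stop_nodes_le) (simp add: v less_imp_le)
    also have "\<dots> = (\<Sum>k<K. \<Sum>x<2 ^ M. 520 * (if v k < m x then sqrt (v k) else 0))"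
    proof (intro sum.cong refl)
      fix k
      have "{x. x < 2 ^ M \<and> v k < m x} = {..<2 ^ M} \<inter> {x. v k < m x}" by auto
      then show "260 * sqrt (v k) * (2 * real (card {x. x < 2 ^ M \<and> v k < m x}))
          = (\<Sum>x<2 ^ M. 520 * (if v k < m x then sqrt (v k) else 0))"
        by (simp add: sum.If_cases sum_distrib_left[symmetric])
    qed
    also have "\<dots> = (\<Sum>x<2 ^ M. 520 * (\<Sum>k<K. if c * 2 ^ k < m x then sqrt (c * 2 ^ k) else 0))"
      unfolding v_def by (subst sum.swap) (simp add: sum_distrib_left)
    also have "\<dots> \<le> (\<Sum>x<2 ^ M. 520 * (4 * sqrt (m x)))"
      using sum_dyadic_levels_le[OF c(1)] max_ev_nonneg
      by (intro sum_mono mult_left_mono) (auto simp: m_def)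
    \<comment> \<open>The constant is \<open>130 + 520 * 4 = 2210\<close>, where
      \<open>520 = 2 * 2 * 130\<close>: one 2 from \<open>sqrt (4 * v k)\<close>, one from
      \<open>sum_stop_nodes_le\<close>.\<close>
    finally show ?thesis by (simp add: m_def sum_distrib_left[symmetric] sum.distrib[symmetric])
  qed
  show ?thesis
    by (rule exI[of _ U]) (use U0 est sum in blast)
qed

end

section \<open>Transfer to the Haar measure\<close>

definition prefix_code :: "nat \<Rightarrow> dyadic \<Rightarrow> nat" where
  "prefix_code n x = (\<Sum>j<n. of_bool (x j = 1) * 2 ^ j)"

text \<open>For \<open>c < 2 ^ n\<close> a representative point of the cylinder with code
  \<open>c\<close>; its coordinates from \<open>n\<close> on are 0.\<close>

definition nat_digits :: "nat \<Rightarrow> dyadic" where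
  "nat_digits c = (\<lambda>j. if bit c j then 1 else 0)"

lemma prefix_code_less: "prefix_code n x < 2 ^ n"
  by (induction n) (auto simp: prefix_code_def)

lemma bit_prefix_code: "bit (prefix_code n x) j \<longleftrightarrow> j < n \<and> x j = 1"
proof (induction n)
  case (Suc n)
  have "prefix_code (Suc n) x = (if x n = 1 then 2 ^ n + prefix_code n x else prefix_code n x)"
    by (simp add: prefix_code_def)
  then show ?case
    using Suc bit_exp_add[OF prefix_code_less, of n x j] by (auto simp: less_Suc_eq)
qed (simp add: prefix_code_def)

lemma prefix_code_mod: "m \<le> n \<Longrightarrow> prefix_code n x mod 2 ^ m = prefix_code m x"
  by (rule bit_eqI) (auto simp: bit_prefix_code bit_take_bit_iff simp flip: take_bit_eq_mod)

lemma prefix_code_nat_digits: "c < 2 ^ n \<Longrightarrow> prefix_code n (nat_digits c) = c"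
  using bit_less_exp[of c _ n] by (intro bit_eqI) (auto simp: bit_prefix_code nat_digits_def split: if_splits)

lemma prefix_code_eq_iff: "prefix_code n x = prefix_code n y \<longleftrightarrow> (\<forall>j<n. x j = y j)"
proof -
  have "(\<forall>j. (j < n \<and> x j = 1) = (j < n \<and> y j = 1)) \<longleftrightarrow> (\<forall>j<n. x j = y j)"
    by (metis bit_not_one_iff)
  then show ?thesis by (simp add: Bit_Operations.bit_eq_iff[of "prefix_code n x"] bit_prefix_code)
qed

lemma cyl_eq: "cyl n x = {y. prefix_code n y = prefix_code n x}"
  unfolding cyl_def prefix_code_eq_iff by auto

lemma space_zeta [simp]: "space (zeta n) = UNIV"
  by (simp add: zeta_def)

lemma sets_zeta: "sets (zeta n) = sigma_sets UNIV (range (cyl n))"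
  by (simp add: zeta_def)

text \<open>The unions of cylinders of length \<open>n\<close> form a sigma-algebra containing the
  generators.\<close>

lemma zeta_saturated:
  assumes "A \<in> sets (zeta n)" "prefix_code n x = prefix_code n y" "x \<in> A"
  shows "y \<in> A"
proof -
  have "\<forall>x y. prefix_code n x = prefix_code n y \<longrightarrow> x \<in> A \<longrightarrow> y \<in> A"
    using assms(1) unfolding sets_zeta
  proof (induction rule: sigma_sets.induct)
    case (Basic a)
    then show ?case by (auto simp: cyl_eq)
  next
    case (Compl a)
    then show ?case by (metis DiffE DiffI UNIV_I)
  next
    case (Union a)
    then show ?case by blast
  qed simp
  then show ?thesis using assms by blast
qed

lemma measurable_prefix_code: "prefix_code n \<in> measurable (zeta n) (count_space {..<2 ^ n})"
proof (subst measurable_count_space_eq2)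
  have "prefix_code n -` {c} \<in> sets (zeta n)" if "c < 2 ^ n" for c
  proof -
    have "prefix_code n -` {c} = cyl n (nat_digits c)" using that by (auto simp: cyl_eq prefix_code_nat_digits)
    then show ?thesis unfolding sets_zeta by auto
  qed
  then show "prefix_code n \<in> space (zeta n) \<rightarrow> {..<2 ^ n} \<and>
      (\<forall>a\<in>{..<2 ^ n}. prefix_code n -` {a} \<inter> space (zeta n) \<in> sets (zeta n))"
    by (auto simp: prefix_code_less)
qed simp

lemma measurable_code_haar: "prefix_code n \<in> measurable haar (count_space {..<2 ^ n})"
  using measurable_from_subalg[OF subalgebra_zeta measurable_prefix_code] .

lemma borel_measurable_prefix_code: "(\<lambda>x. g (prefix_code n x)) \<in> borel_measurable (zeta n)"
  "(\<lambda>x. g (prefix_code n x)) \<in> borel_measurable haar" for g :: "nat \<Rightarrow> 'a :: topological_space"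
  by (rule measurable_compose[OF measurable_prefix_code], simp) (rule measurable_compose[OF measurable_code_haar], simp)

text \<open>The fibre of \<open>h\<close> through \<open>x\<close> is measurable, hence saturated;
  so \<open>h\<close> is a function of the code everywhere, not just almost everywhere.\<close>

lemma borel_measurable_zeta_eq:
  fixes h :: "dyadic \<Rightarrow> real"
  assumes "h \<in> borel_measurable (zeta n)" "prefix_code n x = prefix_code n y"
  shows "h x = h y"
proof -
  have "h -` {h x} \<inter> space (zeta n) \<in> sets (zeta n)"
    using assms(1) by (rule measurable_sets) simp
  from zeta_saturated[OF this assms(2)] show ?thesis by simp
qed

section \<open>Integrals of functions of finitely many coordinates\<close>

lemma emeasure_prefix_code: "c < 2 ^ n \<Longrightarrow> emeasure haar {x. prefix_code n x = c} = ennreal (1 / 2 ^ n)"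
proof -
  assume c: "c < 2 ^ n"
  interpret u: prob_space "uniform_count_measure (UNIV :: bit set)"
    by (intro prob_space_uniform_count_measure finite_UNIV_bit) simp
  interpret P: product_prob_space "\<lambda>_::nat. uniform_count_measure (UNIV :: bit set)" UNIV
    by unfold_locales
  have U: "(UNIV :: bit set) = {0, 1}" using bit.exhaust by auto
  have "{x. prefix_code n x = c} = {x \<in> space haar. \<forall>j\<in>{..<n}. x j \<in> {nat_digits c j}}"
    using prefix_code_eq_iff[of n _ "nat_digits c"] prefix_code_nat_digits[OF c] by auto
  also have "emeasure haar \<dots> = (\<Prod>j<n. emeasure (uniform_count_measure (UNIV :: bit set)) {nat_digits c j})"
    unfolding haar_def by (rule P.emeasure_PiM_Collect) (auto simp: sets_uniform_count_measure)
  also have "\<dots> = (\<Prod>j<n. ennreal (1 / 2))"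
  proof (intro prod.cong refl)
    fix j
    show "emeasure (uniform_count_measure (UNIV :: bit set)) {nat_digits c j} = ennreal (1 / 2)"
      using finite_UNIV_bit by (subst emeasure_uniform_count_measure) (simp_all, simp add: U)
  qed
  also have "\<dots> = ennreal (1 / 2 ^ n)"
    by (simp only: prod_constant card_lessThan) (subst ennreal_power, simp_all add: power_one_over)
  finally show ?thesis .
qed

lemma sets_prefix_code: "{x. prefix_code n x = c} \<in> sets haar"
proof (cases "c < 2 ^ n")
  case True
  then have "{x. prefix_code n x = c} = cyl n (nat_digits c)" by (auto simp: cyl_eq prefix_code_nat_digits)
  then show ?thesis using sets_cyl by simp
next
  case False
  then have "{x. prefix_code n x = c} = {}" using prefix_code_less[of n] by auto
  then show ?thesis by simp
qed

lemma nn_integral_prefix_code: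
  fixes g :: "nat \<Rightarrow> ennreal"
  shows "(\<integral>\<^sup>+x. g (prefix_code n x) \<partial>haar) = (\<Sum>c<2 ^ n. g c * ennreal (1 / 2 ^ n))"
proof -
  have "(\<integral>\<^sup>+x. g (prefix_code n x) \<partial>haar) = (\<integral>\<^sup>+x. (\<Sum>c<2 ^ n. g c * indicator {x. prefix_code n x = c} x) \<partial>haar)"
  proof (intro nn_integral_cong)
    fix x
    have "(\<Sum>c<2 ^ n. g c * indicator {x. prefix_code n x = c} x) = (\<Sum>c<2 ^ n. if c = prefix_code n x then g c else 0)"
      by (intro sum.cong) (auto simp: indicator_def)
    then show "g (prefix_code n x) = (\<Sum>c<2 ^ n. g c * indicator {x. prefix_code n x = c} x)"
      by (simp add: prefix_code_less)
  qed
  also have "\<dots> = (\<Sum>c<2 ^ n. \<integral>\<^sup>+x. g c * indicator {x. prefix_code n x = c} x \<partial>haar)"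
    by (intro nn_integral_sum) (use sets_prefix_code in measurable)
  also have "\<dots> = (\<Sum>c<2 ^ n. g c * ennreal (1 / 2 ^ n))"
    by (intro sum.cong refl) (simp add: nn_integral_cmult_indicator sets_prefix_code emeasure_prefix_code)
  finally show ?thesis .
qed

lemma has_bochner_integral_prefix_code:
  fixes g :: "nat \<Rightarrow> real"
  shows "has_bochner_integral haar (\<lambda>x. g (prefix_code n x)) ((\<Sum>c<2 ^ n. g c) / 2 ^ n)"
proof -
  have eq: "g (prefix_code n x) = (\<Sum>c<2 ^ n. g c * indicator {x. prefix_code n x = c} x)" for x
  proof -
    have "(\<Sum>c<2 ^ n. g c * indicator {x. prefix_code n x = c} x) = (\<Sum>c<2 ^ n. if c = prefix_code n x then g c else 0)"
      by (intro sum.cong) (auto simp: indicator_def)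
    then show ?thesis by (simp add: prefix_code_less)
  qed
  have "has_bochner_integral haar (\<lambda>x. \<Sum>c<2 ^ n. g c * indicator {x. prefix_code n x = c} x)
      (\<Sum>c<2 ^ n. g c * (1 / 2 ^ n))"
  proof (intro has_bochner_integral_sum has_bochner_integral_mult_right)
    fix c :: nat assume c: "c \<in> {..<2 ^ n}"
    then have "measure haar {x. prefix_code n x = c} = 1 / 2 ^ n"
      using emeasure_prefix_code[of c n] by (simp add: measure_def)
    then show "has_bochner_integral haar (indicat_real {x. prefix_code n x = c}) (1 / 2 ^ n)"
      using has_bochner_integral_real_indicator[OF sets_prefix_code[of n c]] emeasure_prefix_code[of c n] c by simp
  qed
  then show ?thesis unfolding eq by (simp add: sum_divide_distrib)
qed

lemmas integrable_prefix_code = has_bochner_integral_prefix_code[THEN integrable.intros]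
lemmas integral_prefix_code = has_bochner_integral_prefix_code[THEN has_bochner_integral_integral_eq]

lemma sigma_finite_subalgebra_zeta: "sigma_finite_subalgebra haar (zeta n)"
proof -
  interpret prob_space haar by (rule prob_space_haar)
  have "finite_measure_subalgebra haar (zeta n)"
    by unfold_locales (rule subalgebra_zeta)
  then show ?thesis by (rule finite_measure_subalgebra_is_sigma_finite)
qed

section \<open>Martingales as dyadic trees\<close>

text \<open>Measurability lets \<open>F n\<close> be read off at representatives. Integrating the
  almost sure identity over one cylinder of length \<open>n\<close>, which has positive measure,
  gives the averaging property.\<close>

lemma martingale_imp_tree:
  assumes "dyadic_martingale F"
  obtains f where "dyadic_tree f" "\<And>n x. F n x = f n (prefix_code n x)"
proof -
  define f where "f n c = F n (nat_digits c)" for n c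
  have Fm: "F n \<in> borel_measurable (zeta n)" and Fi: "integrable haar (F n)" for n
    using assms unfolding dyadic_martingale_def by auto
  have F: "F n x = f n (prefix_code n x)" for n x
    unfolding f_def by (rule borel_measurable_zeta_eq[OF Fm]) (simp add: prefix_code_nat_digits prefix_code_less)
  have "f n c = (f (Suc n) c + f (Suc n) (c + 2 ^ n)) / 2" if c: "c < 2 ^ n" for c n
  proof -
    interpret sigma_finite_subalgebra haar "zeta n" by (rule sigma_finite_subalgebra_zeta)
    have A: "{x. prefix_code n x = c} \<in> sets (zeta n)"
      using measurable_sets[OF measurable_prefix_code, of "{c}" n] c by (simp add: vimage_def)
    have AE: "AE x in haar. real_cond_exp haar (zeta n) (F (Suc n)) x = F n x"
      using assms unfolding dyadic_martingale_def by (meson le_SucI order_refl)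
    have "(LINT x:{x. prefix_code n x = c}|haar. F (Suc n) x)
        = (LINT x:{x. prefix_code n x = c}|haar. real_cond_exp haar (zeta n) (F (Suc n)) x)"
      using real_cond_exp_intA[OF Fi A] .
    also have "\<dots> = (LINT x:{x. prefix_code n x = c}|haar. F n x)"
      unfolding set_lebesgue_integral_def
    proof (rule integral_cong_AE)
      show "AE x in haar. indicat_real {x. prefix_code n x = c} x *\<^sub>R real_cond_exp haar (zeta n) (F (Suc n)) x
          = indicat_real {x. prefix_code n x = c} x *\<^sub>R F n x"
        using AE by eventually_elim simp
    qed (use sets_prefix_code[of n c] Fi[THEN borel_measurable_integrable] in measurable)
    finally have eq: "(LINT x:{x. prefix_code n x = c}|haar. F (Suc n) x) = (LINT x:{x. prefix_code n x = c}|haar. F n x)" .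
    have "(LINT x:{x. prefix_code n x = c}|haar. F n x) = (\<integral>x. (\<lambda>d. if d = c then f n d else 0) (prefix_code n x) \<partial>haar)"
      unfolding set_lebesgue_integral_def by (intro Bochner_Integration.integral_cong) (auto simp: F indicator_def)
    also have "\<dots> = (\<Sum>d<2 ^ n. if d = c then f n d else 0) / 2 ^ n"
      by (rule integral_prefix_code)
    also have "\<dots> = f n c / 2 ^ n" using c by simp
    finally have 1: "(LINT x:{x. prefix_code n x = c}|haar. F n x) = f n c / 2 ^ n" .
    have "(LINT x:{x. prefix_code n x = c}|haar. F (Suc n) x)
        = (\<integral>x. (\<lambda>d. if d mod 2 ^ n = c then f (Suc n) d else 0) (prefix_code (Suc n) x) \<partial>haar)"
      unfolding set_lebesgue_integral_def
      by (intro Bochner_Integration.integral_cong) (auto simp: F indicator_def prefix_code_mod)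
    also have "\<dots> = (\<Sum>d<2 ^ Suc n. if d mod 2 ^ n = c then f (Suc n) d else 0) / 2 ^ Suc n"
      by (rule integral_prefix_code)
    also have "\<dots> = (\<Sum>d\<in>res_class (Suc n) n c. f (Suc n) d) / 2 ^ Suc n"
      by (simp add: sum.inter_filter[symmetric] res_class_def)
    also have "\<dots> = (f (Suc n) c + f (Suc n) (c + 2 ^ n)) / 2 ^ Suc n"
      using c by (simp add: sum_res_class_Suc res_class_same)
    finally have 2: "(LINT x:{x. prefix_code n x = c}|haar. F (Suc n) x)
        = (f (Suc n) c + f (Suc n) (c + 2 ^ n)) / 2 ^ Suc n" .
    have "(f (Suc n) c + f (Suc n) (c + 2 ^ n)) / 2 / 2 ^ n = f n c / 2 ^ n"
      using eq unfolding 1 2 by simp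
    then show ?thesis by (simp only: divide_cancel_right) simp
  qed
  then have "dyadic_tree f" by unfold_locales
  then show thesis using F that by blast
qed

context dyadic_tree
begin

lemma avg_add: "c < 2 ^ n \<Longrightarrow> f (Suc n) c + f (Suc n) (c + 2 ^ n) = 2 * f n c"
  using avg[of c n] by simp

text \<open>An integral over a set that depends on \<open>m\<close> coordinates: summing out the
  last digit replaces the term by the preceding one.\<close>

lemma sum_level:
  assumes "m \<le> n"
  shows "(\<Sum>d<2 ^ n. (if d mod 2 ^ m \<in> B then f n d else 0)) / 2 ^ n
    = (\<Sum>c<2 ^ m. if c \<in> B then f m c else 0) / 2 ^ m"
  using assms
proof (induction n rule: dec_induct)
  case base
  show ?case by (intro arg_cong2[of _ _ _ _ "(/)"] sum.cong refl) auto
next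
  case (step n)
  have "(2::nat) ^ m dvd 2 ^ n" using step.hyps by (intro le_imp_power_dvd)
  then have *: "(y + 2 ^ n) mod 2 ^ m = y mod 2 ^ m" for y :: nat
    by (metis dvd_eq_mod_eq_0 mod_add_right_eq add.right_neutral)
  have "(\<Sum>d<2 ^ Suc n. (if d mod 2 ^ m \<in> B then f (Suc n) d else 0))
      = (\<Sum>d<2 ^ n. 2 * (if d mod 2 ^ m \<in> B then f n d else 0))"
    unfolding sum_exp_Suc by (intro sum.cong refl) (auto simp: * avg_add)
  then show ?case using step.IH by (simp add: sum_distrib_left[symmetric])
qed

lemma martingale: "dyadic_martingale (\<lambda>n x. f n (prefix_code n x))"
  unfolding dyadic_martingale_def
proof (intro conjI allI impI)
  fix n
  show "(\<lambda>x. f n (prefix_code n x)) \<in> borel_measurable (zeta n)" by (rule borel_measurable_prefix_code)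
  show "integrable haar (\<lambda>x. f n (prefix_code n x))" by (rule integrable_prefix_code)
next
  fix m n :: nat assume mn: "m \<le> n"
  interpret sigma_finite_subalgebra haar "zeta m" by (rule sigma_finite_subalgebra_zeta)
  show "AE x in haar. real_cond_exp haar (zeta m) (\<lambda>x. f n (prefix_code n x)) x = f m (prefix_code m x)"
  proof (rule real_cond_exp_charact)
    fix A assume A: "A \<in> sets (zeta m)"
    \<comment> \<open>Saturation makes \<open>A\<close> a union of cylinders, described by the set
      \<open>B\<close> of their codes.\<close>
    obtain B where ind: "x \<in> A \<longleftrightarrow> prefix_code m x \<in> B" for x
    proof
      show "x \<in> A \<longleftrightarrow> prefix_code m x \<in> prefix_code m ` A" for x
        using zeta_saturated[OF A] by (metis imageE imageI)
    qed
    have "(LINT x:A|haar. f n (prefix_code n x))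
        = (\<integral>x. (\<lambda>d. if d mod 2 ^ m \<in> B then f n d else 0) (prefix_code n x) \<partial>haar)"
      unfolding set_lebesgue_integral_def
      by (intro Bochner_Integration.integral_cong) (simp_all add: indicator_def prefix_code_mod[OF mn] ind)
    also have "\<dots> = (\<Sum>d<2 ^ n. if d mod 2 ^ m \<in> B then f n d else 0) / 2 ^ n"
      by (rule integral_prefix_code)
    also have "\<dots> = (\<Sum>c<2 ^ m. if c \<in> B then f m c else 0) / 2 ^ m"
      by (rule sum_level[OF mn])
    also have "\<dots> = (\<integral>x. (\<lambda>c. if c \<in> B then f m c else 0) (prefix_code m x) \<partial>haar)"
      by (rule integral_prefix_code[symmetric])
    also have "\<dots> = (LINT x:A|haar. f m (prefix_code m x))"
      unfolding set_lebesgue_integral_def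
      by (intro Bochner_Integration.integral_cong) (simp_all add: indicator_def ind)
    finally show "(LINT x:A|haar. f n (prefix_code n x)) = (LINT x:A|haar. f m (prefix_code m x))" .
  qed (rule integrable_prefix_code borel_measurable_prefix_code)+
qed

section \<open>Fourier coefficients and Fejer means of a tree\<close>

lemma walsh_eq: "k < 2 ^ n \<Longrightarrow> walsh k x = wal k (prefix_code n x)"
  unfolding walsh_def wal_def
  by (intro prod.cong refl) (simp add: rad_def bit_prefix_code bit_less_exp)

lemma sum_wal_level:
  assumes "M \<le> n" "k < 2 ^ M"
  shows "(\<Sum>c<2 ^ n. f n c * wal k c) / 2 ^ n = (\<Sum>c<2 ^ M. f M c * wal k c) / 2 ^ M"
  using assms(1)
proof (induction n rule: dec_induct)
  case (step n)
  have kn: "k < 2 ^ n" using assms(2) step.hyps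
    by (meson order_less_le_trans one_le_numeral power_increasing)
  have "wal k (c + 2 ^ n) = wal k c" for c
    using wal_mod[OF kn, of "c + 2 ^ n"] wal_mod[OF kn, of c] by simp
  then have "f (Suc n) c * wal k c + f (Suc n) (c + 2 ^ n) * wal k (c + 2 ^ n) = 2 * (f n c * wal k c)"
    if "c < 2 ^ n" for c
    using that by (simp add: distrib_right[symmetric] avg_add)
  then have "(\<Sum>c<2 ^ Suc n. f (Suc n) c * wal k c) = (\<Sum>c<2 ^ n. 2 * (f n c * wal k c))"
    unfolding sum_exp_Suc by (intro sum.cong refl) simp
  then show ?case using step.IH by (simp add: sum_distrib_left[symmetric])
qed simp

text \<open>The Walsh function depends on \<open>M\<close> coordinates only, so the sequence in the
  limit is constant from index \<open>M\<close> on.\<close>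

lemma wf_coeff_eq:
  assumes "k < 2 ^ M"
  shows "wf_coeff (\<lambda>n x. f n (prefix_code n x)) k = (\<Sum>c<2 ^ M. f M c * wal k c) / 2 ^ M"
  unfolding wf_coeff_def
proof (rule limI, rule tendsto_eventually, rule eventually_sequentiallyI[of M])
  fix n assume n: "M \<le> n"
  have kn: "k < 2 ^ n" using assms n
    by (meson order_less_le_trans one_le_numeral power_increasing)
  have "(\<integral>x. f n (prefix_code n x) * walsh k x \<partial>haar) = (\<integral>x. (\<lambda>c. f n c * wal k c) (prefix_code n x) \<partial>haar)"
    by (simp add: walsh_eq[OF kn])
  also have "\<dots> = (\<Sum>c<2 ^ n. f n c * wal k c) / 2 ^ n"
    by (rule integral_prefix_code)
  also have "\<dots> = (\<Sum>c<2 ^ M. f M c * wal k c) / 2 ^ M"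
    by (rule sum_wal_level[OF n assms])
  finally show "(\<integral>x. f n (prefix_code n x) * walsh k x \<partial>haar) = (\<Sum>c<2 ^ M. f M c * wal k c) / 2 ^ M" .
qed

text \<open>Walsh functions are characters, so inserting the coefficients gives convolutions with
  Dirichlet kernels; only frequencies below \<open>2 ^ M\<close> occur.\<close>

lemma fejer_eq_conv:
  assumes "n \<le> 2 ^ M"
  shows "fejer n (\<lambda>n x. f n (prefix_code n x)) x = fejer_conv M (f M) n (prefix_code M x)"
proof -
  define z where "z = prefix_code M x"
  have ps: "partial_sum k (\<lambda>n x. f n (prefix_code n x)) x = (\<Sum>c<2 ^ M. f M c * dir_ker k (z XOR c)) / 2 ^ M"
    if k: "k \<in> {1..n}" for k
  proof -
    have "partial_sum k (\<lambda>n x. f n (prefix_code n x)) x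
        = (\<Sum>j<k. (\<Sum>c<2 ^ M. f M c * wal j c) / 2 ^ M * wal j z)"
      unfolding partial_sum_def z_def
    proof (intro sum.cong refl)
      fix j assume "j \<in> {..<k}"
      then have j: "j < 2 ^ M" using k assms by auto
      show "wf_coeff (\<lambda>n x. f n (prefix_code n x)) j * walsh j x
          = (\<Sum>c<2 ^ M. f M c * wal j c) / 2 ^ M * wal j (prefix_code M x)"
        unfolding wf_coeff_eq[OF j] walsh_eq[OF j] ..
    qed
    also have "\<dots> = (\<Sum>j<k. \<Sum>c<2 ^ M. f M c * wal j (z XOR c)) / 2 ^ M"
      unfolding sum_divide_distrib sum_distrib_right by (intro sum.cong refl) (simp add: wal_xor)
    also have "\<dots> = (\<Sum>c<2 ^ M. f M c * dir_ker k (z XOR c)) / 2 ^ M"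
      unfolding dir_ker_def sum_distrib_left by (subst sum.swap) simp
    finally show ?thesis .
  qed
  have "fejer n (\<lambda>n x. f n (prefix_code n x)) x
      = (1 / real n) * (\<Sum>k=1..n. (\<Sum>c<2 ^ M. f M c * dir_ker k (z XOR c)) / 2 ^ M)"
    unfolding fejer_def by (intro arg_cong[of _ _ "(*) _"] sum.cong refl ps)
  also have "\<dots> = (\<Sum>c<2 ^ M. f M c * dir_sum n (z XOR c)) / (real n * 2 ^ M)"
    unfolding dir_sum_def sum_distrib_left sum_divide_distrib
    by (subst sum.swap) (simp add: sum_divide_distrib)
  finally show ?thesis unfolding fejer_conv_def z_def .
qed

end

section \<open>Square roots of extended nonnegative values\<close>

text \<open>Square root and squaring form a Galois connection; monotonicity and commutation with
  suprema follow from it.\<close>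

lemma epowr_half_le_iff: "epowr a (1 / 2) \<le> u \<longleftrightarrow> a \<le> u * u"
proof (cases a; cases u)
  fix r s assume a: "a = ennreal r" "0 \<le> r" and u: "u = ennreal s" "0 \<le> s"
  have "sqrt r \<le> s \<longleftrightarrow> r \<le> s * s"
    using a u by (metis real_sqrt_le_iff real_sqrt_mult_self abs_of_nonneg real_sqrt_abs2)
  then show ?thesis
    using a u by (simp add: epowr_def powr_half_sqrt ennreal_mult[symmetric])
qed (auto simp: epowr_def ennreal_mult_eq_top_iff ennreal_top_mult top_unique
    intro: ennreal_mult_less_top)

lemma epowr_half_ennreal: "r \<ge> 0 \<Longrightarrow> epowr (ennreal r) (1 / 2) = ennreal (sqrt r)"
  by (simp add: epowr_def powr_half_sqrt)

lemma epowr_half_SUP: "epowr (SUP i\<in>I. g i) (1 / 2) = (SUP i\<in>I. epowr (g i) (1 / 2))"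
proof (rule antisym)
  show "epowr (SUP i\<in>I. g i) (1 / 2) \<le> (SUP i\<in>I. epowr (g i) (1 / 2))"
    unfolding epowr_half_le_iff
  proof (rule SUP_least)
    fix i assume "i \<in> I"
    then have "epowr (g i) (1 / 2) \<le> (SUP i\<in>I. epowr (g i) (1 / 2))" by (rule SUP_upper)
    then show "g i \<le> (SUP i\<in>I. epowr (g i) (1 / 2)) * (SUP i\<in>I. epowr (g i) (1 / 2))"
      unfolding epowr_half_le_iff .
  qed
  show "(SUP i\<in>I. epowr (g i) (1 / 2)) \<le> epowr (SUP i\<in>I. g i) (1 / 2)"
  proof (rule SUP_least)
    fix i assume "i \<in> I"
    moreover have "(SUP i\<in>I. g i) \<le> epowr (SUP i\<in>I. g i) (1 / 2) * epowr (SUP i\<in>I. g i) (1 / 2)"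
      using epowr_half_le_iff by blast
    ultimately show "epowr (g i) (1 / 2) \<le> epowr (SUP i\<in>I. g i) (1 / 2)"
      unfolding epowr_half_le_iff by (meson SUP_upper order_trans)
  qed
qed

lemma Lp_norm_half: "Lp_norm (1 / 2) f = (\<integral>\<^sup>+x. epowr (f x) (1 / 2) \<partial>haar) * (\<integral>\<^sup>+x. epowr (f x) (1 / 2) \<partial>haar)"
proof -
  have "epowr a 2 = a * a" for a
    by (cases a) (auto simp: epowr_def power2_eq_square ennreal_mult ennreal_top_mult powr_numeral)
  then show ?thesis unfolding Lp_norm_def by simp
qed

section \<open>Boundedness\<close>

lemma msb_eq:
  assumes "2 ^ s \<le> n" "n < 2 ^ Suc s"
  shows "msb n = s"
proof -
  obtain m where m: "n = 2 ^ s + m" "m < 2 ^ s"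
    using assms by (metis add_less_cancel_left le_Suc_ex mult_2 power_Suc)
  show ?thesis
    unfolding msb_def
  proof (rule Max_eqI)
    show "finite {j. bit n j}" by (rule finite_bits)
    show "s \<in> {j. bit n j}" using bit_exp_add[OF m(2)] m(1) by simp
    show "j \<le> s" if "j \<in> {j. bit n j}" for j
      using that bit_less_exp[OF _ assms(2)] by (simp add: less_Suc_eq_le)
  qed
qed

lemma epowr_half_mono: "a \<le> b \<Longrightarrow> epowr a (1 / 2) \<le> epowr b (1 / 2)"
  unfolding epowr_half_le_iff by (meson epowr_half_le_iff order_refl order_trans)

lemma (in dyadic_tree) nn_integral_sqrt_max_ev_le:
  "(\<integral>\<^sup>+x. ennreal (sqrt (max_ev M (prefix_code M x))) \<partial>haar)
    \<le> (\<integral>\<^sup>+x. epowr (maximal_fun (\<lambda>n x. f n (prefix_code n x)) x) (1 / 2) \<partial>haar)"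
proof (rule nn_integral_mono)
  fix x
  have "max_ev M (prefix_code M x) \<in> (\<lambda>n. \<bar>ev n (prefix_code M x)\<bar>) ` {..M}"
    unfolding max_ev_def by (rule Max_in) auto
  then obtain n where "n \<le> M" "max_ev M (prefix_code M x) = \<bar>f n (prefix_code n x)\<bar>"
    by (auto simp: ev_def prefix_code_mod)
  then have "ennreal (max_ev M (prefix_code M x)) \<le> maximal_fun (\<lambda>n x. f n (prefix_code n x)) x"
    unfolding maximal_fun_def by (auto intro: SUP_upper2[of n])
  from epowr_half_mono[OF this]
  show "ennreal (sqrt (max_ev M (prefix_code M x))) \<le> epowr (maximal_fun (\<lambda>n x. f n (prefix_code n x)) x) (1 / 2)"
    using max_ev_nonneg by (simp add: epowr_half_ennreal)
qed

text \<open>The supremum over indices below \<open>2 ^ M\<close> is a function of \<open>M\<close>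
  coordinates, for which the finite estimate holds with a constant free of \<open>M\<close>;
  monotone convergence removes the truncation.\<close>

lemma (in dyadic_tree) nn_integral_weighted_fejer_max_le:
  fixes nk :: "nat \<Rightarrow> nat"
  assumes pos: "\<And>k. nk k > 0"
  defines "F \<equiv> \<lambda>n x. f n (prefix_code n x)" and "\<phi> \<equiv> \<lambda>s. (real (card (endpoint_set nk s)))\<^sup>2"
  shows "(\<integral>\<^sup>+x. epowr (weighted_fejer_max nk \<phi> F x) (1 / 2) \<partial>haar)
    \<le> ennreal 2210 * (\<integral>\<^sup>+x. epowr (maximal_fun F x) (1 / 2) \<partial>haar)"
proof -
  define H where "H M c = (SUP k\<in>{k. nk k < 2 ^ M}.
      epowr (ennreal (\<bar>fejer_conv M (f M) (nk k) c\<bar> / \<phi> (msb (nk k)))) (1 / 2))" for M c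
  \<comment> \<open>In this form the terms do not mention \<open>M\<close>, so enlarging
    \<open>M\<close> only enlarges the index set.\<close>
  have H: "H M (prefix_code M x) = (SUP k\<in>{k. nk k < 2 ^ M}. epowr (ennreal (\<bar>fejer (nk k) F x\<bar> / \<phi> (msb (nk k)))) (1 / 2))"
    for M x
    unfolding H_def F_def
    by (intro SUP_cong refl) (use fejer_eq_conv[OF less_imp_le] in auto)
  have "epowr (weighted_fejer_max nk \<phi> F x) (1 / 2) = (SUP M. H M (prefix_code M x))" for x
  proof -
    have "(\<Union>M. {k. nk k < 2 ^ M}) = UNIV" by (auto intro: less_exp)
    then show ?thesis
      unfolding weighted_fejer_max_def epowr_half_SUP H SUP_UNION[symmetric] by simp
  qed
  moreover have "(\<integral>\<^sup>+x. (SUP M. H M (prefix_code M x)) \<partial>haar) = (SUP M. \<integral>\<^sup>+x. H M (prefix_code M x) \<partial>haar)"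
  proof (rule nn_integral_monotone_convergence_SUP)
    show "incseq (\<lambda>M x. H M (prefix_code M x))"
      unfolding H
    proof (intro incseq_SucI le_funI SUP_subset_mono order_refl)
      fix M show "{k. nk k < 2 ^ M} \<subseteq> {k. nk k < 2 ^ Suc M}" by auto
    qed
    show "(\<lambda>x. H M (prefix_code M x)) \<in> borel_measurable haar" for M by (rule borel_measurable_prefix_code)
  qed
  moreover have "(\<integral>\<^sup>+x. H M (prefix_code M x) \<partial>haar) \<le> ennreal 2210 * (\<integral>\<^sup>+x. epowr (maximal_fun F x) (1 / 2) \<partial>haar)" for M
  proof -
    obtain U where U: "\<And>x. 0 \<le> U x"
      "\<And>x s k. x < 2 ^ M \<Longrightarrow> s < M \<Longrightarrow> 2 ^ s \<le> nk k \<Longrightarrow> nk k < 2 ^ Suc s \<Longrightarrow>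
        sqrt (\<bar>fejer_conv M (f M) (nk k) x\<bar> / (real (card (endpoint_set nk s)))\<^sup>2) \<le> U x"
      "(\<Sum>x<2 ^ M. U x) \<le> 2210 * (\<Sum>x<2 ^ M. sqrt (max_ev M x))"
      using fejer_conv_majorant[of M nk] by metis
    have HU: "H M c \<le> ennreal (U c)" if c: "c < 2 ^ M" for c
      unfolding H_def
    proof (rule SUP_least)
      fix k assume k: "k \<in> {k. nk k < 2 ^ M}"
      obtain s m where s: "nk k = 2 ^ s + m" "m < 2 ^ s" using exp_decomp[OF pos[of k]] by metis
      have s2: "2 ^ s \<le> nk k" "nk k < 2 ^ Suc s" using s by auto
      have "(2::nat) ^ s < 2 ^ M" using s2 k by (metis mem_Collect_eq order_le_less_trans)
      then have "s < M" by simp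
      from U(2)[OF c this s2]
      show "epowr (ennreal (\<bar>fejer_conv M (f M) (nk k) c\<bar> / \<phi> (msb (nk k)))) (1 / 2) \<le> ennreal (U c)"
        by (simp add: epowr_half_ennreal \<phi>_def msb_eq[OF s2] ennreal_leI)
    qed
    have "(\<integral>\<^sup>+x. H M (prefix_code M x) \<partial>haar) \<le> (\<Sum>c<2 ^ M. ennreal (U c) * ennreal (1 / 2 ^ M))"
      unfolding nn_integral_prefix_code by (intro sum_mono mult_right_mono HU) auto
    also have "\<dots> = ennreal ((\<Sum>c<2 ^ M. U c) / 2 ^ M)"
      using U(1) by (simp add: ennreal_mult[symmetric] sum_ennreal sum_divide_distrib)
    also have "\<dots> \<le> ennreal (2210 * ((\<Sum>x<2 ^ M. sqrt (max_ev M x)) / 2 ^ M))"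
      using U(3) by (intro ennreal_leI) (simp add: divide_right_mono)
    also have "\<dots> = ennreal 2210 * ennreal ((\<Sum>x<2 ^ M. sqrt (max_ev M x)) / 2 ^ M)"
      by (intro ennreal_mult) (auto intro!: divide_nonneg_nonneg sum_nonneg simp: max_ev_nonneg)
    also have "ennreal ((\<Sum>x<2 ^ M. sqrt (max_ev M x)) / 2 ^ M)
        = (\<Sum>c<2 ^ M. ennreal (sqrt (max_ev M c)) * ennreal (1 / 2 ^ M))"
      by (simp add: ennreal_mult[symmetric] sum_ennreal sum_divide_distrib max_ev_nonneg)
    also have "\<dots> = (\<integral>\<^sup>+x. ennreal (sqrt (max_ev M (prefix_code M x))) \<partial>haar)"
      by (rule nn_integral_prefix_code[symmetric])
    also have "\<dots> \<le> (\<integral>\<^sup>+x. epowr (maximal_fun F x) (1 / 2) \<partial>haar)"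
      unfolding F_def by (rule nn_integral_sqrt_max_ev_le)
    finally show ?thesis by (simp add: mult_left_mono)
  qed
  ultimately show ?thesis by (simp add: SUP_least)
qed

lemma bounded_weighted_fejer_max:
  fixes nk :: "nat \<Rightarrow> nat"
  assumes "\<And>k. nk k > 0"
  shows "bounded_hardy_Lp (1/2) (weighted_fejer_max nk (\<lambda>s. (real (card (endpoint_set nk s)))\<^sup>2))"
  unfolding bounded_hardy_Lp_def
proof (intro exI ballI)
  fix F assume "F \<in> hardy_space (1/2)"
  then have "dyadic_martingale F" unfolding hardy_space_def by blast
  then obtain f where f: "dyadic_tree f" "\<And>n x. F n x = f n (prefix_code n x)"
    using martingale_imp_tree by blast
  have F: "F = (\<lambda>n x. f n (prefix_code n x))" using f(2) by blast
  interpret dyadic_tree f by (rule f(1))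
  define J where "J = (\<integral>\<^sup>+x. epowr (maximal_fun F x) (1 / 2) \<partial>haar)"
  have "Lp_norm (1/2) (weighted_fejer_max nk (\<lambda>s. (real (card (endpoint_set nk s)))\<^sup>2) F)
      \<le> (ennreal 2210 * J) * (ennreal 2210 * J)"
    unfolding Lp_norm_half J_def F
    by (intro mult_mono nn_integral_weighted_fejer_max_le assms) auto
  also have "\<dots> = ennreal (2210 * 2210) * hardy_norm (1/2) F"
    unfolding hardy_norm_def Lp_norm_half J_def by (simp add: ennreal_mult mult_ac)
  finally show "Lp_norm (1/2) (weighted_fejer_max nk (\<lambda>s. (real (card (endpoint_set nk s)))\<^sup>2) F)
      \<le> ennreal (2210 * 2210) * hardy_norm (1/2) F" .
qed

section \<open>Lower bounds and sharpness\<close>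

text \<open>Digit \<open>i\<close> annihilates the Dirichlet terms from level \<open>Suc i\<close>
  on, and digit \<open>Suc i\<close> the factor \<open>1 + rad (Suc i) x\<close>; once 0, the
  recursion stays at 0.\<close>

lemma dir_sum_exp_zero:
  assumes "bit x i" "bit x (Suc i)" "Suc (Suc i) \<le> j"
  shows "dir_sum (2 ^ j) x = 0"
proof -
  have nz: "dir_ker (2 ^ m) x = 0" if "i < m" for m
  proof -
    have "x mod 2 ^ m \<noteq> 0"
      using assms(1) that by (metis bit_0_eq bit_take_bit_iff bot_apply take_bit_eq_mod bot_bool_def)
    then show ?thesis by (simp add: dir_ker_exp)
  qed
  show ?thesis
    using assms(3)
  proof (induction j rule: dec_induct)
    case base
    show ?case unfolding dir_sum_exp_Suc[of "Suc i"] using assms(2) nz[of "Suc i"] by (simp add: rad_def)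
  next
    case (step j)
    then show ?case unfolding dir_sum_exp_Suc using nz[of j] by simp
  qed
qed

text \<open>Removing a leading digit at a place above \<open>Suc i\<close> changes at most the sign,
  since both kernels at that power of two vanish.\<close>

lemma abs_dir_sum_mod:
  assumes "bit x i" "bit x (Suc i)"
  shows "\<bar>dir_sum m x\<bar> = \<bar>dir_sum (m mod 2 ^ Suc (Suc i)) x\<bar>"
proof (induction m rule: less_induct)
  case (less m)
  show ?case
  proof (cases "m < 2 ^ Suc (Suc i)")
    case False
    then have "m > 0" by (cases m) auto
    then obtain j k where m: "m = 2 ^ j + k" "k < 2 ^ j" using exp_decomp by metis
    have ij: "Suc (Suc i) \<le> j"
    proof (rule ccontr)
      assume "\<not> Suc (Suc i) \<le> j"
      then have "(2::nat) ^ Suc j \<le> 2 ^ Suc (Suc i)" by (intro power_increasing) auto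
      then show False using m False by simp
    qed
    have "x mod 2 ^ j \<noteq> 0"
      using assms(1) ij
      by (metis Suc_le_eq Suc_lessD bit_0_eq bit_take_bit_iff bot_apply take_bit_eq_mod bot_bool_def)
    then have "\<bar>dir_sum m x\<bar> = \<bar>dir_sum k x\<bar>"
      unfolding m(1) using dir_sum_exp_add[of k j x] m(2) dir_sum_exp_zero[OF assms ij]
      by (simp add: dir_ker_exp abs_mult)
    moreover have "k mod 2 ^ Suc (Suc i) = m mod 2 ^ Suc (Suc i)"
    proof -
      have "(2::nat) ^ Suc (Suc i) dvd 2 ^ j" using ij by (rule le_imp_power_dvd)
      then show ?thesis unfolding m(1) by (metis dvd_eq_mod_eq_0 mod_add_left_eq add_0)
    qed
    moreover have "k < m" using m by simp
    ultimately show ?thesis using less.IH by metis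
  qed simp
qed

text \<open>Only the digits of \<open>m\<close> up to place \<open>Suc i\<close> count. If digit
  \<open>Suc i\<close> is 1 it contributes \<open>4 ^ i\<close>, of which the lower digits can
  cancel at most half; otherwise digit \<open>i - 1\<close> makes the lower part at least
  \<open>4 ^ i / 8\<close>.\<close>

lemma abs_dir_sum_ge:
  assumes x: "x mod 2 ^ i = 0" "bit x i" "bit x (Suc i)"
    and m: "\<not> bit m i" "bit m (Suc i) \<or> i > 0 \<and> bit m (i - 1)"
  shows "4 ^ i \<le> 8 * \<bar>dir_sum m x\<bar>"
proof -
  define n where "n = m mod 2 ^ i"
  have n: "n < 2 ^ i" unfolding n_def by simp
  have n': "real n + 1 \<le> 2 ^ i"
    using n by (metis Suc_leI of_nat_Suc of_nat_le_iff of_nat_numeral of_nat_power add.commute)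
  have fn: "dir_sum n x = real n * (real n + 1) / 2"
    using dir_sum_at_zero[of n i x] n x(1) by simp
  have fn0: "dir_sum n x \<ge> 0" unfolding fn by simp
  have four: "(4::real) ^ i = 2 ^ i * 2 ^ i" by (simp add: power_mult_distrib[symmetric])
  have m2: "m mod 2 ^ Suc (Suc i) = n + (if bit m (Suc i) then 2 ^ Suc i else 0)"
    unfolding mod_exp_Suc[of m "Suc i"] mod_exp_Suc[of m i] using m(1) by (simp add: n_def)
  show ?thesis
  proof (cases "bit m (Suc i)")
    case True
    have "dir_sum (2 ^ Suc i) x = 4 ^ i"
      unfolding dir_sum_exp_Suc using x by (simp add: rad_def dir_ker_exp four)
    moreover have "dir_ker (2 ^ Suc i) x = 0"
      unfolding dir_ker_exp_Suc using x by (simp add: rad_def)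
    moreover have "n \<le> 2 ^ Suc i" using n by simp
    ultimately have "dir_sum (2 ^ Suc i + n) x = 4 ^ i + rad (Suc i) x * dir_sum n x"
      using dir_sum_exp_add[of n "Suc i" x] by simp
    moreover have "\<bar>rad (Suc i) x * dir_sum n x\<bar> = dir_sum n x" using fn0 by (simp add: abs_mult)
    moreover have "dir_sum n x \<le> 4 ^ i / 2"
      unfolding fn four using n' by (intro divide_right_mono mult_mono) linarith+
    moreover have "0 \<le> (4::real) ^ i" by simp
    ultimately have "4 ^ i \<le> 8 * \<bar>dir_sum (2 ^ Suc i + n) x\<bar>" by linarith
    then show ?thesis
      unfolding abs_dir_sum_mod[OF x(2,3), of m] m2 using True by (simp add: add.commute)
  next
    case False
    then obtain j where j: "i = Suc j" "bit m j" using m(2) by (cases i) auto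
    have "2 ^ j \<le> n" unfolding n_def j(1) mod_exp_Suc[of m j] using j(2) by simp
    then have "2 ^ j \<le> real n" by (metis of_nat_le_iff of_nat_numeral of_nat_power)
    then have "2 ^ j * 2 ^ j \<le> real n * (real n + 1)" by (intro mult_mono) (linarith | simp)+
    then have "4 ^ i \<le> 8 * dir_sum n x"
      unfolding fn four j(1) by (simp flip: power_mult_distrib)
    then show ?thesis
      unfolding abs_dir_sum_mod[OF x(2,3), of m] m2 using False fn0 by simp
  qed
qed

text \<open>Places of a digit 0 next to a digit 1, both below the leading digit \<open>s\<close>;
  there \<open>abs_dir_sum_ge\<close> applies to the index without its leading digit.\<close>

definition gap_set :: "(nat \<Rightarrow> nat) \<Rightarrow> nat \<Rightarrow> nat set" where
  "gap_set nk s = {i. i < s \<and> (\<exists>k. 2 ^ s \<le> nk k \<and> nk k < 2 ^ Suc s \<and> \<not> bit (nk k - 2 ^ s) i \<and>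
     (bit (nk k - 2 ^ s) (Suc i) \<or> i > 0 \<and> bit (nk k - 2 ^ s) (i - 1)))}"

text \<open>Every endpoint other than 0 and \<open>s\<close> is adjacent to a gap, and a gap has
  only two neighbours.\<close>

lemma card_endpoint_set_le: "card (endpoint_set nk s) \<le> 2 + 2 * card (gap_set nk s)"
proof -
  have fin: "finite (gap_set nk s)" unfolding gap_set_def by simp
  have "endpoint_set nk s \<subseteq> {0, s} \<union> (Suc ` gap_set nk s \<union> (\<lambda>i. i - 1) ` gap_set nk s)"
  proof
    fix e assume "e \<in> endpoint_set nk s"
    then obtain k where k: "2 ^ s \<le> nk k" "nk k < 2 ^ Suc s" "bit (nk k) e"
      "(e > 0 \<longrightarrow> \<not> bit (nk k) (e - 1)) \<or> \<not> bit (nk k) (Suc e)"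
      using endpoint_set_bits by metis
    define m where "m = nk k - 2 ^ s"
    have m: "nk k = 2 ^ s + m" "m < 2 ^ s" using k unfolding m_def by auto
    have b: "bit (nk k) j \<longleftrightarrow> j = s \<or> bit m j" for j unfolding m(1) by (rule bit_exp_add[OF m(2)])
    have bs: "bit m j \<Longrightarrow> j < s" for j using bit_less_exp m(2) by blast
    show "e \<in> {0, s} \<union> (Suc ` gap_set nk s \<union> (\<lambda>i. i - 1) ` gap_set nk s)"
    proof (cases "e = 0 \<or> e = s")
      case False
      then have e: "bit m e" "e < s" "e > 0" using k(3) b bs by auto
      from k(4) show ?thesis
      proof
        assume "e > 0 \<longrightarrow> \<not> bit (nk k) (e - 1)"
        then have "\<not> bit m (e - 1)" using e b by auto
        then have "e - 1 \<in> gap_set nk s"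
          unfolding gap_set_def using k(1,2) e m_def by auto
        then have "Suc (e - 1) \<in> Suc ` gap_set nk s" by blast
        then show ?thesis using e by simp
      next
        assume "\<not> bit (nk k) (Suc e)"
        then have "\<not> bit m (Suc e)" "Suc e \<noteq> s" using b by auto
        then have "Suc e \<in> gap_set nk s"
          unfolding gap_set_def using k(1,2) e m_def by auto
        then have "Suc e - 1 \<in> (\<lambda>i. i - 1) ` gap_set nk s" by blast
        then show ?thesis by simp
      qed
    qed auto
  qed
  then have "card (endpoint_set nk s) \<le> card ({0, s} \<union> (Suc ` gap_set nk s \<union> (\<lambda>i. i - 1) ` gap_set nk s))"
    using fin by (intro card_mono) auto
  also have "\<dots> \<le> card {0, s} + (card (Suc ` gap_set nk s) + card ((\<lambda>i. i - 1) ` gap_set nk s))"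
    by (meson add_left_mono card_Un_le order_trans)
  also have "\<dots> \<le> 2 + (card (gap_set nk s) + card (gap_set nk s))"
    using fin by (intro add_mono card_image_le) (auto intro: order_trans[OF card_insert_le_m1])
  finally show ?thesis by simp
qed

section \<open>Atoms of a single scale\<close>

text \<open>Height \<open>4 ^ s\<close> on a set of measure \<open>2 ^ - s\<close> makes the mean of
  the square root equal to 1.\<close>

definition spike :: "nat \<Rightarrow> nat \<Rightarrow> real" where
  "spike s c = (if c mod 2 ^ s = 0 then 4 ^ s * rad s c else 0)"

lemma abs_spike: "\<bar>spike s c\<bar> = (if c mod 2 ^ s = 0 then 4 ^ s else 0)"
  by (simp add: spike_def abs_mult)

lemma spike_mod: "s < n \<Longrightarrow> spike s (c mod 2 ^ n) = spike s c"
  unfolding spike_def by (simp add: rad_mod mod_mod_cancel le_imp_power_dvd)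

text \<open>Only the codes 0 and \<open>2 ^ s\<close> carry mass, with opposite signs, so the
  convolution is a difference of kernel values under flipping digit \<open>s\<close>. This isolates
  the part \<open>rad s x * dir_sum m x\<close> of the kernel. The remaining factor
  \<open>2 ^ s / (2 ^ s + m)\<close> is at least 1/2.\<close>

lemma fejer_conv_spike:
  assumes "m < 2 ^ s" "x < 2 ^ Suc s"
  shows "\<bar>dir_sum m x\<bar> \<le> 2 * \<bar>fejer_conv (Suc s) (spike s) (2 ^ s + m) x\<bar>"
proof -
  define n where "n = 2 ^ s + m"
  have four: "(4::real) ^ s = 2 ^ s * 2 ^ s" by (simp add: power_mult_distrib[symmetric])
  have "(\<Sum>y<2 ^ Suc s. spike s y * dir_sum n (x XOR y))
      = (\<Sum>y::nat<2 ^ s. if y = 0 then 4 ^ s * (dir_sum n x - dir_sum n (x XOR 2 ^ s)) else 0)"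
    unfolding sum_exp_Suc
  proof (intro sum.cong refl)
    fix y :: nat assume "y \<in> {..<2 ^ s}"
    then have y: "y < 2 ^ s" by simp
    have "bit ((2::nat) ^ s) s" by (simp add: bit_exp_iff)
    then show "spike s y * dir_sum n (x XOR y) + spike s (y + 2 ^ s) * dir_sum n (x XOR (y + 2 ^ s))
        = (if y = 0 then 4 ^ s * (dir_sum n x - dir_sum n (x XOR 2 ^ s)) else 0)"
      using y by (simp add: spike_def rad_def algebra_simps)
  qed
  also have "\<dots> = 4 ^ s * (dir_sum n x - dir_sum n (x XOR 2 ^ s))" by simp
  also have "dir_sum n x - dir_sum n (x XOR 2 ^ s) = 2 * rad s x * dir_sum m x"
  proof -
    have z: "(x XOR 2 ^ s) mod 2 ^ s = x mod 2 ^ s" by (rule mod_exp_flip) simp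
    have "dir_sum (2 ^ s) (x XOR 2 ^ s) = dir_sum (2 ^ s) x" "dir_ker (2 ^ s) (x XOR 2 ^ s) = dir_ker (2 ^ s) x"
      "dir_sum m (x XOR 2 ^ s) = dir_sum m x"
      using dir_sum_mod[of "2 ^ s" s] dir_ker_mod[of "2 ^ s" s] dir_sum_mod[of m s] assms(1) z
      by (metis order_refl less_imp_le)+
    moreover have "rad s (x XOR 2 ^ s) = - rad s x" by (simp add: rad_def bit_simps)
    ultimately show ?thesis
      unfolding n_def using dir_sum_exp_add[of m s x] dir_sum_exp_add[of m s "x XOR 2 ^ s"] assms(1) by simp
  qed
  finally have c: "fejer_conv (Suc s) (spike s) n x = 2 ^ s * rad s x * dir_sum m x / real n"
    unfolding fejer_conv_def by (simp add: four field_simps)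
  have n0: "real n > 0" unfolding n_def by (simp add: add_pos_nonneg)
  have "real n \<le> 2 * 2 ^ s"
    unfolding n_def using assms(1) by (simp add: less_imp_le flip: of_nat_less_iff)
  then have "1 \<le> 2 * (2 ^ s / real n)" using n0 by (simp add: field_simps)
  then have "1 * \<bar>dir_sum m x\<bar> \<le> 2 * (2 ^ s / real n) * \<bar>dir_sum m x\<bar>" by (intro mult_right_mono) auto
  then show ?thesis unfolding n_def[symmetric] c by (simp add: abs_mult)
qed

text \<open>The residue has digits 1 exactly at \<open>i\<close> and \<open>Suc i\<close>, the
  situation of \<open>abs_dir_sum_ge\<close>.\<close>

lemma gap_class_bits:
  fixes x :: nat
  assumes "x mod 2 ^ Suc (Suc i) = 3 * 2 ^ i"
  shows "x mod 2 ^ i = 0" "bit x i" "bit x (Suc i)"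
proof -
  have "x mod 2 ^ i = x mod 2 ^ Suc (Suc i) mod 2 ^ i"
    by (intro mod_mod_cancel[symmetric] le_imp_power_dvd) simp
  then show "x mod 2 ^ i = 0" unfolding assms by simp
  have b: "bit x j \<longleftrightarrow> bit ((3::nat) * 2 ^ i) j" if "j < Suc (Suc i)" for j
    using that assms by (metis bit_take_bit_iff take_bit_eq_mod)
  have e: "(3::nat) * 2 ^ i = push_bit i 3" by (simp add: push_bit_eq_mult)
  have t: "bit (3::nat) 0" "bit (3::nat) (Suc 0)" by (simp_all add: bit_0 bit_Suc)
  show "bit x i" "bit x (Suc i)"
    using b[of i] b[of "Suc i"] t unfolding e by (simp_all add: bit_push_bit_iff)
qed

text \<open>The index is the place of the lowest digit 1 of \<open>x\<close>.\<close>

lemma gap_class_disjoint: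
  fixes x :: nat
  assumes "x mod 2 ^ Suc (Suc i) = 3 * 2 ^ i" "x mod 2 ^ Suc (Suc j) = 3 * 2 ^ j"
  shows "i = j"
proof -
  have "\<not> i < j" if "x mod 2 ^ j = 0" "bit x i" for i j
  proof
    assume "i < j"
    then have "bit (x mod 2 ^ j) i" using that(2) by (simp add: bit_take_bit_iff flip: take_bit_eq_mod)
    then show False using that by simp
  qed
  then show ?thesis
    using gap_class_bits[OF assms(1)] gap_class_bits[OF assms(2)] by (meson linorder_neqE_nat)
qed

text \<open>\<open>ennreal\<close> sends negative summands to 0, which can only enlarge the
  right-hand side.\<close>

lemma sum_ennreal_ge: "ennreal (\<Sum>i\<in>A. g i) \<le> (\<Sum>i\<in>A. ennreal (g i))"
proof -
  have *: "ennreal (max 0 r) = ennreal r" for r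
    by (cases "r \<ge> 0") (auto simp: ennreal_neg)
  have "ennreal (\<Sum>i\<in>A. g i) \<le> ennreal (\<Sum>i\<in>A. max 0 (g i))"
    by (intro ennreal_leI sum_mono) auto
  also have "\<dots> = (\<Sum>i\<in>A. ennreal (max 0 (g i)))" by (rule sum_ennreal[symmetric]) simp
  finally show ?thesis unfolding * .
qed

text \<open>The bounded part \<open>u\<close> costs at most \<open>sqrt (2 * b)\<close>. The class
  of a gap \<open>i\<close> has measure \<open>2 ^ - (i + 2)\<close> and carries a square root of
  size \<open>sqrt v * 2 ^ i / 4\<close>, so each gap contributes \<open>sqrt v / 16\<close>, and
  the classes are disjoint.\<close>

lemma (in dyadic_tree) nn_integral_weighted_fejer_max_ge:
  fixes nk :: "nat \<Rightarrow> nat"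
  assumes v: "v \<ge> 0" and phi: "\<phi> s > 0"
    and f: "\<And>c. c < 2 ^ Suc s \<Longrightarrow> f (Suc s) c = u c + v * spike s c"
    and u: "\<And>c. \<bar>u c\<bar> \<le> b"
  shows "ennreal ((sqrt v * real (card (gap_set nk s)) / 16 - sqrt (2 * b)) / sqrt (\<phi> s))
    \<le> (\<integral>\<^sup>+x. epowr (weighted_fejer_max nk \<phi> (\<lambda>n x. f n (prefix_code n x)) x) (1 / 2) \<partial>haar)"
proof -
  define I where "I = gap_set nk s"
  have finI: "finite I" unfolding I_def gap_set_def by simp
  have b: "b \<ge> 0" using u by (meson abs_ge_zero order_trans)
  \<comment> \<open>At most one summand is nonzero at each code; where none is, \<open>T\<close> is
    at most 0 and the bound is trivial.\<close>
  define T where "T c = (\<Sum>i\<in>I. if c mod 2 ^ Suc (Suc i) = 3 * 2 ^ i then sqrt v * 2 ^ i / 4 else 0) - sqrt (2 * b)" for c :: nat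
  have T: "ennreal (T (prefix_code (Suc s) x) / sqrt (\<phi> s))
      \<le> epowr (weighted_fejer_max nk \<phi> (\<lambda>n x. f n (prefix_code n x)) x) (1 / 2)" for x
  proof -
    define c where "c = prefix_code (Suc s) x"
    have c: "c < 2 ^ Suc s" unfolding c_def by (rule prefix_code_less)
    show ?thesis
    proof (cases "\<exists>i\<in>I. c mod 2 ^ Suc (Suc i) = 3 * 2 ^ i")
      case False
      then have "T c = - sqrt (2 * b)" unfolding T_def by (simp add: sum.neutral)
      then have "T c / sqrt (\<phi> s) \<le> 0" using b phi by (simp add: divide_nonpos_pos)
      then show ?thesis unfolding c_def[symmetric] by (simp add: ennreal_neg)
    next
      case True
      then obtain i where i: "i \<in> I" "c mod 2 ^ Suc (Suc i) = 3 * 2 ^ i" by blast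
      have "c mod 2 ^ Suc (Suc j) = 3 * 2 ^ j \<longleftrightarrow> j = i" for j
        using gap_class_disjoint[OF i(2), of j] i(2) by metis
      then have "T c = (\<Sum>j\<in>I. if j = i then sqrt v * 2 ^ j / 4 else 0) - sqrt (2 * b)"
        unfolding T_def by (simp only:)
      then have Tc: "T c = sqrt v * 2 ^ i / 4 - sqrt (2 * b)" using i(1) finI by simp
      obtain k where k: "2 ^ s \<le> nk k" "nk k < 2 ^ Suc s" "\<not> bit (nk k - 2 ^ s) i"
        "bit (nk k - 2 ^ s) (Suc i) \<or> i > 0 \<and> bit (nk k - 2 ^ s) (i - 1)"
        using i(1) unfolding I_def gap_set_def by blast
      define m where "m = nk k - 2 ^ s"
      have m: "nk k = 2 ^ s + m" "m < 2 ^ s" using k unfolding m_def by auto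
      define y where "y = fejer_conv (Suc s) (f (Suc s)) (nk k) c"
      have "4 ^ i \<le> 8 * \<bar>dir_sum m c\<bar>"
        using abs_dir_sum_ge[OF gap_class_bits[OF i(2)] k(3,4)] unfolding m_def .
      also have "\<bar>dir_sum m c\<bar> \<le> 2 * \<bar>fejer_conv (Suc s) (spike s) (nk k) c\<bar>"
        unfolding m(1) by (rule fejer_conv_spike[OF m(2) c])
      finally have "4 ^ i \<le> 16 * \<bar>fejer_conv (Suc s) (spike s) (nk k) c\<bar>" by simp
      then have "v * 4 ^ i \<le> v * (16 * \<bar>fejer_conv (Suc s) (spike s) (nk k) c\<bar>)"
        using v by (rule mult_left_mono)
      then have 1: "v * 4 ^ i / 16 \<le> \<bar>v * fejer_conv (Suc s) (spike s) (nk k) c\<bar>"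
        using v by (simp add: abs_mult)
      have "y = fejer_conv (Suc s) (\<lambda>c. u c + v * spike s c) (nk k) c"
        unfolding y_def by (rule fejer_conv_cong[OF f])
      also have "\<dots> = fejer_conv (Suc s) u (nk k) c + fejer_conv (Suc s) (\<lambda>c. v * spike s c) (nk k) c"
        by (rule fejer_conv_add)
      also have "fejer_conv (Suc s) (\<lambda>c. v * spike s c) (nk k) c = v * fejer_conv (Suc s) (spike s) (nk k) c"
        unfolding fejer_conv_def by (simp add: sum_distrib_left mult.assoc)
      finally have y: "y = fejer_conv (Suc s) u (nk k) c + v * fejer_conv (Suc s) (spike s) (nk k) c" .
      have "\<bar>fejer_conv (Suc s) u (nk k) c\<bar> \<le> 2 * b"
        using k m by (intro abs_fejer_conv_le c u) auto
      with 1 y have "v * 4 ^ i / 16 \<le> \<bar>y\<bar> + 2 * b" by linarith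
      then have "sqrt (v * 4 ^ i / 16) \<le> sqrt (\<bar>y\<bar> + 2 * b)" by (rule real_sqrt_le_mono)
      also have "\<dots> \<le> sqrt \<bar>y\<bar> + sqrt (2 * b)" using b by (intro sqrt_add_le_add_sqrt) auto
      also have "sqrt (v * 4 ^ i / 16) = sqrt v * 2 ^ i / 4"
        by (simp add: real_sqrt_mult real_sqrt_divide real_sqrt_power)
      finally have "T c \<le> sqrt \<bar>y\<bar>" unfolding Tc by simp
      then have "T c / sqrt (\<phi> s) \<le> sqrt \<bar>y\<bar> / sqrt (\<phi> s)" using phi by (simp add: divide_right_mono)
      then have "ennreal (T c / sqrt (\<phi> s)) \<le> ennreal (sqrt (\<bar>y\<bar> / \<phi> s))"
        by (intro ennreal_leI) (simp add: real_sqrt_divide)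
      also have "\<dots> = epowr (ennreal (\<bar>y\<bar> / \<phi> s)) (1 / 2)"
        using phi by (simp add: epowr_half_ennreal)
      also have "y = fejer (nk k) (\<lambda>n x. f n (prefix_code n x)) x"
        unfolding y_def c_def using k(2) by (intro fejer_eq_conv[symmetric]) simp
      also have "epowr (ennreal (\<bar>fejer (nk k) (\<lambda>n x. f n (prefix_code n x)) x\<bar> / \<phi> s)) (1 / 2)
          \<le> epowr (weighted_fejer_max nk \<phi> (\<lambda>n x. f n (prefix_code n x)) x) (1 / 2)"
        unfolding weighted_fejer_max_def
        by (rule epowr_half_mono, rule SUP_upper2[of k]) (use msb_eq[OF k(1,2)] in auto)
      finally show ?thesis unfolding c_def .
    qed
  qed
  have card: "(\<Sum>c::nat<2 ^ Suc s. if c mod 2 ^ Suc (Suc i) = 3 * 2 ^ i then sqrt v * 2 ^ i / 4 else 0)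
      = 2 ^ Suc s * (sqrt v / 16)" if "i \<in> I" for i
  proof -
    have i: "Suc (Suc i) \<le> Suc s" using that unfolding I_def gap_set_def by auto
    have "(\<Sum>c::nat<2 ^ Suc s. if c mod 2 ^ Suc (Suc i) = 3 * 2 ^ i then sqrt v * 2 ^ i / 4 else 0)
        = (\<Sum>c\<in>res_class (Suc s) (Suc (Suc i)) (3 * 2 ^ i). sqrt v * 2 ^ i / 4)"
      by (simp add: sum.inter_filter[symmetric] res_class_def del: power_Suc)
    also have "\<dots> = real (2 ^ (Suc s - Suc (Suc i))) * (sqrt v * 2 ^ i / 4)"
      using card_res_class[OF i, of "3 * 2 ^ i"] by simp
    also have "real (2 ^ (Suc s - Suc (Suc i))) = 2 ^ Suc s / (4 * 2 ^ i)"
    proof -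
      have "(2::real) ^ (Suc s - Suc (Suc i)) = 2 ^ Suc s / 2 ^ Suc (Suc i)"
        using i by (intro power_diff) auto
      then show ?thesis by simp
    qed
    finally show ?thesis by simp
  qed
  have "(\<Sum>c<2 ^ Suc s. T c) = 2 ^ Suc s * (sqrt v * real (card I) / 16 - sqrt (2 * b))"
  proof -
    have "(\<Sum>c<2 ^ Suc s. T c)
      = (\<Sum>i\<in>I. \<Sum>c::nat<2 ^ Suc s. if c mod 2 ^ Suc (Suc i) = 3 * 2 ^ i then sqrt v * 2 ^ i / 4 else 0)
        - 2 ^ Suc s * sqrt (2 * b)"
      unfolding T_def sum_subtractf by (subst sum.swap) simp
    also have "\<dots> = (\<Sum>i\<in>I. 2 ^ Suc s * (sqrt v / 16)) - 2 ^ Suc s * sqrt (2 * b)"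
      by (simp only: sum.cong[OF refl card])
    finally show ?thesis by (simp add: algebra_simps)
  qed
  then have "(sqrt v * real (card I) / 16 - sqrt (2 * b)) / sqrt (\<phi> s)
      = (\<Sum>c<2 ^ Suc s. T c / sqrt (\<phi> s) * (1 / 2 ^ Suc s))"
    by (simp add: sum_divide_distrib[symmetric])
  also have "ennreal \<dots> \<le> (\<Sum>c<2 ^ Suc s. ennreal (T c / sqrt (\<phi> s) * (1 / 2 ^ Suc s)))"
    by (rule sum_ennreal_ge)
  also have "\<dots> = (\<integral>\<^sup>+x. ennreal (T (prefix_code (Suc s) x) / sqrt (\<phi> s)) \<partial>haar)"
    unfolding nn_integral_prefix_code[of "\<lambda>c. ennreal (T c / sqrt (\<phi> s))"]
    by (intro sum.cong refl ennreal_mult'') simp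
  also have "\<dots> \<le> (\<integral>\<^sup>+x. epowr (weighted_fejer_max nk \<phi> (\<lambda>n x. f n (prefix_code n x)) x) (1 / 2) \<partial>haar)"
    by (rule nn_integral_mono) (rule T)
  finally show ?thesis unfolding I_def .
qed

section \<open>The lacunary martingale\<close>

text \<open>A spike of scale \<open>s i\<close> uses \<open>Suc (s i)\<close> coordinates, hence the
  strict inequality. The weights \<open>(1 / 4) ^ i\<close> have summable square roots.\<close>

definition spike_sum :: "(nat \<Rightarrow> nat) \<Rightarrow> nat \<Rightarrow> nat \<Rightarrow> real" where
  "spike_sum s n c = (\<Sum>i | s i < n. (1 / 4) ^ i * spike (s i) c)"

lemma finite_strict_mono_less:
  fixes s :: "nat \<Rightarrow> nat"
  assumes "strict_mono s"
  shows "finite {i. s i < n}"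
proof (rule finite_subset)
  show "{i. s i < n} \<subseteq> {..<n}"
    using strict_mono_imp_increasing[OF assms] by (auto intro: le_less_trans)
qed simp

lemma spike_sum_tree:
  assumes "strict_mono s"
  shows "dyadic_tree (spike_sum s)"
proof
  fix c n :: nat assume c: "c < 2 ^ n"
  \<comment> \<open>Earlier spikes do not see digit \<open>n\<close>; the spike of scale
    \<open>n\<close> takes opposite values on the two children.\<close>
  have pair: "spike k c + spike k (c + 2 ^ n) = (if k < n then 2 * spike k c else 0)" if "k < Suc n" for k
  proof (cases "k < n")
    case True
    then show ?thesis using spike_mod[OF True, of "c + 2 ^ n"] c by simp
  next
    case False
    then have "k = n" using that by simp
    then show ?thesis using c bit_at_exp[OF c] by (simp add: spike_def rad_def bit_exp_iff)
  qed
  have "spike_sum s (Suc n) c + spike_sum s (Suc n) (c + 2 ^ n)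
      = (\<Sum>i | s i < Suc n. (1 / 4) ^ i * (if s i < n then 2 * spike (s i) c else 0))"
    unfolding spike_sum_def sum.distrib[symmetric] distrib_left[symmetric]
    by (intro sum.cong refl) (simp only: mem_Collect_eq pair)
  also have "\<dots> = (\<Sum>i | s i < n. (1 / 4) ^ i * (2 * spike (s i) c))"
    by (rule sum.mono_neutral_cong_right) (auto intro: finite_strict_mono_less assms)
  also have "\<dots> = 2 * spike_sum s n c"
    unfolding spike_sum_def by (simp add: sum_distrib_left mult.left_commute)
  finally show "spike_sum s n c = (spike_sum s (Suc n) c + spike_sum s (Suc n) (c + 2 ^ n)) / 2"
    by simp
qed

text \<open>By subadditivity the square root of the maximal function is at most the sum of the roots
  of all weighted spikes; the \<open>i\<close>-th has integral \<open>(1 / 2) ^ i\<close>.\<close>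

lemma spike_sum_in_hardy_space:
  assumes s: "strict_mono s"
  shows "(\<lambda>n x. spike_sum s n (prefix_code n x)) \<in> hardy_space (1/2)"
proof -
  define F where "F n x = spike_sum s n (prefix_code n x)" for n x
  interpret dyadic_tree "spike_sum s" by (rule spike_sum_tree[OF s])
  define g where "g i c = ennreal (if c = 0 then (1 / 2) ^ i * 2 ^ s i else 0)" for i and c :: nat
  have bound: "epowr (maximal_fun F x) (1 / 2) \<le> (\<Sum>i. g i (prefix_code (s i) x))" for x
    unfolding maximal_fun_def epowr_half_SUP
  proof (rule SUP_least)
    fix n
    have sq: "sqrt \<bar>(1 / 4) ^ i * spike (s i) (prefix_code n x)\<bar>
        = (if prefix_code (s i) x = 0 then (1 / 2) ^ i * 2 ^ s i else 0)" if "s i < n" for i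
    proof -
      have "sqrt (4 ^ k) = 2 ^ k" for k by (simp add: real_sqrt_power)
      then show ?thesis
        using that by (simp add: abs_mult abs_spike prefix_code_mod real_sqrt_mult power_one_over real_sqrt_divide)
    qed
    have "sqrt \<bar>F n x\<bar> \<le> (\<Sum>i | s i < n. sqrt (\<bar>(1 / 4) ^ i * spike (s i) (prefix_code n x)\<bar>))"
      unfolding F_def spike_sum_def
      using sqrt_abs_sum_le[of 1 "\<lambda>i. (1 / 4) ^ i * spike (s i) (prefix_code n x)" "{i. s i < n}"] by simp
    also have "\<dots> = (\<Sum>i | s i < n. if prefix_code (s i) x = 0 then (1 / 2) ^ i * 2 ^ s i else 0)"
      by (intro sum.cong refl) (simp only: mem_Collect_eq sq)
    finally have "ennreal (sqrt \<bar>F n x\<bar>) \<le> ennreal (\<Sum>i | s i < n. if prefix_code (s i) x = 0 then (1 / 2) ^ i * 2 ^ s i else 0)"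
      by (rule ennreal_leI)
    also have "\<dots> = (\<Sum>i | s i < n. g i (prefix_code (s i) x))"
      unfolding g_def by (rule sum_ennreal[symmetric]) simp
    also have "\<dots> \<le> (\<Sum>i. g i (prefix_code (s i) x))"
      by (intro sum_le_suminf summableI finite_strict_mono_less s) auto
    finally show "epowr (ennreal \<bar>F n x\<bar>) (1 / 2) \<le> (\<Sum>i. g i (prefix_code (s i) x))"
      by (simp add: epowr_half_ennreal)
  qed
  have "(\<integral>\<^sup>+x. epowr (maximal_fun F x) (1 / 2) \<partial>haar) \<le> (\<integral>\<^sup>+x. (\<Sum>i. g i (prefix_code (s i) x)) \<partial>haar)"
    by (intro nn_integral_mono bound)
  also have "\<dots> = (\<Sum>i. \<integral>\<^sup>+x. g i (prefix_code (s i) x) \<partial>haar)"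
    by (intro nn_integral_suminf borel_measurable_prefix_code)
  also have "\<dots> = (\<Sum>i. ennreal ((1 / 2) ^ i))"
  proof (intro suminf_cong)
    fix i
    have "(\<integral>\<^sup>+x. g i (prefix_code (s i) x) \<partial>haar) = (\<Sum>c<2 ^ s i. g i c * ennreal (1 / 2 ^ s i))"
      by (rule nn_integral_prefix_code)
    also have "\<dots> = (\<Sum>c::nat<2 ^ s i. if c = 0 then ennreal ((1 / 2) ^ i) else 0)"
      unfolding g_def by (intro sum.cong refl) (simp add: ennreal_mult[symmetric])
    finally show "(\<integral>\<^sup>+x. g i (prefix_code (s i) x) \<partial>haar) = ennreal ((1 / 2) ^ i)" by simp
  qed
  also have "\<dots> < \<top>"
    by (subst suminf_ennreal2) (auto intro!: summable_geometric)
  finally have fin: "(\<integral>\<^sup>+x. epowr (maximal_fun F x) (1 / 2) \<partial>haar) < \<top>" .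
  then have "hardy_norm (1/2) F < \<infinity>"
    unfolding hardy_norm_def Lp_norm_half by (simp add: ennreal_mult_less_top)
  then show ?thesis
    unfolding hardy_space_def using martingale by (simp add: F_def[abs_def])
qed

text \<open>The spikes before the \<open>j\<close>-th are bounded by the height of the last of them,
  and the weights sum to less than 2. For \<open>j = 0\<close> the sum is empty and the exponent 0 a
  placeholder.\<close>

lemma sum_spikes_bound:
  assumes "strict_mono s"
  shows "\<bar>\<Sum>i<j. (1 / 4) ^ i * spike (s i) c\<bar> \<le> 2 * 4 ^ (case j of 0 \<Rightarrow> 0 | Suc i \<Rightarrow> s i)"
proof (cases j)
  case (Suc k)
  have g: "(\<Sum>i<n. (1 / 4 :: real) ^ i) \<le> 2 - 2 * (1 / 4) ^ n" for n
  proof (induction n)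
    case (Suc n)
    have "0 \<le> (1 / 4 :: real) ^ n" by simp
    then show ?case using Suc unfolding sum.lessThan_Suc power_Suc by linarith
  qed simp
  have "\<bar>\<Sum>i<j. (1 / 4) ^ i * spike (s i) c\<bar> \<le> (\<Sum>i<j. (1 / 4) ^ i * 4 ^ s k)"
  proof (rule order_trans[OF sum_abs sum_mono])
    fix i assume "i \<in> {..<j}"
    then have "s i \<le> s k" using Suc assms by (simp add: strict_mono_less_eq)
    then have "(4::real) ^ s i \<le> 4 ^ s k" by (intro power_increasing) auto
    then have "\<bar>spike (s i) c\<bar> \<le> 4 ^ s k" unfolding abs_spike by auto
    then show "\<bar>(1 / 4) ^ i * spike (s i) c\<bar> \<le> (1 / 4) ^ i * 4 ^ s k"
      by (simp add: abs_mult mult_left_mono)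
  qed
  also have "\<dots> = (\<Sum>i<j. (1 / 4) ^ i) * 4 ^ s k" by (simp add: sum_distrib_right)
  also have "\<dots> \<le> 2 * 4 ^ s k"
  proof (intro mult_right_mono)
    have "0 \<le> (1 / 4 :: real) ^ j" by simp
    then show "(\<Sum>i<j. (1 / 4 :: real) ^ i) \<le> 2" using g[of j] by linarith
  qed simp
  finally show ?thesis using Suc by simp
qed simp

section \<open>Choice of the scales\<close>

text \<open>Values beyond the maximum of \<open>q\<close> over the levels up to \<open>s0\<close>
  can only be taken at later levels.\<close>

lemma unbounded_selection:
  fixes nk :: "nat \<Rightarrow> nat" and q :: "nat \<Rightarrow> real"
  assumes "limsup (\<lambda>k. ereal (q (msb (nk k)))) = \<infinity>"
  shows "\<exists>s>s0. r \<le> q s"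
proof -
  define R where "R = max r (Max (q ` {..s0}))"
  have "\<exists>k. ereal R < ereal (q (msb (nk k)))"
  proof (rule ccontr)
    assume "\<nexists>k. ereal R < ereal (q (msb (nk k)))"
    then have "limsup (\<lambda>k. ereal (q (msb (nk k)))) \<le> ereal R"
      by (intro Limsup_bounded always_eventually) (auto simp: not_less)
    then show False using assms by simp
  qed
  then obtain k where k: "R < q (msb (nk k))" by auto
  have "msb (nk k) > s0"
  proof (rule ccontr)
    assume "\<not> msb (nk k) > s0"
    then have "q (msb (nk k)) \<le> Max (q ` {..s0})" by (intro Max_ge) auto
    then show False using k unfolding R_def by linarith
  qed
  moreover have "r \<le> q (msb (nk k))" using k unfolding R_def by linarith
  ultimately show ?thesis by blast
qed

lemma sharpness:
  fixes nk :: "nat \<Rightarrow> nat" and \<phi> :: "nat \<Rightarrow> real"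
  assumes pos: "\<And>n. \<phi> n > 0" and mono: "mono \<phi>"
    and lim: "limsup (\<lambda>k. ereal ((real (card (endpoint_set nk (msb (nk k)))))\<^sup>2 / \<phi> (msb (nk k)))) = \<infinity>"
  shows "\<exists>F\<in>hardy_space (1/2). Lp_norm (1/2) (weighted_fejer_max nk \<phi> F) = \<infinity>"
proof -
  define A where "A s = real (card (endpoint_set nk s))" for s
  \<comment> \<open>What the lower bound requires at stage \<open>j\<close>: 2 for the exceptional
    endpoints, a term for the earlier spikes of size of order \<open>4 ^ p\<close>, and a term that
    leaves \<open>j\<close> after division by the root of \<open>\<phi>\<close>.\<close>
  define Q where "Q j p = (2 + 64 * 2 ^ j * 2 ^ p) / sqrt (\<phi> 0) + 32 * 2 ^ j * real j" for j p :: nat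
  define pick where "pick j p = (SOME s. s > p \<and> (Q j p)\<^sup>2 \<le> (A s)\<^sup>2 / \<phi> s)" for j p
  have pick: "pick j p > p" "(Q j p)\<^sup>2 \<le> (A (pick j p))\<^sup>2 / \<phi> (pick j p)" for j p
  proof -
    have "\<exists>s>p. (Q j p)\<^sup>2 \<le> (A s)\<^sup>2 / \<phi> s"
      unfolding A_def by (rule unbounded_selection[OF lim])
    from someI_ex[OF this] show "pick j p > p" "(Q j p)\<^sup>2 \<le> (A (pick j p))\<^sup>2 / \<phi> (pick j p)"
      unfolding pick_def by auto
  qed
  \<comment> \<open>Each scale is chosen after its predecessor, since its threshold depends on the
    size of the earlier spikes; the first one uses 0 as predecessor.\<close>
  define s where "s = rec_nat (pick 0 0) (\<lambda>j p. pick (Suc j) p)"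
  define prev where "prev j = (case j of 0 \<Rightarrow> 0 | Suc i \<Rightarrow> s i)" for j
  have s: "s j = pick j (prev j)" for j
    unfolding s_def prev_def by (cases j) auto
  have smono: "strict_mono s"
    unfolding strict_mono_Suc_iff using s pick(1) by (metis prev_def nat.case(2))
  define F where "F n x = spike_sum s n (prefix_code n x)" for n x
  interpret dyadic_tree "spike_sum s" by (rule spike_sum_tree[OF smono])
  define J where "J = (\<integral>\<^sup>+x. epowr (weighted_fejer_max nk \<phi> F x) (1 / 2) \<partial>haar)"
  have "ennreal (real j) \<le> J" for j
  proof -
    define w where "w = sqrt (\<phi> (s j))"
    have w: "w > 0" "sqrt (\<phi> 0) \<le> w"
      unfolding w_def using pos monoD[OF mono, of 0 "s j"] by auto
    have A: "Q j (prev j) * w \<le> A (s j)"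
    proof (rule power2_le_imp_le)
      have "(Q j (prev j))\<^sup>2 * \<phi> (s j) \<le> (A (s j))\<^sup>2"
        using pick(2)[of j "prev j"] pos[of "s j"] unfolding s[symmetric] by (simp add: field_simps)
      then show "(Q j (prev j) * w)\<^sup>2 \<le> (A (s j))\<^sup>2"
        unfolding w_def using pos[of "s j"] by (simp add: power_mult_distrib less_imp_le)
    qed (simp add: A_def)
    \<comment> \<open>Monotonicity of \<open>\<phi>\<close> gives
      \<open>w / sqrt (\<phi> 0) \<ge> 1\<close>, so a threshold fixed before \<open>s j\<close> is
      known suffices.\<close>
    have "(2 + 64 * 2 ^ j * 2 ^ prev j) * 1 \<le> (2 + 64 * 2 ^ j * 2 ^ prev j) * (w / sqrt (\<phi> 0))"
      using w(2) pos[of 0] by (intro mult_left_mono) (auto simp: le_divide_eq)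
    then have "2 + 64 * 2 ^ j * 2 ^ prev j + 32 * 2 ^ j * (real j * w) \<le> Q j (prev j) * w"
      unfolding Q_def by (simp add: distrib_right mult.assoc)
    also have "\<dots> \<le> A (s j)" by (rule A)
    also have "A (s j) \<le> 2 + 2 * real (card (gap_set nk (s j)))"
      unfolding A_def using card_endpoint_set_le[of nk "s j"]
      by (metis (mono_tags, opaque_lifting) of_nat_add of_nat_le_iff of_nat_mult of_nat_numeral)
    finally have "2 ^ j * (32 * 2 ^ prev j + 16 * (real j * w)) \<le> real (card (gap_set nk (s j)))"
      by (simp add: algebra_simps)
    then have c: "32 * 2 ^ prev j + 16 * (real j * w) \<le> (1 / 2) ^ j * real (card (gap_set nk (s j)))"
      by (simp add: field_simps power_one_over)
    have sq: "sqrt ((1 / 4) ^ j) = (1 / 2) ^ j"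
      by (simp add: real_sqrt_power real_sqrt_divide)
    have sq2: "sqrt (2 * (2 * 4 ^ prev j)) = 2 * 2 ^ prev j"
      by (simp add: real_sqrt_mult real_sqrt_power)
    have "real j * w \<le> sqrt ((1 / 4) ^ j) * real (card (gap_set nk (s j))) / 16 - sqrt (2 * (2 * 4 ^ prev j))"
      unfolding sq sq2 using c by simp
    then have "real j \<le> (sqrt ((1 / 4) ^ j) * real (card (gap_set nk (s j))) / 16
        - sqrt (2 * (2 * 4 ^ prev j))) / sqrt (\<phi> (s j))"
      unfolding w_def[symmetric] using w(1) by (simp only: le_divide_eq if_True)
    then have "ennreal (real j) \<le> ennreal \<dots>" by (rule ennreal_leI)
    also have "\<dots> \<le> J"
      unfolding J_def F_def
    proof (rule nn_integral_weighted_fejer_max_ge[where v = "(1 / 4) ^ j" and b = "2 * 4 ^ prev j"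
          and u = "\<lambda>c. \<Sum>i<j. (1 / 4) ^ i * spike (s i) c"])
      \<comment> \<open>At level \<open>Suc (s j)\<close> no later spike has entered.\<close>
      show "spike_sum s (Suc (s j)) c = (\<Sum>i<j. (1 / 4) ^ i * spike (s i) c) + (1 / 4) ^ j * spike (s j) c" for c
      proof -
        have "{i. s i < Suc (s j)} = {..<Suc j}"
          using smono by (auto simp: less_Suc_eq_le strict_mono_less_eq)
        then show ?thesis unfolding spike_sum_def by simp
      qed
      show "\<bar>\<Sum>i<j. (1 / 4) ^ i * spike (s i) c\<bar> \<le> 2 * 4 ^ prev j" for c
        unfolding prev_def by (rule sum_spikes_bound[OF smono])
    qed (use pos in auto)
    finally show ?thesis .
  qed
  then have "J = \<top>"
    using ennreal_Ex_less_of_nat[of J] by (metis ennreal_of_nat_eq_real_of_nat not_less top.not_eq_extremum)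
  then have "Lp_norm (1/2) (weighted_fejer_max nk \<phi> F) = \<infinity>"
    unfolding Lp_norm_half J_def by simp
  then show ?thesis
    using spike_sum_in_hardy_space[OF smono] unfolding F_def by blast
qed

theorem theorem1:
  fixes nk :: "nat \<Rightarrow> nat"
  assumes "\<And>k. nk k > 0"
  shows "bounded_hardy_Lp (1/2)
           (weighted_fejer_max nk (\<lambda>s. (real (card (endpoint_set nk s)))\<^sup>2))
       \<and> (\<forall>\<phi> :: nat \<Rightarrow> real.
            (SUP k. ereal (real (card (endpoint_set nk (msb (nk k)))))) = \<infinity> \<and>
            (\<forall>n. \<phi> n > 0) \<and> mono \<phi> \<and>
            limsup (\<lambda>k. ereal ((real (card (endpoint_set nk (msb (nk k)))))\<^sup>2
                                 / \<phi> (msb (nk k)))) = \<infinity>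
            \<longrightarrow>
            (\<exists>F\<in>hardy_space (1/2). Lp_norm (1/2) (weighted_fejer_max nk \<phi> F) = \<infinity>) \<and>
            \<not> bounded_hardy_Lp (1/2) (weighted_fejer_max nk \<phi>))"
proof (intro conjI allI impI)
  show "bounded_hardy_Lp (1/2) (weighted_fejer_max nk (\<lambda>s. (real (card (endpoint_set nk s)))\<^sup>2))"
    using assms by (rule bounded_weighted_fejer_max)
next
  fix \<phi> :: "nat \<Rightarrow> real"
  assume *: "(SUP k. ereal (real (card (endpoint_set nk (msb (nk k)))))) = \<infinity> \<and>
    (\<forall>n. \<phi> n > 0) \<and> mono \<phi> \<and>
    limsup (\<lambda>k. ereal ((real (card (endpoint_set nk (msb (nk k)))))\<^sup>2 / \<phi> (msb (nk k)))) = \<infinity>"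
  show ex: "\<exists>F\<in>hardy_space (1/2). Lp_norm (1/2) (weighted_fejer_max nk \<phi> F) = \<infinity>"
    by (rule sharpness) (use * in auto)
  show "\<not> bounded_hardy_Lp (1/2) (weighted_fejer_max nk \<phi>)"
  proof
    assume "bounded_hardy_Lp (1/2) (weighted_fejer_max nk \<phi>)"
    then obtain C F where "F \<in> hardy_space (1/2)" "\<infinity> \<le> ennreal C * hardy_norm (1/2) F"
      using ex unfolding bounded_hardy_Lp_def by metis
    \<comment> \<open>A real constant times the finite Hardy norm of \<open>F\<close> cannot be
      infinite.\<close>
    then show False
      unfolding hardy_space_def by (simp add: top_unique ennreal_mult_eq_top_iff)
  qed
qed

end
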